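(* Let $\alpha_1,\alpha_2,\gamma_1,\gamma_2,\Gamma$ be real constants with $\Gamma>0$, $\alpha_1\neq 0$ and $\frac{2\alpha_2}{3\alpha_1}\notin\mathbf{Z}$. Let $s\ge1$, let $I$ be a closed interval containing $0$, and let $u\in C(I;H^{\frac12+}(\mathbf{T}))$ be a solution on $I$ to $$\partial_t u=\alpha_1\partial_x^3u+i\alpha_2\partial_x^2u+i\gamma_1|u|^2u+\gamma_2\partial_x(|u|^2u)-i\Gamma u\,\partial_x(|u|^2),\quad x\in\mathbf{T},\qquad u(0,\cdot)=u_0,$$ such that $u(t)\in H^s(\mathbf{T})$ for all $t\in I$ and $\sup_{t\in I}\|u(t)\|_{H^s}<\infty$. Then the following hold for any $T>0$. (i) If $I=[0,T]$, then $P_+u_0\in H^{s+\frac12-}(\mathbf{T})$. (ii) If $I=[-T,0]$, then $P_-u_0\in H^{s+\frac12-}(\mathbf{T})$. (iii) If $I=[-T,T]$, then $u(t)\in H^\infty(\mathbf{T})$ for every $t\in(-T,T)$, and $u_0$ satisfies $$\|u_0\|_{H^{\sigma}}\le C_1^{\sigma}R_1^{\sigma^2}\qquad\text{for every }\sigma\ge1,$$ where $C_1=C_1\big(\sup_{t\in I}\|u(t)\|_{H^1},\,\|u_0\|_{L^2}^{-1},\,T^{-1}\big)>0$ and $R_1>0$ are constants independent of $\sigma$.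
   Context: Notation: $\mathbf{T}=\mathbf{R}/2\pi\mathbf{Z}$; functions are complex-valued; $\hat f(k)=\frac1{\sqrt{2\pi}}\int_{\mathbf{T}}e^{-ikx}f(x)\,dx$ for $k\in\mathbf{Z}$; $\langle\xi\rangle=1+|\xi|$; $\|f\|_{H^s}=\|\langle k\rangle^s\hat f(k)\|_{\ell^2(\mathbf{Z})}$; $H^\infty=\bigcap_{s}H^s$. $P_\pm f(x)=\frac1{\sqrt{2\pi}}\sum_{k\in\mathbf{Z},\,\pm k>0}\hat f(k)e^{ikx}$. $x+$ (resp. $x-$) denotes a slightly bigger (resp. smaller) number than $x\in\mathbf{R}$: $u\in C(I;H^{\frac12+})$ means $u\in C(I;H^{\sigma_0})$ for some $\sigma_0>\frac12$, and $f\in H^{s+\frac12-}$ means $f\in H^{\sigma}$ for every $\sigma<s+\frac12$. Constants may also depend on the parameters $\alpha_j,\gamma_j,\Gamma$ of the equation. Notion of solution: Let $T>0$, $s\ge0$, $u_0\in H^s(\mathbf{T})$. A function $u$ is a solution of the Cauchy problem on $[0,T)$ if $u\in L^\infty_{loc}([0,T);H^s(\mathbf{T}))\cap L^3_{loc}([0,T)\times\mathbf{T})$, $\partial_x(|u|^2)\in L^1_{loc}([0,T);H^{-s}(\mathbf{T}))$, and for every $\phi\in C_0^\infty([0,T)\times\mathbf{T})$, $$-\int_0^T\!\!\int_{\mathbf{T}}u\,\partial_t\phi\,dx\,dt-\int_{\mathbf{T}}u_0\phi(0,\cdot)\,dx=\int_0^T\!\!\int_{\mathbf{T}}\big[u(-\alpha_1\partial_x^3\phi+i\alpha_2\partial_x^2\phi)+|u|^2u(i\gamma_1\phi-\gamma_2\partial_x\phi)\big]dx\,dt-i\Gamma\int_0^T\langle\partial_x(|u|^2)(t),u(t)\phi(t)\rangle_{H^{-s},H^s}\,dt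 .$$ A function $u$ is a solution on the closed interval $[0,T]$ if $u\in C([0,T];H^{s}(\mathbf{T}))$ for some $s>1/2$ and $u|_{[0,T)}$ is a solution on $[0,T)$, that is, $u|_{[0,T)}\in L^\infty_{loc}([0,T);H^s(\mathbf{T}))\cap L^3_{loc}([0,T)\times\mathbf{T})$, $\partial_x(|u|^2)\in L^1_{loc}([0,T);H^{-s}(\mathbf{T}))$, and the displayed integral identity holds for every $\phi\in C_0^\infty([0,T)\times\mathbf{T})$. Solutions on $(-T,0]$ and $[-T,0]$ are defined in a similar manner (with test functions in $C_0^\infty((-T,0]\times\mathbf{T})$, time integrals over $(-T,0)$, and the term $-\int_{\mathbf{T}}u_0\phi(0,\cdot)\,dx$ replaced by $+\int_{\mathbf{T}}u_0\phi(0,\cdot)\,dx$). A solution on $[-T,T]$ is a function whose restrictions to $[0,T]$ and $[-T,0]$ are solutions there with the same $u_0$. *)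

theory Defs
  imports "HOL-Analysis.Analysis"
begin

text \<open>
  Functions on the torus \<open>\<real> / 2\<pi>\<int>\<close> are \<open>2\<pi>\<close>-periodic functions \<open>real \<Rightarrow> complex\<close> and are integrated
  over one period. Only their values almost everywhere matter below. A space-time function
  is written \<open>u t x\<close>. A periodic distribution (needed for Sobolev spaces of negative order)
  is represented by its sequence of Fourier coefficients \<open>int \<Rightarrow> complex\<close>.
\<close>

abbreviation torus :: "real set" where
  "torus \<equiv> {0..2 * pi}"

definition fourier :: "(real \<Rightarrow> complex) \<Rightarrow> int \<Rightarrow> complex" where
  "fourier f k = of_real (1 / sqrt (2 * pi)) *
     (LINT x:torus|lebesgue. exp (- \<i> * of_int k * of_real x) * f x)"

definition bracket :: "real \<Rightarrow> real" where
  "bracket \<xi> = 1 + \<bar>\<xi>\<bar>"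


subsection \<open>Sobolev spaces\<close>

definition sobolev_seq :: "real \<Rightarrow> (int \<Rightarrow> complex) set" where
  "sobolev_seq s = {c. (\<lambda>k. (bracket (of_int k) powr s * cmod (c k))\<^sup>2) summable_on UNIV}"

definition sobolev_seq_norm :: "real \<Rightarrow> (int \<Rightarrow> complex) \<Rightarrow> real" where
  "sobolev_seq_norm s c = sqrt (\<Sum>\<^sub>\<infinity>k. (bracket (of_int k) powr s * cmod (c k))\<^sup>2)"

text \<open>
  \<open>sobolev s\<close> consists of the integrable functions on the torus which, as distributions, belong
  to \<open>H\<^sup>s\<close>. For \<open>s \<ge> 0\<close> this is all of \<open>H\<^sup>s\<close>, and its members are then square integrable.
\<close>

definition sobolev :: "real \<Rightarrow> (real \<Rightarrow> complex) set" where
  "sobolev s = {f. (\<forall>x. f (x + 2 * pi) = f x) \<and> set_integrable lebesgue torus f \<and>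
                   fourier f \<in> sobolev_seq s}"

definition sobolev_norm :: "real \<Rightarrow> (real \<Rightarrow> complex) \<Rightarrow> real" where
  "sobolev_norm s f = sobolev_seq_norm s (fourier f)"

definition sobolev_inf :: "(real \<Rightarrow> complex) set" where
  "sobolev_inf = (\<Inter>s. sobolev s)"

definition l2_norm :: "(real \<Rightarrow> complex) \<Rightarrow> real" where
  "l2_norm f = sqrt (LINT x:torus|lebesgue. (cmod (f x))\<^sup>2)"

text \<open>
  The duality pairing of \<open>H\<^sup>-\<^sup>s\<close> and \<open>H\<^sup>s\<close>, in terms of Fourier coefficients. It is the bilinear
  (not sesquilinear) extension of \<open>\<integral> F g dx\<close>, since the weak formulation below arises by
  multiplication with a test function without conjugation.
\<close>

definition pairing :: "(int \<Rightarrow> complex) \<Rightarrow> (int \<Rightarrow> complex) \<Rightarrow> complex" where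
  "pairing F g = (\<Sum>\<^sub>\<infinity>k. F k * g (- k))"

text \<open>
  The projections are applied to functions in \<open>H\<^sup>\<sigma>\<close> with \<open>\<sigma> > 1/2\<close> only; for these the series
  converge absolutely at every point.
\<close>

definition P_plus :: "(real \<Rightarrow> complex) \<Rightarrow> real \<Rightarrow> complex" where
  "P_plus f x = of_real (1 / sqrt (2 * pi)) *
     (\<Sum>\<^sub>\<infinity>k\<in>{0<..}. fourier f k * exp (\<i> * of_int k * of_real x))"

definition P_minus :: "(real \<Rightarrow> complex) \<Rightarrow> real \<Rightarrow> complex" where
  "P_minus f x = of_real (1 / sqrt (2 * pi)) *
     (\<Sum>\<^sub>\<infinity>k\<in>{..<0}. fourier f k * exp (\<i> * of_int k * of_real x))"


subsection \<open>Spaces of time-dependent functions\<close>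

definition C_sobolev :: "real set \<Rightarrow> real \<Rightarrow> (real \<Rightarrow> real \<Rightarrow> complex) set" where
  "C_sobolev I s = {u. (\<forall>t\<in>I. u t \<in> sobolev s) \<and>
     (\<forall>t\<in>I. ((\<lambda>t'. sobolev_norm s (\<lambda>x. u t' x - u t x)) \<longlongrightarrow> 0) (at t within I))}"

text \<open>
  In the next two definitions measurability in time is required coefficientwise; as \<open>H\<^sup>s\<close> is
  a separable Hilbert space, this is strong measurability.
\<close>

definition Linf_loc_sobolev :: "real set \<Rightarrow> real \<Rightarrow> (real \<Rightarrow> real \<Rightarrow> complex) set" where
  "Linf_loc_sobolev J s = {u.
     (\<forall>k. set_borel_measurable lebesgue J (\<lambda>t. fourier (u t) k)) \<and>
     (\<forall>K. compact K \<and> K \<subseteq> J \<longrightarrow>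
        (\<exists>M. AE t in lebesgue. t \<in> K \<longrightarrow> u t \<in> sobolev s \<and> sobolev_norm s (u t) \<le> M))}"

definition L1_loc_sobolev_seq :: "real set \<Rightarrow> real \<Rightarrow> (real \<Rightarrow> int \<Rightarrow> complex) set" where
  "L1_loc_sobolev_seq J s = {F.
     (\<forall>k. set_borel_measurable lebesgue J (\<lambda>t. F t k)) \<and>
     (AE t in lebesgue. t \<in> J \<longrightarrow> F t \<in> sobolev_seq s) \<and>
     (\<forall>K. compact K \<and> K \<subseteq> J \<longrightarrow> set_integrable lebesgue K (\<lambda>t. sobolev_seq_norm s (F t)))}"

definition L3_loc :: "real set \<Rightarrow> (real \<Rightarrow> real \<Rightarrow> complex) set" where
  "L3_loc J = {u.
     set_borel_measurable lebesgue (J \<times> torus) (\<lambda>(t, x). u t x) \<and>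
     (\<forall>K. compact K \<and> K \<subseteq> J \<longrightarrow>
        set_integrable lebesgue (K \<times> torus) (\<lambda>(t, x). (cmod (u t x)) ^ 3))}"


subsection \<open>Test functions\<close>

definition partial_t :: "(real \<Rightarrow> real \<Rightarrow> complex) \<Rightarrow> real \<Rightarrow> real \<Rightarrow> complex" where
  "partial_t \<phi> t x = vector_derivative (\<lambda>t'. \<phi> t' x) (at t)"

definition partial_x :: "(real \<Rightarrow> real \<Rightarrow> complex) \<Rightarrow> real \<Rightarrow> real \<Rightarrow> complex" where
  "partial_x \<phi> t x = vector_derivative (\<lambda>x'. \<phi> t x') (at x)"

primrec C_k :: "nat \<Rightarrow> (real \<Rightarrow> real \<Rightarrow> complex) \<Rightarrow> bool" where
  "C_k 0 \<phi> \<longleftrightarrow> continuous_on UNIV (\<lambda>(t, x). \<phi> t x)"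
| "C_k (Suc n) \<phi> \<longleftrightarrow> continuous_on UNIV (\<lambda>(t, x). \<phi> t x) \<and>
     (\<forall>t x. (\<lambda>t'. \<phi> t' x) differentiable (at t)) \<and>
     (\<forall>t x. (\<lambda>x'. \<phi> t x') differentiable (at x)) \<and>
     C_k n (partial_t \<phi>) \<and> C_k n (partial_x \<phi>)"

text \<open>
  Smooth functions on \<open>J\<close> times the torus with compact support there. If \<open>J\<close> contains an
  endpoint, smoothness up to that endpoint means, as usual, being the restriction of a
  smooth function; the elements are such smooth extensions to all times, and their values
  outside \<open>J\<close> are irrelevant.
\<close>

definition test_fun :: "real set \<Rightarrow> (real \<Rightarrow> real \<Rightarrow> complex) set" where
  "test_fun J = {\<phi>. (\<forall>n. C_k n \<phi>) \<and> (\<forall>t x. \<phi> t (x + 2 * pi) = \<phi> t x) \<and>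
     (\<exists>K. compact K \<and> K \<subseteq> J \<and> (\<forall>t\<in>J - K. \<forall>x. \<phi> t x = 0))}"


subsection \<open>Solutions\<close>

text \<open>The Fourier coefficients of the distribution \<open>\<partial>\<^sub>x (\<bar>u(t)\<bar>\<^sup>2)\<close>.\<close>

definition dx_sq :: "(real \<Rightarrow> real \<Rightarrow> complex) \<Rightarrow> real \<Rightarrow> int \<Rightarrow> complex" where
  "dx_sq u t k = \<i> * of_int k * fourier (\<lambda>x. of_real ((cmod (u t x))\<^sup>2)) k"

text \<open>
  The time interval is \<open>J = [0,T)\<close> with \<open>\<epsilon> = 1\<close>, or \<open>J = (-T,0]\<close> with \<open>\<epsilon> = -1\<close>; \<open>\<epsilon>\<close> is the sign
  of the boundary term at \<open>t = 0\<close>.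
\<close>

definition weak_identity ::
  "real \<Rightarrow> real \<Rightarrow> real \<Rightarrow> real \<Rightarrow> real \<Rightarrow> real set \<Rightarrow> real \<Rightarrow>
   (real \<Rightarrow> complex) \<Rightarrow> (real \<Rightarrow> real \<Rightarrow> complex) \<Rightarrow> (real \<Rightarrow> real \<Rightarrow> complex) \<Rightarrow> bool" where
  "weak_identity \<alpha>\<^sub>1 \<alpha>\<^sub>2 \<gamma>\<^sub>1 \<gamma>\<^sub>2 \<Gamma> J \<epsilon> u\<^sub>0 u \<phi> \<longleftrightarrow>
     - set_lebesgue_integral lebesgue (J \<times> torus) (\<lambda>(t, x). u t x * partial_t \<phi> t x)
     - of_real \<epsilon> * (LINT x:torus|lebesgue. u\<^sub>0 x * \<phi> 0 x)
     = set_lebesgue_integral lebesgue (J \<times> torus) (\<lambda>(t, x).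
         u t x * (- of_real \<alpha>\<^sub>1 * partial_x (partial_x (partial_x \<phi>)) t x
                  + \<i> * of_real \<alpha>\<^sub>2 * partial_x (partial_x \<phi>) t x)
         + of_real ((cmod (u t x))\<^sup>2) * u t x *
             (\<i> * of_real \<gamma>\<^sub>1 * \<phi> t x - of_real \<gamma>\<^sub>2 * partial_x \<phi> t x))
     - \<i> * of_real \<Gamma> *
         (LINT t:J|lebesgue. pairing (dx_sq u t) (fourier (\<lambda>x. u t x * \<phi> t x)))"

definition solution_half_open ::
  "real \<Rightarrow> real \<Rightarrow> real \<Rightarrow> real \<Rightarrow> real \<Rightarrow> real set \<Rightarrow> real \<Rightarrow> real \<Rightarrow>
   (real \<Rightarrow> complex) \<Rightarrow> (real \<Rightarrow> real \<Rightarrow> complex) \<Rightarrow> bool" where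
  "solution_half_open \<alpha>\<^sub>1 \<alpha>\<^sub>2 \<gamma>\<^sub>1 \<gamma>\<^sub>2 \<Gamma> J \<epsilon> s u\<^sub>0 u \<longleftrightarrow>
     u\<^sub>0 \<in> sobolev s \<and>
     u \<in> Linf_loc_sobolev J s \<inter> L3_loc J \<and>
     dx_sq u \<in> L1_loc_sobolev_seq J (- s) \<and>
     (\<forall>\<phi>\<in>test_fun J. weak_identity \<alpha>\<^sub>1 \<alpha>\<^sub>2 \<gamma>\<^sub>1 \<gamma>\<^sub>2 \<Gamma> J \<epsilon> u\<^sub>0 u \<phi>)"

definition solution_forward ::
  "real \<Rightarrow> real \<Rightarrow> real \<Rightarrow> real \<Rightarrow> real \<Rightarrow> real \<Rightarrow>
   (real \<Rightarrow> complex) \<Rightarrow> (real \<Rightarrow> real \<Rightarrow> complex) \<Rightarrow> bool" where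
  "solution_forward \<alpha>\<^sub>1 \<alpha>\<^sub>2 \<gamma>\<^sub>1 \<gamma>\<^sub>2 \<Gamma> T u\<^sub>0 u \<longleftrightarrow>
     (\<exists>s>1/2. u \<in> C_sobolev {0..T} s \<and>
        solution_half_open \<alpha>\<^sub>1 \<alpha>\<^sub>2 \<gamma>\<^sub>1 \<gamma>\<^sub>2 \<Gamma> {0..<T} 1 s u\<^sub>0 u)"

definition solution_backward ::
  "real \<Rightarrow> real \<Rightarrow> real \<Rightarrow> real \<Rightarrow> real \<Rightarrow> real \<Rightarrow>
   (real \<Rightarrow> complex) \<Rightarrow> (real \<Rightarrow> real \<Rightarrow> complex) \<Rightarrow> bool" where
  "solution_backward \<alpha>\<^sub>1 \<alpha>\<^sub>2 \<gamma>\<^sub>1 \<gamma>\<^sub>2 \<Gamma> T u\<^sub>0 u \<longleftrightarrow>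
     (\<exists>s>1/2. u \<in> C_sobolev {-T..0} s \<and>
        solution_half_open \<alpha>\<^sub>1 \<alpha>\<^sub>2 \<gamma>\<^sub>1 \<gamma>\<^sub>2 \<Gamma> {-T<..0} (- 1) s u\<^sub>0 u)"

definition solution_two_sided ::
  "real \<Rightarrow> real \<Rightarrow> real \<Rightarrow> real \<Rightarrow> real \<Rightarrow> real \<Rightarrow>
   (real \<Rightarrow> complex) \<Rightarrow> (real \<Rightarrow> real \<Rightarrow> complex) \<Rightarrow> bool" where
  "solution_two_sided \<alpha>\<^sub>1 \<alpha>\<^sub>2 \<gamma>\<^sub>1 \<gamma>\<^sub>2 \<Gamma> T u\<^sub>0 u \<longleftrightarrow>
     solution_forward \<alpha>\<^sub>1 \<alpha>\<^sub>2 \<gamma>\<^sub>1 \<gamma>\<^sub>2 \<Gamma> T u\<^sub>0 u \<and>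
     solution_backward \<alpha>\<^sub>1 \<alpha>\<^sub>2 \<gamma>\<^sub>1 \<gamma>\<^sub>2 \<Gamma> T u\<^sub>0 u"

definition regular_on :: "real set \<Rightarrow> real \<Rightarrow> (real \<Rightarrow> real \<Rightarrow> complex) \<Rightarrow> bool" where
  "regular_on I s u \<longleftrightarrow>
     (\<exists>\<sigma>>1/2. u \<in> C_sobolev I \<sigma>) \<and>
     (\<forall>t\<in>I. u t \<in> sobolev s) \<and>
     bdd_above ((\<lambda>t. sobolev_norm s (u t)) ` I)"

end

theory Submission
  imports Defs
begin

text \<open>
  In terms of the Fourier coefficients \<open>c\<^sub>k\<close> the resonant part of \<open>- \<i>\<Gamma>u \<partial>\<^sub>x(|u|\<^sup>2)\<close> contains \<open>\<Gamma>kM c\<^sub>k\<close>,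
  where \<open>M = \<Sum>|c\<^sub>j|\<^sup>2\<close>: the equation is elliptic, and \<open>c\<^sub>k\<close> with \<open>k > 0\<close> can only stay bounded forward
  in time if it decays in \<open>k\<close>. All other interactions oscillate with the phase
  \<open>3\<alpha>\<^sub>1 (k - p)(k - q)(p + q + 2\<alpha>\<^sub>2/(3\<alpha>\<^sub>1))\<close>, whose last factor is bounded away from zero by assumption; one
  integration by parts in time (a normal form) gains enough to absorb the derivatives in the
  nonlinearity. Integrating against \<open>exp (- \<Gamma>kMt)\<close> then gives \<open>|c\<^sub>k(0)| \<le> C k\<^bsup>-s-1\<^esup>\<close>, with a bound that is
  linear in the \<open>H\<^sup>s\<close> norm and otherwise depends on the \<open>H\<^sup>1\<close> norm only. On a two-sided interval the
  reflection \<open>u(-t,-x)\<close> treats \<open>k < 0\<close>, and the gain is iterated on shrinking intervals.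
\<close>

subsection \<open>Square summable sequences and trilinear sums\<close>

text \<open>In each product the weight of order s goes to a single entry, and a surplus derivative
  is cancelled by the phase or moved to entries in H^1; hence the linearity, and the constants of
  successive steps simply multiply. The normal form gains exactly one power of k: the boundary term
  \<open>Bn\<close> carries it directly, whereas the quintic term \<open>Qn\<close> is merely
  bounded and receives it from the time integral of the exponential. The mass in the exponent is
  frozen at its initial value; the resulting error, of size k t, integrates to k / k^2. Only single
  coefficients are known to be differentiable in time, so the normal form is truncated to a finite
  box, and the truncation is removed at the end by bounds that are uniform in it. Passing from a
  pointwise bound of order s + 1 to l^2 costs more than half a derivative, hence steps of 1/4. About
  4 \<sigma> of them are needed, each with a factor exponential in its index, and the product has
  the form C^\<sigma> R^(\<sigma>^2). The rate degenerates with the mass, which is why the constant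
  involves the inverse of the L^2 norm.\<close>

definition jbr :: "int \<Rightarrow> real" where
  "jbr k = bracket (real_of_int k)"

lemma jbr_ge1: "1 \<le> jbr k" and jbr_pos: "0 < jbr k" and jbr_nonneg: "0 \<le> jbr k"
  and jbr_nz: "jbr k \<noteq> 0"
  by (auto simp: jbr_def bracket_def)

lemma jbr_minus [simp]: "jbr (- k) = jbr k"
  by (simp add: jbr_def bracket_def)

text \<open>An l^2 bound tested on finite sets: it has no summability side condition, passes to
  smaller sequences and to injective reindexings, and gives back summability together with the bound
  when that is wanted.\<close>

definition l2b :: "(int \<Rightarrow> real) \<Rightarrow> real \<Rightarrow> bool" where
  "l2b f A \<longleftrightarrow> (\<forall>j. 0 \<le> f j) \<and> (\<forall>S. finite S \<longrightarrow> L2_set f S \<le> A)"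

definition l1b :: "(int \<Rightarrow> real) \<Rightarrow> real \<Rightarrow> bool" where
  "l1b f A \<longleftrightarrow> (\<forall>j. 0 \<le> f j) \<and> (\<forall>S. finite S \<longrightarrow> sum f S \<le> A)"

lemma l2b_nonneg: "l2b f A \<Longrightarrow> 0 \<le> f j"
  by (simp add: l2b_def)

lemma l1b_nonneg: "l1b f A \<Longrightarrow> 0 \<le> f j"
  by (simp add: l1b_def)

lemma l2b_const_nonneg: "l2b f A \<Longrightarrow> 0 \<le> A"
  unfolding l2b_def by (metis L2_set_empty finite.emptyI)

lemma l1b_const_nonneg: "l1b f A \<Longrightarrow> 0 \<le> A"
  unfolding l1b_def by (metis sum.empty finite.emptyI)

lemma l2bD: "l2b f A \<Longrightarrow> finite S \<Longrightarrow> L2_set f S \<le> A"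
  by (simp add: l2b_def)

lemma l1bD: "l1b f A \<Longrightarrow> finite S \<Longrightarrow> sum f S \<le> A"
  by (simp add: l1b_def)

lemma l2b_pt: "l2b f A \<Longrightarrow> f j \<le> A"
  using l2bD[of f A "{j}"] l2b_nonneg[of f A j] by (simp add: L2_set_def)

lemma l2b_mono:
  assumes "l2b f A" "\<And>j. 0 \<le> g j" "\<And>j. g j \<le> f j" "A \<le> B"
  shows "l2b g B"
  unfolding l2b_def
proof (intro conjI allI impI)
  fix S :: "int set" assume "finite S"
  have "L2_set g S \<le> L2_set f S" by (rule L2_set_mono) (use assms in auto)
  also have "\<dots> \<le> A" using assms(1) \<open>finite S\<close> by (rule l2bD)
  finally show "L2_set g S \<le> B" using assms(4) by simp
qed (use assms in auto)

lemma L2_set_comp: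
  assumes "inj_on g I"
  shows "L2_set (\<lambda>i. f (g i)) I = L2_set f (g ` I)"
  using assms by (simp add: L2_set_def sum.reindex o_def)

lemma l2b_comp:
  assumes "l2b f A" "inj g"
  shows "l2b (\<lambda>j. f (g j)) A"
  unfolding l2b_def
proof (intro conjI allI impI)
  fix S :: "int set" assume "finite S"
  then show "L2_set (\<lambda>j. f (g j)) S \<le> A"
    using L2_set_comp[of g S f] assms by (metis finite_imageI inj_on_subset l2bD top_greatest)
qed (use assms l2b_nonneg in auto)

lemma l2b_add:
  assumes "l2b f A" "l2b g B"
  shows "l2b (\<lambda>j. f j + g j) (A + B)"
  unfolding l2b_def
proof (intro conjI allI impI)
  fix S :: "int set" assume "finite S"
  have "L2_set (\<lambda>j. f j + g j) S \<le> L2_set f S + L2_set g S" by (rule L2_set_triangle_ineq)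
  then show "L2_set (\<lambda>j. f j + g j) S \<le> A + B"
    using l2bD[OF assms(1) \<open>finite S\<close>] l2bD[OF assms(2) \<open>finite S\<close>] by simp
qed (use assms l2b_nonneg in \<open>auto intro: add_nonneg_nonneg\<close>)

lemma l2b_scale:
  assumes "l2b f A" "0 \<le> c"
  shows "l2b (\<lambda>j. c * f j) (c * A)"
  unfolding l2b_def
proof (intro conjI allI impI)
  fix S :: "int set" assume "finite S"
  then show "L2_set (\<lambda>j. c * f j) S \<le> c * A"
    using L2_set_right_distrib[OF assms(2), of f S] l2bD[OF assms(1) \<open>finite S\<close>] assms(2)
    by (metis mult_left_mono)
qed (use assms l2b_nonneg in auto)

lemma l2b_sym:
  assumes "l2b f A"
  shows "l2b (\<lambda>j. f j + f (- j)) (2 * A)"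
  using l2b_add[OF assms l2b_comp[OF assms, of uminus]] by simp

text \<open>The subtracted term makes the induction close: 2 / (n+2)^2 is at most 2 / (n+1) - 2 /
  (n+2).\<close>

lemma sum_inv_jbr_sq_interval: "(\<Sum>j\<in>{- int n..int n}. 1 / (jbr j)\<^sup>2) \<le> 3 - 2 / (real n + 1)"
proof (induction n)
  case 0
  then show ?case by (simp add: jbr_def bracket_def)
next
  case (Suc n)
  have eq: "{- int (Suc n)..int (Suc n)} = insert (int (Suc n)) (insert (- int (Suc n)) {- int n..int n})"
    by auto
  have "(\<Sum>j\<in>{- int (Suc n)..int (Suc n)}. 1 / (jbr j)\<^sup>2)
      = 2 / (real n + 2)\<^sup>2 + (\<Sum>j\<in>{- int n..int n}. 1 / (jbr j)\<^sup>2)"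
    unfolding eq by (simp add: jbr_def bracket_def add_ac)
  also have "\<dots> \<le> 2 / (real n + 2)\<^sup>2 + (3 - 2 / (real n + 1))" using Suc by simp
  also have "\<dots> \<le> 3 - 2 / (real (Suc n) + 1)"
    by (simp add: divide_simps power2_eq_square) (simp add: algebra_simps)
  finally show ?case .
qed

lemma finite_int_subset_interval:
  fixes S :: "int set"
  assumes "finite S"
  obtains n where "S \<subseteq> {- int n..int n}"
proof -
  have "finite (abs ` S)" using assms by simp
  then obtain m where m: "\<forall>x\<in>abs ` S. x \<le> m"
    using bdd_above_finite bdd_above_def by blast
  have "S \<subseteq> {- int (nat m)..int (nat m)}"
  proof
    fix x assume "x \<in> S"
    then have "\<bar>x\<bar> \<le> m" using m by auto
    then show "x \<in> {- int (nat m)..int (nat m)}" by auto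
  qed
  then show ?thesis using that by blast
qed

lemma l2b_inv_jbr: "l2b (\<lambda>j. 1 / jbr j) 2"
  unfolding l2b_def
proof (intro conjI allI impI)
  fix S :: "int set" assume "finite S"
  then obtain n where n: "S \<subseteq> {- int n..int n}" using finite_int_subset_interval by blast
  have "(\<Sum>j\<in>S. (1 / jbr j)\<^sup>2) = (\<Sum>j\<in>S. 1 / (jbr j)\<^sup>2)"
    by (simp add: power_divide)
  also have "\<dots> \<le> (\<Sum>j\<in>{- int n..int n}. 1 / (jbr j)\<^sup>2)"
    using n by (intro sum_mono2) auto
  also have "\<dots> \<le> 3 - 2 / (real n + 1)" by (rule sum_inv_jbr_sq_interval)
  also have "\<dots> \<le> 2\<^sup>2" by (simp add: divide_simps)
  finally show "L2_set (\<lambda>j. 1 / jbr j) S \<le> 2"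
    unfolding L2_set_def by (intro real_le_lsqrt) auto
qed (auto simp: jbr_def bracket_def)

lemma l2b_inv_jbr_shift: "l2b (\<lambda>j. 1 / jbr (k - j)) 2"
  using l2b_comp[OF l2b_inv_jbr, of "\<lambda>j. k - j"] by (simp add: inj_def)

lemma l1b_mult:
  assumes "l2b f A" "l2b g B"
  shows "l1b (\<lambda>j. f j * g j) (A * B)"
  unfolding l1b_def
proof (intro conjI allI impI)
  fix S :: "int set" assume "finite S"
  have "(\<Sum>j\<in>S. f j * g j) \<le> (\<Sum>j\<in>S. \<bar>f j\<bar> * \<bar>g j\<bar>)"
    using assms by (intro sum_mono) (simp add: l2b_nonneg)
  also have "\<dots> \<le> L2_set f S * L2_set g S" by (rule L2_set_mult_ineq)
  also have "\<dots> \<le> A * B"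
    using l2bD[OF assms(1) \<open>finite S\<close>] l2bD[OF assms(2) \<open>finite S\<close>]
    by (intro mult_mono) (use assms l2b_const_nonneg in auto)
  finally show "(\<Sum>j\<in>S. f j * g j) \<le> A * B" .
qed (use assms l2b_nonneg in auto)

lemma sum_inj_prod_le:
  fixes F G :: "int \<Rightarrow> real"
  assumes "finite I" "inj_on (\<lambda>i. (a i, b i)) I" "\<And>x. 0 \<le> F x" "\<And>x. 0 \<le> G x"
  shows "(\<Sum>i\<in>I. F (a i) * G (b i)) \<le> (\<Sum>x\<in>a ` I. F x) * (\<Sum>y\<in>b ` I. G y)"
proof -
  have "(\<Sum>i\<in>I. F (a i) * G (b i)) = (\<Sum>(x, y)\<in>(\<lambda>i. (a i, b i)) ` I. F x * G y)"
    using assms(2) by (simp add: sum.reindex)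
  also have "\<dots> \<le> (\<Sum>(x, y)\<in>a ` I \<times> b ` I. F x * G y)"
    using assms by (intro sum_mono2) auto
  also have "\<dots> = (\<Sum>x\<in>a ` I. F x) * (\<Sum>y\<in>b ` I. G y)"
    by (simp add: sum_product sum.cartesian_product)
  finally show ?thesis .
qed

text \<open>A family of triples with sum \<open>k\<close>, each determined by two of its entries; the three entries play
  symmetric roles, so that every bound can be used after a cyclic permutation.\<close>

definition tri :: "int \<Rightarrow> 'i set \<Rightarrow> ('i \<Rightarrow> int) \<Rightarrow> ('i \<Rightarrow> int) \<Rightarrow> ('i \<Rightarrow> int) \<Rightarrow> bool" where
  "tri k I a b c \<longleftrightarrow> finite I \<and> inj_on (\<lambda>i. (a i, b i)) I \<and> (\<forall>i\<in>I. a i + b i + c i = k)"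

lemma tri_finite: "tri k I a b c \<Longrightarrow> finite I"
  by (simp add: tri_def)

lemma tri_sum: "tri k I a b c \<Longrightarrow> i \<in> I \<Longrightarrow> a i + b i + c i = k"
  by (simp add: tri_def)

lemma tri_swap: "tri k I a b c \<Longrightarrow> tri k I b a c"
  unfolding tri_def inj_on_def by (auto simp: add_ac)

lemma tri_rot: "tri k I a b c \<Longrightarrow> tri k I b c a"
  unfolding tri_def inj_on_def prod.inject
proof (intro conjI ballI impI; elim conjE)
  fix x y
  assume inj: "\<forall>x\<in>I. \<forall>y\<in>I. a x = a y \<and> b x = b y \<longrightarrow> x = y"
    and s: "\<forall>i\<in>I. a i + b i + c i = k" and xy: "x \<in> I" "y \<in> I" "b x = b y" "c x = c y"
  have "a x + b x + c x = k" "a y + b y + c y = k" using s xy by auto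
  then show "x = y" using inj xy by auto
qed (auto simp: add_ac)

lemma tri_pairs:
  assumes "finite F"
  shows "tri k F fst (\<lambda>i. k - fst i - snd i) snd"
  using assms unfolding tri_def inj_on_def by auto

section \<open>Trilinear bounds over families of triples\<close>

lemma tri_inj: "tri k I a b c \<Longrightarrow> inj_on (\<lambda>i. (a i, b i)) I"
  by (simp add: tri_def)

text \<open>Each of the first two factors meets its own weight in Cauchy-Schwarz, the weight having
  l^2 norm at most 2; the third entry is bounded by its supremum. Thus all three sequences need only
  lie in l^2, whereas without the weights one of them would have to be in l^1.\<close>

lemma weighted_sum_le:
  assumes "tri k I a b c" "l2b f A" "l2b g B" "l2b h C"
  shows "(\<Sum>i\<in>I. f (a i) * g (b i) * h (c i) / (jbr (k - a i) * jbr (k - b i))) \<le> 4 * A * B * C"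
proof -
  let ?F = "\<lambda>x. f x * (1 / jbr (k - x))" and ?G = "\<lambda>x. g x * (1 / jbr (k - x))"
  have f: "l1b ?F (A * 2)" and g: "l1b ?G (B * 2)"
    by (rule l1b_mult[OF assms(2) l2b_inv_jbr_shift] l1b_mult[OF assms(3) l2b_inv_jbr_shift])+
  have "(\<Sum>i\<in>I. f (a i) * g (b i) * h (c i) / (jbr (k - a i) * jbr (k - b i)))
      = (\<Sum>i\<in>I. ?F (a i) * ?G (b i) * h (c i))"
    by (intro sum.cong) auto
  also have "\<dots> \<le> (\<Sum>i\<in>I. ?F (a i) * ?G (b i) * C)"
    using l2b_nonneg[OF assms(2)] l2b_nonneg[OF assms(3)] l2b_pt[OF assms(4)] jbr_nonneg
    by (intro sum_mono mult_left_mono mult_nonneg_nonneg) auto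
  also have "\<dots> = (\<Sum>i\<in>I. ?F (a i) * ?G (b i)) * C" by (simp add: sum_distrib_right)
  also have "\<dots> \<le> ((\<Sum>x\<in>a ` I. ?F x) * (\<Sum>y\<in>b ` I. ?G y)) * C"
    using tri_finite[OF assms(1)] tri_inj[OF assms(1)] l1b_nonneg[OF f] l1b_nonneg[OF g]
      l2b_const_nonneg[OF assms(4)]
    by (intro mult_right_mono sum_inj_prod_le) auto
  also have "\<dots> \<le> ((A * 2) * (B * 2)) * C"
    using l1bD[OF f, of "a ` I"] l1bD[OF g, of "b ` I"] tri_finite[OF assms(1)]
      l2b_const_nonneg[OF assms(4)] l1b_const_nonneg[OF f] l1b_nonneg[OF g]
    by (intro mult_right_mono mult_mono) (auto intro: sum_nonneg)
  finally show ?thesis by (simp add: mult_ac)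
qed

text \<open>Once the first entry is fixed, either of the others determines the triple, so that
  Cauchy-Schwarz applies to the inner sum; the first entry is then summed in l^1.\<close>

lemma young_l1_l2_l2:
  assumes t: "tri k I a b c" and f: "l1b f A" and g: "l2b g B" and h: "l2b h C"
  shows "(\<Sum>i\<in>I. f (a i) * g (b i) * h (c i)) \<le> A * B * C"
proof -
  have fin: "finite I" using t by (rule tri_finite)
  have "(\<Sum>i\<in>I. f (a i) * g (b i) * h (c i))
      = (\<Sum>x\<in>a ` I. \<Sum>i\<in>{i\<in>I. a i = x}. f (a i) * g (b i) * h (c i))"
    using fin by (rule sum.image_gen)
  also have "\<dots> \<le> (\<Sum>x\<in>a ` I. f x * (B * C))"
  proof (rule sum_mono)
    fix x assume "x \<in> a ` I"
    let ?J = "{i\<in>I. a i = x}"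
    have fJ: "finite ?J" using fin by simp
    have ib: "inj_on b ?J" and ic: "inj_on c ?J"
      using tri_inj[OF t] tri_inj[OF tri_rot[OF tri_rot[OF t]]] unfolding inj_on_def by auto
    have "(\<Sum>i\<in>?J. f (a i) * g (b i) * h (c i)) = f x * (\<Sum>i\<in>?J. g (b i) * h (c i))"
      unfolding sum_distrib_left by (intro sum.cong) auto
    also have "(\<Sum>i\<in>?J. g (b i) * h (c i)) \<le> (\<Sum>i\<in>?J. \<bar>g (b i)\<bar> * \<bar>h (c i)\<bar>)"
      using l2b_nonneg[OF g] l2b_nonneg[OF h] by (intro sum_mono) auto
    also have "\<dots> \<le> L2_set (\<lambda>i. g (b i)) ?J * L2_set (\<lambda>i. h (c i)) ?J"
      by (rule L2_set_mult_ineq)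
    also have "\<dots> = L2_set g (b ` ?J) * L2_set h (c ` ?J)"
      using ib ic by (simp add: L2_set_comp)
    also have "\<dots> \<le> B * C"
      using l2bD[OF g, of "b ` ?J"] l2bD[OF h, of "c ` ?J"] fJ l2b_const_nonneg[OF g]
      by (intro mult_mono) auto
    finally show "(\<Sum>i\<in>?J. f (a i) * g (b i) * h (c i)) \<le> f x * (B * C)"
      using l1b_nonneg[OF f, of x] by (simp add: mult_left_mono)
  qed
  also have "\<dots> = (\<Sum>x\<in>a ` I. f x) * (B * C)" by (simp add: sum_distrib_right)
  also have "\<dots> \<le> A * (B * C)"
    using l1bD[OF f, of "a ` I"] fin l2b_const_nonneg[OF g] l2b_const_nonneg[OF h]
    by (intro mult_right_mono) auto
  finally show ?thesis by (simp add: mult_ac)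
qed

lemma young_l2_l1_l2: "tri k I a b c \<Longrightarrow> l2b f A \<Longrightarrow> l1b g B \<Longrightarrow> l2b h C \<Longrightarrow>
    (\<Sum>i\<in>I. f (a i) * g (b i) * h (c i)) \<le> A * B * C"
  using young_l1_l2_l2[OF tri_swap, of k I a b c g B f A h C] by (simp add: mult_ac)

lemma young_l1_l1_bounded:
  assumes t: "tri k I a b c" and f: "l1b f A" and g: "l1b g B" and h: "\<And>j. 0 \<le> h j" "\<And>j. h j \<le> C"
  shows "(\<Sum>i\<in>I. f (a i) * g (b i) * h (c i)) \<le> A * B * C"
proof -
  have C: "0 \<le> C" using h order_trans by blast
  have "(\<Sum>i\<in>I. f (a i) * g (b i) * h (c i)) \<le> (\<Sum>i\<in>I. f (a i) * g (b i) * C)"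
    using h l1b_nonneg[OF f] l1b_nonneg[OF g] by (intro sum_mono mult_left_mono) auto
  also have "\<dots> = (\<Sum>i\<in>I. f (a i) * g (b i)) * C" by (simp add: sum_distrib_right)
  also have "\<dots> \<le> ((\<Sum>x\<in>a ` I. f x) * (\<Sum>y\<in>b ` I. g y)) * C"
    using tri_finite[OF t] tri_inj[OF t] l1b_nonneg[OF f] l1b_nonneg[OF g] C
    by (intro mult_right_mono sum_inj_prod_le) auto
  also have "\<dots> \<le> (A * B) * C"
    using l1bD[OF f, of "a ` I"] l1bD[OF g, of "b ` I"] tri_finite[OF t] C
      l1b_const_nonneg[OF f] l1b_nonneg[OF g]
    by (intro mult_right_mono mult_mono) (auto intro: sum_nonneg)
  finally show ?thesis .
qed

text \<open>The size of the quotient of a nonlinear term by its phase.\<close>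

definition Wt :: "int \<Rightarrow> int \<Rightarrow> int \<Rightarrow> int \<Rightarrow> real" where
  "Wt k x y z = 1 / (jbr (k - x) * jbr (k - y)) + 1 / (jbr (k - x) * jbr (k - z))
      + 1 / (jbr (k - y) * jbr (k - z))"

lemma Wt_nonneg: "0 \<le> Wt k x y z"
  by (simp add: Wt_def jbr_def bracket_def)

lemma Wt_rot: "Wt k x y z = Wt k y z x"
  by (simp add: Wt_def mult_ac)

lemma Wt_le: "Wt k x y z \<le> 3"
proof -
  have "1 / (jbr i * jbr j) \<le> 1" for i j
    using mult_mono[OF jbr_ge1[of i] jbr_ge1[of j]] jbr_nonneg[of i]
    by (simp add: divide_simps jbr_pos)
  from this[of "k - x" "k - y"] this[of "k - x" "k - z"] this[of "k - y" "k - z"]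
  show ?thesis unfolding Wt_def by linarith
qed

lemma Wt_sum_le:
  assumes t: "tri k I a b c" and f: "l2b f A" and g: "l2b g B" and h: "l2b h C"
  shows "(\<Sum>i\<in>I. Wt k (a i) (b i) (c i) * (f (a i) * g (b i) * h (c i))) \<le> 12 * A * B * C"
proof -
  have "(\<Sum>i\<in>I. Wt k (a i) (b i) (c i) * (f (a i) * g (b i) * h (c i)))
      = (\<Sum>i\<in>I. f (a i) * g (b i) * h (c i) / (jbr (k - a i) * jbr (k - b i)))
      + (\<Sum>i\<in>I. h (c i) * f (a i) * g (b i) / (jbr (k - c i) * jbr (k - a i)))
      + (\<Sum>i\<in>I. g (b i) * h (c i) * f (a i) / (jbr (k - b i) * jbr (k - c i)))"
    unfolding Wt_def sum.distrib[symmetric]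
    by (intro sum.cong refl) (simp add: divide_inverse distrib_left distrib_right mult_ac)
  moreover note weighted_sum_le[OF t f g h] weighted_sum_le[OF tri_rot[OF tri_rot[OF t]] h f g]
    weighted_sum_le[OF tri_rot[OF t] g h f]
  ultimately show ?thesis by (simp add: mult_ac)
qed

text \<open>Every product in \<open>Wt\<close> contains \<open>jbr (k - y)\<close> or
  \<open>jbr (k - z)\<close>. The weight X is either cancelled by that factor, which leaves at most
  1 in each of the three terms, or paid for by the frequencies y and z.\<close>

lemma jbr_Wt_aux:
  assumes "0 \<le> X" "X \<le> jbr (k - y) + (jbr y + jbr z)" "X \<le> jbr (k - z) + (jbr y + jbr z)"
  shows "X * Wt k x y z \<le> 3 + (jbr y + jbr z) * Wt k x y z"
proof -
  have *: "X / (P * R) \<le> 1 + Y / (P * R)" if "X \<le> R + Y" "1 \<le> P" "1 \<le> R" for P R Y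
  proof -
    have "1 * R \<le> P * R" using that by (intro mult_right_mono) auto
    then have "X \<le> P * R + Y" using that by linarith
    then show ?thesis using that by (simp add: divide_simps)
  qed
  have "X * Wt k x y z = X / (jbr (k - x) * jbr (k - y)) + X / (jbr (k - x) * jbr (k - z))
      + X / (jbr (k - y) * jbr (k - z))"
    by (simp add: Wt_def distrib_left)
  moreover have "(jbr y + jbr z) * Wt k x y z
      = (jbr y + jbr z) / (jbr (k - x) * jbr (k - y)) + (jbr y + jbr z) / (jbr (k - x) * jbr (k - z))
      + (jbr y + jbr z) / (jbr (k - y) * jbr (k - z))"
    by (simp add: Wt_def distrib_left)
  ultimately show ?thesis
    using *[of "jbr (k - y)" "jbr y + jbr z" "jbr (k - x)"]
      *[of "jbr (k - z)" "jbr y + jbr z" "jbr (k - x)"]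
      *[of "jbr (k - z)" "jbr y + jbr z" "jbr (k - y)"] assms(2,3)
      jbr_ge1[of "k - x"] jbr_ge1[of "k - y"] jbr_ge1[of "k - z"]
    by linarith
qed

text \<open>Cauchy-Schwarz against \<open>1 / jbr\<close>: sequences in H^1 are absolutely
  summable.\<close>

lemma l2b_of_weight:
  assumes "l2b (\<lambda>j. jbr j * v j) V"
  shows "l2b v V" "l1b v (2 * V)"
proof -
  have v: "0 \<le> v j" for j
    using l2b_nonneg[OF assms, of j] jbr_pos[of j] by (simp add: zero_le_mult_iff)
  show "l2b v V"
    using mult_right_mono[OF jbr_ge1 v] v by (intro l2b_mono[OF assms]) auto
  have "l1b (\<lambda>j. 1 / jbr j * (jbr j * v j)) (2 * V)"
    by (rule l1b_mult[OF l2b_inv_jbr assms])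
  then show "l1b v (2 * V)" using jbr_nz by simp
qed

text \<open>X stands for a full derivative on the total or on the first frequency. It either cancels
  a denominator of the phase, leaving an l^2-l^1-l^2 sum, or is moved to one of the two H^1 entries.
  The first entry stays in l^2 in all cases, so that no derivative is asked of it.\<close>

lemma Wt_sum_weight_le:
  assumes t: "tri k I a b c" and f: "l2b f A" and v: "l2b (\<lambda>j. jbr j * v j) V"
    and X: "\<And>i. i \<in> I \<Longrightarrow> 0 \<le> X i" "\<And>i. i \<in> I \<Longrightarrow> X i \<le> jbr (k - b i) + (jbr (b i) + jbr (c i))"
      "\<And>i. i \<in> I \<Longrightarrow> X i \<le> jbr (k - c i) + (jbr (b i) + jbr (c i))"
  shows "(\<Sum>i\<in>I. X i * Wt k (a i) (b i) (c i) * (f (a i) * v (b i) * v (c i))) \<le> 30 * A * V\<^sup>2"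
proof -
  note v1 = l2b_of_weight[OF v]
  have nn: "0 \<le> f (a i) * v (b i) * v (c i)" for i
    using l2b_nonneg[OF f] l2b_nonneg[OF v1(1)] by auto
  have "(\<Sum>i\<in>I. X i * Wt k (a i) (b i) (c i) * (f (a i) * v (b i) * v (c i)))
     \<le> (\<Sum>i\<in>I. (3 + (jbr (b i) + jbr (c i)) * Wt k (a i) (b i) (c i)) * (f (a i) * v (b i) * v (c i)))"
    using X nn by (intro sum_mono mult_right_mono jbr_Wt_aux) auto
  also have "\<dots> = 3 * (\<Sum>i\<in>I. f (a i) * v (b i) * v (c i))
      + (\<Sum>i\<in>I. Wt k (a i) (b i) (c i) * (f (a i) * (jbr (b i) * v (b i)) * v (c i)))
      + (\<Sum>i\<in>I. Wt k (a i) (b i) (c i) * (f (a i) * v (b i) * (jbr (c i) * v (c i))))"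
    unfolding sum_distrib_left sum.distrib[symmetric]
    by (intro sum.cong refl) (simp add: algebra_simps)
  also have "\<dots> \<le> 3 * (A * (2 * V) * V) + 12 * A * V * V + 12 * A * V * V"
    using young_l2_l1_l2[OF t f v1(2) v1(1)] Wt_sum_le[OF t f v v1(1)] Wt_sum_le[OF t f v1(1) v]
    by (intro add_mono mult_left_mono) simp_all
  also have "\<dots> = 30 * A * V\<^sup>2" by (simp add: power2_eq_square)
  finally show ?thesis .
qed

lemma Wt_sum_total_le:
  assumes "tri k I a b c" "l2b f A" "l2b (\<lambda>j. jbr j * v j) V"
  shows "(\<Sum>i\<in>I. jbr k * Wt k (a i) (b i) (c i) * (f (a i) * v (b i) * v (c i))) \<le> 30 * A * V\<^sup>2"
  using assms
proof (rule Wt_sum_weight_le)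
  fix i
  show "jbr k \<le> jbr (k - b i) + (jbr (b i) + jbr (c i))"
    "jbr k \<le> jbr (k - c i) + (jbr (b i) + jbr (c i))"
    by (simp_all add: jbr_def bracket_def)
qed (rule jbr_nonneg)

lemma Wt_sum_first_le:
  assumes t: "tri k I a b c" and "l2b f A" "l2b (\<lambda>j. jbr j * v j) V"
  shows "(\<Sum>i\<in>I. jbr (a i) * Wt k (a i) (b i) (c i) * (f (a i) * v (b i) * v (c i))) \<le> 30 * A * V\<^sup>2"
  using assms
proof (rule Wt_sum_weight_le)
  fix i assume "i \<in> I"
  then have "a i = k - b i - c i" using tri_sum[OF t] by force
  then show "jbr (a i) \<le> jbr (k - b i) + (jbr (b i) + jbr (c i))"
    "jbr (a i) \<le> jbr (k - c i) + (jbr (b i) + jbr (c i))"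
    by (simp_all add: jbr_def bracket_def)
qed (rule jbr_nonneg)

section \<open>The cubic convolution as a majorant\<close>

definition conv3 :: "(int \<Rightarrow> real) \<Rightarrow> (int \<Rightarrow> real) \<Rightarrow> (int \<Rightarrow> real) \<Rightarrow> int \<Rightarrow> real" where
  "conv3 g h f j = (\<Sum>\<^sub>\<infinity>(x, y)\<in>UNIV. g x * h y * f (j - x - y))"

lemma conv3_summable:
  assumes "l1b g A" "l1b h B" "l2b f C"
  shows "(\<lambda>(x, y). g x * h y * f (j - x - y)) summable_on UNIV"
proof (rule nonneg_bdd_above_summable_on)
  show "bdd_above (sum (\<lambda>(x, y). g x * h y * f (j - x - y)) ` {F. F \<subseteq> UNIV \<and> finite F})"
  proof (rule bdd_aboveI2)
    fix F :: "(int \<times> int) set" assume "F \<in> {F. F \<subseteq> UNIV \<and> finite F}"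
    then have "finite F" by simp
    then have "tri j F fst snd (\<lambda>i. j - fst i - snd i)"
      unfolding tri_def inj_on_def by auto
    from young_l1_l1_bounded[OF this assms(1,2), of f C]
    show "(\<Sum>(x, y)\<in>F. g x * h y * f (j - x - y)) \<le> A * B * C"
      using l2b_nonneg[OF assms(3)] l2b_pt[OF assms(3)] by (simp add: case_prod_beta)
  qed
qed (use assms l2b_nonneg l1b_nonneg in auto)

text \<open>Bounds for finite families of triples become a bound by one fixed sequence in the output
  frequency, whose l^2 norm can be taken afterwards.\<close>

lemma tri_le_conv3:
  assumes t: "tri k I a b c" and g: "l1b g A" and h: "l1b h B" and f: "l2b f C"
  shows "(\<Sum>i\<in>I. g (a i) * h (b i) * f (c i)) \<le> conv3 g h f k"
proof -
  have "(\<Sum>i\<in>I. g (a i) * h (b i) * f (c i))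
      = (\<Sum>i\<in>I. (\<lambda>(x, y). g x * h y * f (k - x - y)) (a i, b i))"
  proof (rule sum.cong[OF refl])
    fix i assume "i \<in> I"
    then have "c i = k - a i - b i" using tri_sum[OF t] by force
    then show "g (a i) * h (b i) * f (c i) = (\<lambda>(x, y). g x * h y * f (k - x - y)) (a i, b i)"
      by simp
  qed
  also have "\<dots> = sum (\<lambda>(x, y). g x * h y * f (k - x - y)) ((\<lambda>i. (a i, b i)) ` I)"
    using tri_inj[OF t] by (simp add: sum.reindex)
  also have "\<dots> \<le> conv3 g h f k"
    unfolding conv3_def
    using tri_finite[OF t] g h f
    by (intro finite_sum_le_infsum conv3_summable) (auto simp: l1b_nonneg l2b_nonneg)
  finally show ?thesis .
qed

lemma L2_set_sum_le:
  assumes "finite F"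
  shows "L2_set (\<lambda>j. \<Sum>i\<in>F. f i j) S \<le> (\<Sum>i\<in>F. L2_set (f i) S)"
  using assms
proof (induction F rule: finite_induct)
  case empty
  then show ?case by (simp add: L2_set_def)
next
  case (insert x F)
  then show ?case
    using L2_set_triangle_ineq[of "f x" "\<lambda>j. \<Sum>i\<in>F. f i j" S] by simp
qed

text \<open>Minkowski's inequality for a finite set of shifts, followed by the limit over finite
  sets of pairs; over a finite set S the l^2 norm is continuous in the values.\<close>

lemma l2b_conv3:
  assumes g: "l1b g A" and h: "l1b h B" and f: "l2b f C"
  shows "l2b (conv3 g h f) (A * B * C)"
  unfolding l2b_def
proof (intro conjI allI impI)
  fix j
  show "0 \<le> conv3 g h f j"
    unfolding conv3_def using g h f by (intro infsum_nonneg) (auto simp: l1b_nonneg l2b_nonneg)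
next
  fix S :: "int set" assume S: "finite S"
  let ?T = "\<lambda>F j. \<Sum>i\<in>F. g (fst i) * h (snd i) * f (j - fst i - snd i)"
  have lim: "((\<lambda>F. ?T F j) \<longlongrightarrow> conv3 g h f j) (finite_subsets_at_top UNIV)" for j
    using has_sum_infsum[OF conv3_summable[OF g h f, of j]]
    unfolding has_sum_def conv3_def by (simp add: case_prod_beta')
  have "((\<lambda>F. L2_set (?T F) S) \<longlongrightarrow> L2_set (conv3 g h f) S) (finite_subsets_at_top UNIV)"
    unfolding L2_set_def by (intro tendsto_intros lim)
  moreover have "L2_set (?T F) S \<le> A * B * C" if F: "finite F" for F
  proof -
    have "L2_set (?T F) S
        \<le> (\<Sum>i\<in>F. L2_set (\<lambda>j. g (fst i) * h (snd i) * f (j - fst i - snd i)) S)"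
      using F by (rule L2_set_sum_le)
    also have "\<dots> \<le> (\<Sum>i\<in>F. g (fst i) * h (snd i) * C)"
    proof (rule sum_mono)
      fix i
      have gh: "0 \<le> g (fst i) * h (snd i)" using g h by (simp add: l1b_nonneg)
      have "inj (\<lambda>j::int. j - fst i - snd i)" by (simp add: inj_def)
      then have "L2_set (\<lambda>j. f (j - fst i - snd i)) S \<le> C"
        using l2bD[OF l2b_comp[OF f] S] by blast
      then show "L2_set (\<lambda>j. g (fst i) * h (snd i) * f (j - fst i - snd i)) S
          \<le> g (fst i) * h (snd i) * C"
        using L2_set_right_distrib[OF gh, of "\<lambda>j. f (j - fst i - snd i)" S] gh
        by (metis mult_left_mono)
    qed
    also have "\<dots> = (\<Sum>i\<in>F. g (fst i) * h (snd i)) * C" by (simp add: sum_distrib_right)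
    also have "\<dots> \<le> ((\<Sum>x\<in>fst ` F. g x) * (\<Sum>y\<in>snd ` F. h y)) * C"
      using F g h f l2b_const_nonneg
      by (intro mult_right_mono sum_inj_prod_le) (auto simp: l1b_nonneg)
    also have "\<dots> \<le> (A * B) * C"
      using l1bD[OF g, of "fst ` F"] l1bD[OF h, of "snd ` F"] F l2b_const_nonneg[OF f]
        l1b_const_nonneg[OF g] l1b_nonneg[OF h]
      by (intro mult_right_mono mult_mono) (auto intro: sum_nonneg)
    finally show ?thesis .
  qed
  ultimately show "L2_set (conv3 g h f) S \<le> A * B * C"
    by (intro tendsto_upperbound[OF _ _ finite_subsets_at_top_neq_bot])
       (auto intro: eventually_finite_subsets_at_top_weakI)
qed

subsection \<open>The cubic nonlinearity and its resonances\<close>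

text \<open>The factor \<open>3 powr s\<close> is the only way in which the constants of the later
  estimates depend on s; it enters the bound of the quintic term twice, which gives
  \<open>9 powr s\<close>.\<close>

lemma jbr_powr_add3_le:
  assumes "k = a + b + c" "0 \<le> s"
  shows "jbr k powr s \<le> 3 powr s * (jbr a powr s + jbr b powr s + jbr c powr s)"
proof -
  define m where "m = max (jbr a) (max (jbr b) (jbr c))"
  have "jbr a \<le> m" "jbr b \<le> m" "jbr c \<le> m" by (auto simp: m_def)
  moreover have "jbr k \<le> jbr a + jbr b + jbr c" unfolding assms(1) by (simp add: jbr_def bracket_def)
  ultimately have "jbr k \<le> 3 * m" by linarith
  then have "jbr k powr s \<le> (3 * m) powr s"
    using assms(2) jbr_nonneg by (intro powr_mono2) auto
  also have "\<dots> = 3 powr s * m powr s"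
    using jbr_nonneg[of a] by (subst powr_mult) (auto simp: m_def)
  also have "m powr s \<le> jbr a powr s + jbr b powr s + jbr c powr s"
    unfolding m_def max_def by auto
  finally show ?thesis by simp
qed

lemma infsum_tail_bound:
  fixes f :: "'a \<Rightarrow> complex"
  assumes fin: "finite F" and b: "\<And>G. finite G \<Longrightarrow> G \<inter> F = {} \<Longrightarrow> (\<Sum>i\<in>G. cmod (f i)) \<le> \<epsilon>"
  shows "f summable_on UNIV" "cmod (infsum f UNIV - sum f F) \<le> \<epsilon>"
proof -
  have abs: "(\<lambda>i. cmod (f i)) summable_on (- F)"
    by (rule nonneg_bdd_above_summable_on) (auto intro!: bdd_aboveI2[where M = \<epsilon>] b)
  then have s1: "f summable_on (- F)" by (rule abs_summable_summable)
  have sF: "f summable_on F" using fin by (rule summable_on_finite)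
  have u: "infsum f (F \<union> - F) = infsum f F + infsum f (- F)"
    by (rule infsum_Un_disjoint[OF sF s1]) auto
  have "f summable_on (F \<union> - F)"
    by (rule summable_on_Un_disjoint[OF sF s1]) auto
  then show "f summable_on UNIV" by (simp add: Compl_partition)
  have "infsum f UNIV - sum f F = infsum f (- F)"
    using u fin by (simp add: Compl_partition)
  also have "cmod \<dots> \<le> infsum (\<lambda>i. cmod (f i)) (- F)"
    using abs by (rule norm_infsum_bound)
  also have "\<dots> \<le> \<epsilon>"
    by (rule infsum_le_finite_sums[OF abs]) (auto intro!: b)
  finally show "cmod (infsum f UNIV - sum f F) \<le> \<epsilon>" .
qed

lemma infsum_bound_finite:
  fixes f :: "'a \<Rightarrow> complex"
  assumes "\<And>G. finite G \<Longrightarrow> (\<Sum>i\<in>G. cmod (f i)) \<le> \<epsilon>"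
  shows "f summable_on UNIV" "cmod (infsum f UNIV) \<le> \<epsilon>"
  using infsum_tail_bound[of "{}" f \<epsilon>] assms by auto

text \<open>An even majorant, so that complex conjugation does not disturb the symmetry of the sums.\<close>

definition sy :: "(int \<Rightarrow> complex) \<Rightarrow> int \<Rightarrow> real" where
  "sy c j = cmod (c j) + cmod (c (- j))"

lemma sy_nonneg: "0 \<le> sy c j" and sy_ge: "cmod (c j) \<le> sy c j" and sy_ge_minus: "cmod (c (- j)) \<le> sy c j"
  and sy_minus [simp]: "sy c (- j) = sy c j"
  by (auto simp: sy_def)

lemma l2b_sy:
  assumes "l2b (\<lambda>j. jbr j powr s * cmod (c j)) A"
  shows "l2b (\<lambda>j. jbr j powr s * sy c j) (2 * A)"
  using l2b_sym[OF assms] by (simp add: sy_def distrib_left)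

definition square_box :: "nat \<Rightarrow> (int \<times> int) set" where
  "square_box n = {- int n..int n} \<times> {- int n..int n}"

lemma finite_square_box [simp]: "finite (square_box n)"
  by (simp add: square_box_def)

section \<open>The nonlinearity in Fourier coefficients\<close>

locale raman =
  fixes \<alpha>1 \<alpha>2 \<gamma>1 \<gamma>2 \<Gamma> :: real
  assumes \<Gamma>_pos: "\<Gamma> > 0" and \<alpha>1_nz: "\<alpha>1 \<noteq> 0" and nonres: "2 * \<alpha>2 / (3 * \<alpha>1) \<notin> \<int>"
begin

text \<open>Dispersion relation: the linear part of the equation multiplies the coefficient at k by
  - i \<open>om k\<close>.\<close>

definition om :: "int \<Rightarrow> real" where
  "om k = \<alpha>1 * (of_int k) ^ 3 + \<alpha>2 * (of_int k)\<^sup>2"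

text \<open>Symbol of the cubic terms. Differentiating |u|^2, which enters at frequency k - q, gives
  i (k - q); together with - i \<Gamma> this is real and hence the source of growth and decay. The
  terms with \<gamma>1 and \<gamma>2 are purely imaginary.\<close>

definition nlw :: "int \<Rightarrow> int \<Rightarrow> complex" where
  "nlw k q = Complex (\<Gamma> * of_int (k - q)) (\<gamma>1 + \<gamma>2 * of_int k)"

text \<open>The summand with \<open>c\<^sub>p\<close>, the conjugate of \<open>c\<^bsub>p+q-k\<^esub>\<close> and \<open>c\<^sub>q\<close> for \<open>i = (p, q)\<close>.\<close>

definition nlt :: "(int \<Rightarrow> complex) \<Rightarrow> int \<Rightarrow> int \<times> int \<Rightarrow> complex" where
  "nlt c k i = nlw k (snd i) * (c (fst i) * cnj (c (fst i + snd i - k)) * c (snd i))"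

definition nl :: "(int \<Rightarrow> complex) \<Rightarrow> int \<Rightarrow> complex" where
  "nl c k = (\<Sum>\<^sub>\<infinity>i. nlt c k i)"

definition Kc :: real where
  "Kc = \<bar>\<gamma>1\<bar> + \<bar>\<gamma>2\<bar> + \<Gamma>"

lemma Kc_nonneg: "0 \<le> Kc"
  using \<Gamma>_pos by (auto simp: Kc_def)

lemma nlw_le': "cmod (nlw k q) \<le> \<bar>\<gamma>1\<bar> + \<bar>\<gamma>2\<bar> * \<bar>of_int k\<bar> + \<Gamma> * \<bar>of_int (k - q)\<bar>"
proof -
  have "cmod (nlw k q) \<le> \<bar>\<Gamma> * of_int (k - q)\<bar> + \<bar>\<gamma>1 + \<gamma>2 * of_int k\<bar>"
    unfolding nlw_def using cmod_le[of "Complex (\<Gamma> * of_int (k - q)) (\<gamma>1 + \<gamma>2 * of_int k)"] by simp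
  also have "\<bar>\<gamma>1 + \<gamma>2 * of_int k\<bar> \<le> \<bar>\<gamma>1\<bar> + \<bar>\<gamma>2\<bar> * \<bar>of_int k\<bar>"
    by (metis abs_mult abs_triangle_ineq)
  finally show ?thesis using \<Gamma>_pos by (simp add: abs_mult)
qed

lemma nlw_le: "cmod (nlw k q) \<le> Kc * (jbr k + jbr q)"
proof -
  have "\<bar>\<gamma>1\<bar> * 1 \<le> \<bar>\<gamma>1\<bar> * (jbr k + jbr q)" "\<bar>\<gamma>2\<bar> * \<bar>of_int k\<bar> \<le> \<bar>\<gamma>2\<bar> * (jbr k + jbr q)"
    "\<Gamma> * \<bar>of_int (k - q)\<bar> \<le> \<Gamma> * (jbr k + jbr q)"
    using \<Gamma>_pos by (intro mult_left_mono; simp add: jbr_def bracket_def)+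
  then show ?thesis using nlw_le'[of k q] unfolding Kc_def by (simp add: distrib_right)
qed

lemma nlt_le:
  "cmod (nlt c k i) \<le> Kc * (jbr k + jbr (snd i)) * (sy c (fst i) * sy c (k - fst i - snd i) * sy c (snd i))"
proof -
  have m: "cmod (c (fst i + snd i - k)) \<le> sy c (k - fst i - snd i)"
    using sy_ge_minus[of c "k - fst i - snd i"] by (simp add: algebra_simps)
  show ?thesis
    unfolding nlt_def norm_mult complex_mod_cnj
    by (intro mult_mono nlw_le sy_ge m mult_nonneg_nonneg add_nonneg_nonneg sy_nonneg)
       (auto simp: Kc_nonneg jbr_nonneg add_nonneg_nonneg)
qed

context
  fixes c :: "int \<Rightarrow> complex" and V :: real
  assumes V: "l2b (\<lambda>j. jbr j * sy c j) V"
begin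

lemma V0: "0 \<le> V"
  using V by (rule l2b_const_nonneg)

lemma v2: "l2b (sy c) V" and v1: "l1b (sy c) (2 * V)"
  using l2b_of_weight[OF V] by auto

text \<open>Outside the box p or q exceeds n, so that a factor n + 1 is paid for by
  \<open>jbr p + jbr q\<close>. Together with the derivative in the nonlinearity this may put two
  weights on q; one of them is then spread over k and the other two entries, so that no entry
  carries more than the single weight allowed by H^1.\<close>

lemma nlt_tail_le:
  assumes "finite F" "F \<inter> square_box n = {}"
  shows "(\<Sum>i\<in>F. cmod (nlt c k i)) \<le> 12 * Kc * jbr k * V ^ 3 / (real n + 1)"
proof -
  note t = tri_pairs[OF assms(1), of k]
  let ?v = "sy c"
  let ?e = "\<lambda>j. jbr j * sy c j"
  let ?b = "\<lambda>i::int \<times> int. k - fst i - snd i"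
  have pt: "(real n + 1) * cmod (nlt c k i) \<le> Kc * (jbr k * (?e (fst i) * ?v (?b i) * ?v (snd i))
       + 2 * (jbr k * (?v (fst i) * ?v (?b i) * ?e (snd i))) + 2 * (?e (fst i) * ?v (?b i) * ?e (snd i))
       + ?v (fst i) * ?e (?b i) * ?e (snd i))" if "i \<in> F" for i
  proof -
    define a b q where "a = jbr (fst i)" and "b = jbr (?b i)" and "q = jbr (snd i)"
    define w where "w = ?v (fst i) * ?v (?b i) * ?v (snd i)"
    have w: "0 \<le> w" by (simp add: w_def sy_nonneg)
    have n: "real n + 1 \<le> a + q"
    proof -
      have "i \<notin> square_box n" using that assms(2) by auto
      then have "int n + 1 \<le> \<bar>fst i\<bar> \<or> int n + 1 \<le> \<bar>snd i\<bar>" unfolding square_box_def by (cases i) auto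
      then have "real n + 1 \<le> \<bar>real_of_int (fst i)\<bar> \<or> real n + 1 \<le> \<bar>real_of_int (snd i)\<bar>"
        by linarith
      then show ?thesis unfolding a_def q_def jbr_def bracket_def by linarith
    qed
    have q: "q \<le> jbr k + a + b" unfolding a_def b_def q_def jbr_def bracket_def by simp
    have p: "0 \<le> a" "0 \<le> q" "0 \<le> b" by (auto simp: a_def b_def q_def jbr_nonneg)
    have "(real n + 1) * cmod (nlt c k i) \<le> (a + q) * (Kc * (jbr k + q) * w)"
      using nlt_le[of c k i] n p unfolding w_def q_def
      by (intro mult_mono) auto
    also have "\<dots> = Kc * ((a * jbr k + a * q + q * jbr k + q * q) * w)"
      by (simp add: algebra_simps)
    also have "\<dots> \<le> Kc * ((a * jbr k + a * q + q * jbr k + q * (jbr k + a + b)) * w)"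
      using q p w Kc_nonneg by (intro mult_left_mono mult_right_mono add_left_mono) auto
    also have "\<dots> = Kc * (jbr k * (a * w) + 2 * (jbr k * (q * w)) + 2 * (a * q * w) + b * q * w)"
      by (simp add: algebra_simps)
    finally show ?thesis by (simp add: w_def a_def b_def q_def mult_ac)
  qed
  have "(real n + 1) * (\<Sum>i\<in>F. cmod (nlt c k i)) \<le> (\<Sum>i\<in>F. Kc * (jbr k * (?e (fst i) * ?v (?b i) * ?v (snd i))
       + 2 * (jbr k * (?v (fst i) * ?v (?b i) * ?e (snd i))) + 2 * (?e (fst i) * ?v (?b i) * ?e (snd i))
       + ?v (fst i) * ?e (?b i) * ?e (snd i)))"
    unfolding sum_distrib_left by (intro sum_mono pt)
  also have "\<dots> = Kc * (jbr k * (\<Sum>i\<in>F. ?e (fst i) * ?v (?b i) * ?v (snd i))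
       + 2 * (jbr k * (\<Sum>i\<in>F. ?v (fst i) * ?v (?b i) * ?e (snd i)))
       + 2 * (\<Sum>i\<in>F. ?e (fst i) * ?v (?b i) * ?e (snd i))
       + (\<Sum>i\<in>F. ?v (fst i) * ?e (?b i) * ?e (snd i)))"
    unfolding sum_distrib_left sum.distrib[symmetric] ..
  also have "\<dots> \<le> Kc * (jbr k * (V * (2 * V) * V) + 2 * (jbr k * (2 * V * V * V))
       + 2 * (V * (2 * V) * V) + 2 * V * V * V)"
    using Kc_nonneg jbr_nonneg young_l2_l1_l2[OF t V v1 v2] young_l1_l2_l2[OF t v1 v2 V] young_l2_l1_l2[OF t V v1 V]
      young_l1_l2_l2[OF t v1 V V]
    by (intro mult_left_mono add_mono) auto
  also have "\<dots> = Kc * (6 * jbr k * V ^ 3 + 6 * V ^ 3)" by (simp add: power3_eq_cube algebra_simps)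
  also have "\<dots> \<le> Kc * (6 * jbr k * V ^ 3 + jbr k * (6 * V ^ 3))"
    using Kc_nonneg jbr_ge1[of k] V0 mult_right_mono[of 1 "jbr k" "6 * V ^ 3"]
    by (intro mult_left_mono add_left_mono) auto
  also have "\<dots> = 12 * Kc * jbr k * V ^ 3" by simp
  finally show ?thesis by (simp add: pos_le_divide_eq mult.commute)
qed

lemma nl_tail: "cmod (nl c k - sum (nlt c k) (square_box n)) \<le> 12 * Kc * jbr k * V ^ 3 / (real n + 1)"
  unfolding nl_def by (rule infsum_tail_bound) (auto intro: nlt_tail_le)

lemma nl_le_conv3: "cmod (nl c j) \<le> 4 * Kc * conv3 (sy c) (sy c) (\<lambda>j. jbr j * sy c j) j"
  unfolding nl_def
proof (rule infsum_bound_finite)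
  fix F :: "(int \<times> int) set" assume "finite F"
  note t = tri_pairs[OF this, of j]
  let ?v = "sy c"
  let ?e = "\<lambda>j. jbr j * sy c j"
  let ?b = "\<lambda>i::int \<times> int. j - fst i - snd i"
  let ?T = "conv3 ?v ?v ?e j"
  have pt: "cmod (nlt c j i) \<le> Kc * (?v (?b i) * ?v (snd i) * ?e (fst i)
       + ?v (snd i) * ?v (fst i) * ?e (?b i) + 2 * (?v (fst i) * ?v (?b i) * ?e (snd i)))" for i
  proof -
    define w where "w = ?v (fst i) * ?v (?b i) * ?v (snd i)"
    have w: "0 \<le> w" by (simp add: w_def sy_nonneg)
    have "jbr j \<le> jbr (fst i) + jbr (?b i) + jbr (snd i)"
      by (simp add: jbr_def bracket_def)
    then have "Kc * ((jbr j + jbr (snd i)) * w)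
       \<le> Kc * ((jbr (fst i) + jbr (?b i) + 2 * jbr (snd i)) * w)"
      using w Kc_nonneg by (intro mult_left_mono mult_right_mono) auto
    then show ?thesis using nlt_le[of c j i] unfolding w_def by (simp add: algebra_simps)
  qed
  have "(\<Sum>i\<in>F. cmod (nlt c j i)) \<le> (\<Sum>i\<in>F. Kc * (?v (?b i) * ?v (snd i) * ?e (fst i)
       + ?v (snd i) * ?v (fst i) * ?e (?b i) + 2 * (?v (fst i) * ?v (?b i) * ?e (snd i))))"
    by (intro sum_mono pt)
  also have "\<dots> = Kc * ((\<Sum>i\<in>F. ?v (?b i) * ?v (snd i) * ?e (fst i))
       + (\<Sum>i\<in>F. ?v (snd i) * ?v (fst i) * ?e (?b i))
       + 2 * (\<Sum>i\<in>F. ?v (fst i) * ?v (?b i) * ?e (snd i)))"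
    unfolding sum_distrib_left sum.distrib[symmetric] ..
  also have "\<dots> \<le> Kc * (?T + ?T + 2 * ?T)"
    using Kc_nonneg tri_le_conv3[OF tri_rot[OF t] v1 v1 V] tri_le_conv3[OF t v1 v1 V]
      tri_le_conv3[OF tri_rot[OF tri_rot[OF t]] v1 v1 V]
    by (intro mult_left_mono add_mono) auto
  finally show "(\<Sum>i\<in>F. cmod (nlt c j i)) \<le> 4 * Kc * ?T" by simp
qed

lemma nl_l2b: "l2b (\<lambda>j. cmod (nl c j)) (16 * Kc * V ^ 3)"
proof (rule l2b_mono)
  show "l2b (\<lambda>j. 4 * Kc * conv3 (sy c) (sy c) (\<lambda>j. jbr j * sy c j) j)
      (4 * Kc * (2 * V * (2 * V) * V))"
    using Kc_nonneg by (intro l2b_scale l2b_conv3 v1 V) auto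
qed (use nl_le_conv3 in \<open>auto simp: power3_eq_cube\<close>)

text \<open>When the weight of order s and the derivative fall on the same entry, the derivative is
  traded for one on j or on another entry, so that no norm above H^s occurs. What remains is an
  explicit factor \<open>jbr j\<close> in front of an l^2 sequence, and terms bounded uniformly in
  j.\<close>

lemma nl_weighted:
  assumes E: "l2b (\<lambda>j. jbr j powr s * sy c j) H" and s: "0 \<le> s"
  shows "jbr j powr s * cmod (nl c j) \<le> Kc * 3 powr s *
     (4 * jbr j * conv3 (sy c) (sy c) (\<lambda>j. jbr j powr s * sy c j) j + 8 * V\<^sup>2 * H)"
proof -
  let ?v = "sy c"
  let ?e = "\<lambda>j. jbr j * sy c j"
  let ?E = "\<lambda>j. jbr j powr s * sy c j"
  let ?b = "\<lambda>i::int \<times> int. j - fst i - snd i"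
  let ?T = "conv3 ?v ?v ?E j"
  let ?R = "Kc * 3 powr s * (4 * jbr j * ?T + 8 * V\<^sup>2 * H)"
  have H0: "0 \<le> H" using E by (rule l2b_const_nonneg)
  have pos: "0 < jbr j powr s" using jbr_nz by simp
  have "cmod (nl c j) \<le> ?R / jbr j powr s"
    unfolding nl_def
  proof (rule infsum_bound_finite)
    fix F :: "(int \<times> int) set" assume "finite F"
    note t = tri_pairs[OF this, of j]
    have pt: "jbr j powr s * cmod (nlt c j i) \<le> Kc * 3 powr s *
       (jbr j * (?v (?b i) * ?v (snd i) * ?E (fst i)) + jbr j * (?v (snd i) * ?v (fst i) * ?E (?b i))
       + 2 * (jbr j * (?v (fst i) * ?v (?b i) * ?E (snd i)))
       + (?E (fst i) * ?v (?b i) * ?e (snd i) + ?v (fst i) * ?E (?b i) * ?e (snd i)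
       + ?e (fst i) * ?v (?b i) * ?E (snd i) + ?v (fst i) * ?e (?b i) * ?E (snd i)))" for i
    proof -
      define w where "w = ?v (fst i) * ?v (?b i) * ?v (snd i)"
      define a b q where "a = jbr (fst i)" and "b = jbr (?b i)" and "q = jbr (snd i)"
      define S where "S = a powr s + b powr s + q powr s"
      have w: "0 \<le> w" by (simp add: w_def sy_nonneg)
      have p: "0 \<le> a" "0 \<le> q" "0 \<le> b" by (auto simp: a_def b_def q_def jbr_nonneg)
      have q: "q \<le> jbr j + a + b" unfolding a_def b_def q_def jbr_def bracket_def by simp
      have "jbr j powr s \<le> 3 powr s * S"
        unfolding S_def a_def b_def q_def by (rule jbr_powr_add3_le) (use s in auto)
      then have "jbr j powr s * cmod (nlt c j i) \<le> (3 powr s * S) * (Kc * (jbr j + q) * w)"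
        using nlt_le[of c j i] unfolding w_def q_def
        by (intro mult_mono) (auto simp: S_def)
      also have "\<dots> = Kc * 3 powr s * ((jbr j * S + q * (a powr s + b powr s) + q * q powr s) * w)"
        by (simp add: S_def algebra_simps)
      also have "\<dots> \<le> Kc * 3 powr s * ((jbr j * S + q * (a powr s + b powr s)
          + (jbr j + a + b) * q powr s) * w)"
        using q w Kc_nonneg by (intro mult_left_mono mult_right_mono add_left_mono) auto
      also have "\<dots> = Kc * 3 powr s * (jbr j * (a powr s * w) + jbr j * (b powr s * w)
          + 2 * (jbr j * (q powr s * w)) + (a powr s * q * w + b powr s * q * w
          + a * q powr s * w + b * q powr s * w))"
        by (simp add: S_def algebra_simps)
      finally show ?thesis by (simp add: w_def a_def b_def q_def mult_ac)
    qed
    have "jbr j powr s * (\<Sum>i\<in>F. cmod (nlt c j i)) \<le> (\<Sum>i\<in>F. Kc * 3 powr s *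
       (jbr j * (?v (?b i) * ?v (snd i) * ?E (fst i)) + jbr j * (?v (snd i) * ?v (fst i) * ?E (?b i))
       + 2 * (jbr j * (?v (fst i) * ?v (?b i) * ?E (snd i)))
       + (?E (fst i) * ?v (?b i) * ?e (snd i) + ?v (fst i) * ?E (?b i) * ?e (snd i)
       + ?e (fst i) * ?v (?b i) * ?E (snd i) + ?v (fst i) * ?e (?b i) * ?E (snd i))))"
      unfolding sum_distrib_left by (intro sum_mono pt)
    also have "\<dots> = Kc * 3 powr s * (
         jbr j * (\<Sum>i\<in>F. ?v (?b i) * ?v (snd i) * ?E (fst i))
       + jbr j * (\<Sum>i\<in>F. ?v (snd i) * ?v (fst i) * ?E (?b i))
       + 2 * (jbr j * (\<Sum>i\<in>F. ?v (fst i) * ?v (?b i) * ?E (snd i)))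
       + ((\<Sum>i\<in>F. ?E (fst i) * ?v (?b i) * ?e (snd i)) + (\<Sum>i\<in>F. ?v (fst i) * ?E (?b i) * ?e (snd i))
       + (\<Sum>i\<in>F. ?e (fst i) * ?v (?b i) * ?E (snd i)) + (\<Sum>i\<in>F. ?v (fst i) * ?e (?b i) * ?E (snd i))))"
      unfolding sum_distrib_left sum.distrib[symmetric] ..
    also have "\<dots> \<le> Kc * 3 powr s * (jbr j * ?T + jbr j * ?T + 2 * (jbr j * ?T)
       + (H * (2 * V) * V + 2 * V * H * V + V * (2 * V) * H + 2 * V * V * H))"
      using Kc_nonneg jbr_nonneg tri_le_conv3[OF tri_rot[OF t] v1 v1 E] tri_le_conv3[OF t v1 v1 E]
        tri_le_conv3[OF tri_rot[OF tri_rot[OF t]] v1 v1 E]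
        young_l2_l1_l2[OF t E v1 V] young_l1_l2_l2[OF t v1 E V] young_l2_l1_l2[OF t V v1 E] young_l1_l2_l2[OF t v1 V E]
      by (intro mult_left_mono add_mono) auto
    also have "\<dots> = ?R" by (simp add: power2_eq_square)
    finally show "(\<Sum>i\<in>F. cmod (nlt c j i)) \<le> ?R / jbr j powr s"
      using pos by (simp add: pos_le_divide_eq mult.commute)
  qed
  then show ?thesis using pos by (simp add: pos_le_divide_eq mult.commute)
qed

end

section \<open>The phase and its lower bound\<close>

definition Phi :: "int \<Rightarrow> int \<Rightarrow> int \<Rightarrow> real" where
  "Phi k p q = om k - om p + om (p + q - k) - om q"

lemma Phi_factor:
  "Phi k p q = 3 * \<alpha>1 * of_int (k - p) * of_int (k - q) * (of_int (p + q) + 2 * \<alpha>2 / (3 * \<alpha>1))"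
proof -
  have "Phi k p q = of_int (k - p) * of_int (k - q) * (3 * \<alpha>1 * of_int (p + q) + 2 * \<alpha>2)"
    unfolding Phi_def om_def by (simp add: power3_eq_cube power2_eq_square algebra_simps)
  also have "3 * \<alpha>1 * of_int (p + q) + 2 * \<alpha>2 = 3 * \<alpha>1 * (of_int (p + q) + 2 * \<alpha>2 / (3 * \<alpha>1))"
    using \<alpha>1_nz by (simp add: field_simps)
  finally show ?thesis by simp
qed

text \<open>For bounded j the distance \<open>d\<close> from \<open>\<beta>\<close> to the integers
  gives the bound, for large j the linear growth does. \<open>M\<close> is chosen such that 1 +
  |\<beta>| is at most (M - 1) |j + \<beta>|.\<close>

lemma nonres_gap: "\<exists>\<delta>>0. \<forall>j. \<delta> * jbr j \<le> \<bar>of_int j + 2 * \<alpha>2 / (3 * \<alpha>1)\<bar>"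
proof -
  define \<beta> where "\<beta> = 2 * \<alpha>2 / (3 * \<alpha>1)"
  define d where "d = min (frac \<beta>) (1 - frac \<beta>)"
  have d: "d > 0" using nonres[folded \<beta>_def] frac_lt_1[of \<beta>] unfolding d_def by (simp add: frac_gt_0_iff)
  define M where "M = (1 + \<bar>\<beta>\<bar>) / d + 1"
  have M: "M > 0" unfolding M_def using d by (intro add_nonneg_pos divide_nonneg_pos) auto
  have "1 / M * jbr j \<le> \<bar>of_int j + \<beta>\<bar>" for j :: int
  proof -
    let ?x = "of_int j + \<beta>"
    have dx: "d \<le> \<bar>?x\<bar>"
    proof -
      have "?x = of_int (j + \<lfloor>\<beta>\<rfloor>) + frac \<beta>" by (simp add: frac_def)
      moreover have "j + \<lfloor>\<beta>\<rfloor> \<ge> 0 \<or> j + \<lfloor>\<beta>\<rfloor> \<le> -1" by auto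
      then have "(of_int (j + \<lfloor>\<beta>\<rfloor>) :: real) \<ge> 0 \<or> (of_int (j + \<lfloor>\<beta>\<rfloor>) :: real) \<le> -1"
        by linarith
      ultimately show ?thesis using frac_lt_1[of \<beta>] frac_ge_0[of \<beta>] unfolding d_def by linarith
    qed
    have "jbr j \<le> (1 + \<bar>\<beta>\<bar>) + \<bar>?x\<bar>" by (simp add: jbr_def bracket_def)
    also have "1 + \<bar>\<beta>\<bar> = (1 + \<bar>\<beta>\<bar>) / d * d" using d by simp
    also have "\<dots> \<le> (1 + \<bar>\<beta>\<bar>) / d * \<bar>?x\<bar>" using dx d by (intro mult_left_mono) auto
    finally have "jbr j \<le> M * \<bar>?x\<bar>" by (simp add: M_def distrib_right)
    then show ?thesis using M by (simp add: field_simps)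
  qed
  then show ?thesis using M unfolding \<beta>_def by (intro exI[of _ "1 / M"]) auto
qed

definition gap :: real where
  "gap = (SOME \<delta>. \<delta> > 0 \<and> (\<forall>j. \<delta> * jbr j \<le> \<bar>of_int j + 2 * \<alpha>2 / (3 * \<alpha>1)\<bar>))"

lemma gap_pos: "gap > 0" and gap: "gap * jbr j \<le> \<bar>of_int j + 2 * \<alpha>2 / (3 * \<alpha>1)\<bar>"
  using someI_ex[OF nonres_gap] unfolding gap_def by auto

definition Kw :: real where
  "Kw = 4 * Kc / (3 * \<bar>\<alpha>1\<bar> * gap)"

lemma Kw_nonneg: "0 \<le> Kw"
  using Kc_nonneg gap_pos by (simp add: Kw_def)

lemma Phi_nz:
  assumes "p \<noteq> k" "q \<noteq> k"
  shows "Phi k p q \<noteq> 0"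
proof -
  have "0 < gap * jbr (p + q)" using gap_pos jbr_pos by simp
  then have "of_int (p + q) + 2 * \<alpha>2 / (3 * \<alpha>1) \<noteq> 0" using gap[of "p + q"] by linarith
  then show ?thesis unfolding Phi_factor using assms \<alpha>1_nz by simp
qed

text \<open>With P, Q, R the weights of the three phase factors, the symbol is at most a multiple of
  P + Q + R and the phase at least a multiple of P Q R; the quotient is the sum of the reciprocals
  of the pair products, that is, \<open>Wt\<close>. The 4 in \<open>Kw\<close> comes from
  \<open>jbr j \<le> 2 * \<bar>of_int j\<bar>\<close> for nonzero j, used twice.\<close>

lemma multiplier_le:
  assumes "p \<noteq> k" "q \<noteq> k"
  shows "cmod (nlw k q / (\<i> * of_real (Phi k p q))) \<le> Kw * Wt k p (k - p - q) q"
proof -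
  define P Q R where "P = jbr (k - p)" and "Q = jbr (k - q)" and "R = jbr (p + q)"
  have pos: "0 < P" "0 < Q" "0 < R" by (auto simp: P_def Q_def R_def jbr_pos)
  have R': "jbr (k - (k - p - q)) = R" by (simp add: R_def)
  have W: "Wt k p (k - p - q) q = (P + Q + R) / (P * Q * R)"
    unfolding Wt_def R' P_def[symmetric] Q_def[symmetric] using pos by (simp add: field_simps)
  have int2: "jbr j \<le> 2 * \<bar>of_int j\<bar>" if "j \<noteq> 0" for j
  proof -
    have "1 \<le> \<bar>j\<bar>" using that by linarith
    then have "1 \<le> \<bar>real_of_int j\<bar>" by (metis of_int_1_le_iff of_int_abs)
    then show ?thesis by (simp add: jbr_def bracket_def)
  qed
  have m: "cmod (nlw k q) \<le> Kc * (P + Q + R)"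
  proof -
    have "\<bar>\<gamma>1\<bar> * 1 \<le> \<bar>\<gamma>1\<bar> * (P + Q + R)" "\<bar>\<gamma>2\<bar> * \<bar>of_int k\<bar> \<le> \<bar>\<gamma>2\<bar> * (P + Q + R)"
      "\<Gamma> * \<bar>of_int (k - q)\<bar> \<le> \<Gamma> * (P + Q + R)"
      using \<Gamma>_pos unfolding P_def Q_def R_def
      by (intro mult_left_mono; simp add: jbr_def bracket_def)+
    then show ?thesis using nlw_le'[of k q] unfolding Kc_def by (simp add: distrib_right)
  qed
  have ph: "3 * \<bar>\<alpha>1\<bar> * gap * (P * Q * R) \<le> 4 * \<bar>Phi k p q\<bar>"
  proof -
    have "P * Q * (gap * R) \<le> (2 * \<bar>of_int (k - p)\<bar>) * (2 * \<bar>of_int (k - q)\<bar>)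
        * \<bar>of_int (p + q) + 2 * \<alpha>2 / (3 * \<alpha>1)\<bar>"
      using int2[of "k - p"] int2[of "k - q"] gap[of "p + q"] assms pos gap_pos
      unfolding P_def Q_def R_def by (intro mult_mono) auto
    then have "3 * \<bar>\<alpha>1\<bar> * (P * Q * (gap * R)) \<le> 3 * \<bar>\<alpha>1\<bar> * ((2 * \<bar>of_int (k - p)\<bar>) * (2 * \<bar>of_int (k - q)\<bar>)
        * \<bar>of_int (p + q) + 2 * \<alpha>2 / (3 * \<alpha>1)\<bar>)"
      by (intro mult_left_mono) auto
    then show ?thesis unfolding Phi_factor abs_mult by (simp add: mult_ac)
  qed
  have D: "0 < 3 * \<bar>\<alpha>1\<bar> * gap * (P * Q * R)" using \<alpha>1_nz gap_pos pos by simp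
  have "cmod (nlw k q / (\<i> * of_real (Phi k p q))) = cmod (nlw k q) / \<bar>Phi k p q\<bar>"
    by (simp add: norm_divide norm_mult)
  also have "\<dots> \<le> Kc * (P + Q + R) / (3 * \<bar>\<alpha>1\<bar> * gap * (P * Q * R) / 4)"
    using m ph D Kc_nonneg pos by (intro frac_le) auto
  also have "\<dots> = Kw * ((P + Q + R) / (P * Q * R))"
    unfolding Kw_def by simp
  finally show ?thesis unfolding W .
qed

end

subsection \<open>The normal form\<close>

lemma filterlim_symm_interval:
  "filterlim (\<lambda>n. {- int n..int n}) (finite_subsets_at_top UNIV) sequentially"
  unfolding filterlim_finite_subsets_at_top
proof (intro allI impI, elim conjE)
  fix X :: "int set" assume "finite X"
  then obtain m where m: "X \<subseteq> {- int m..int m}" using finite_int_subset_interval by blast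
  show "\<forall>\<^sub>F n in sequentially. finite {- int n..int n} \<and> X \<subseteq> {- int n..int n} \<and> {- int n..int n} \<subseteq> UNIV"
    using eventually_ge_at_top[of m]
  proof eventually_elim
    case (elim n)
    then show ?case using m by (auto dest!: subsetD)
  qed
qed

lemma has_sum_symm_interval:
  assumes "(f has_sum S) UNIV"
  shows "(\<lambda>n. sum f {- int n..int n}) \<longlonglongrightarrow> S"
  using filterlim_compose[OF assms[unfolded has_sum_def] filterlim_symm_interval] .

context raman
begin

text \<open>Truncation to a box keeps the normal form a finite sum, which can be differentiated term
  by term; the bounds for \<open>Bn\<close> and \<open>Qn\<close> are uniform in n.\<close>

definition NR :: "nat \<Rightarrow> int \<Rightarrow> (int \<times> int) set" where
  "NR n k = {i \<in> square_box n. fst i \<noteq> k \<and> snd i \<noteq> k}"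

lemma finite_NR [simp]: "finite (NR n k)"
  by (simp add: NR_def)

definition multiplier :: "int \<Rightarrow> int \<times> int \<Rightarrow> complex" where
  "multiplier k i = nlw k (snd i) / (\<i> * of_real (Phi k (fst i) (snd i)))"

text \<open>Along a solution the derivative of \<open>Bn\<close> cancels the nonresonant terms; \<open>Qn\<close> is the quintic
  remainder.\<close>

definition Bn :: "nat \<Rightarrow> int \<Rightarrow> (int \<Rightarrow> complex) \<Rightarrow> complex" where
  "Bn n k c = (\<Sum>i\<in>NR n k. multiplier k i * (c (fst i) * cnj (c (fst i + snd i - k)) * c (snd i)))"

definition Qn :: "nat \<Rightarrow> int \<Rightarrow> (int \<Rightarrow> complex) \<Rightarrow> complex" where
  "Qn n k c = (\<Sum>i\<in>NR n k. multiplier k i *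
      (nl c (fst i) * cnj (c (fst i + snd i - k)) * c (snd i)
       + c (fst i) * cnj (nl c (fst i + snd i - k)) * c (snd i)
       + c (fst i) * cnj (c (fst i + snd i - k)) * nl c (snd i)))"

definition Mn :: "nat \<Rightarrow> (int \<Rightarrow> complex) \<Rightarrow> real" where
  "Mn n c = (\<Sum>j\<in>{- int n..int n}. (cmod (c j))\<^sup>2)"

text \<open>Truncated momentum. It appears in the resonant part without a factor k, so that
  boundedness suffices.\<close>

definition Pn :: "nat \<Rightarrow> (int \<Rightarrow> complex) \<Rightarrow> real" where
  "Pn n c = (\<Sum>j\<in>{- int n..int n}. of_int j * (cmod (c j))\<^sup>2)"

lemma multiplier_NR_le:
  "i \<in> NR n k \<Longrightarrow> cmod (multiplier k i) \<le> Kw * Wt k (fst i) (k - fst i - snd i) (snd i)"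
  unfolding multiplier_def NR_def by (intro multiplier_le) auto

text \<open>The terms with \<open>p = k\<close> or \<open>q = k\<close> are the resonant ones; they produce the growth rate
  proportional to \<open>k\<close> and the mass.\<close>

lemma resonant_split:
  assumes "\<bar>k\<bar> \<le> int n"
  shows "sum (nlt c k) (square_box n) = sum (nlt c k) (NR n k)
    + c k * (of_real (\<Gamma> * of_int k * Mn n c - \<Gamma> * Pn n c)
             + \<i> * of_real ((\<gamma>1 + \<gamma>2 * of_int k) * (2 * Mn n c - (cmod (c k))\<^sup>2)))"
proof -
  define g where "g = \<gamma>1 + \<gamma>2 * of_int k"
  let ?J = "{- int n..int n}"
  have kJ: "k \<in> ?J" using assms by auto
  have sq: "c j * cnj (c j) = of_real ((cmod (c j))\<^sup>2)" for j
    by (simp only: complex_norm_square)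
  have nlw: "nlw k q = of_real \<Gamma> * of_int (k - q) + \<i> * of_real g" for q
    unfolding nlw_def g_def by (simp add: complex_eq_iff)
  \<comment> \<open>The line p = k is taken whole, so the line q = k leaves out the corner (k, k);
    this is the origin of the subtracted square of \<open>c k\<close>.\<close>
  have eq: "square_box n = NR n k \<union> (\<lambda>q. (k, q)) ` ?J \<union> (\<lambda>p. (p, k)) ` (?J - {k})"
    using kJ by (auto simp: NR_def square_box_def)
  have "sum (nlt c k) (square_box n) = sum (nlt c k) (NR n k) + sum (nlt c k) ((\<lambda>q. (k, q)) ` ?J)
      + sum (nlt c k) ((\<lambda>p. (p, k)) ` (?J - {k}))"
    unfolding eq by (subst sum.union_disjoint; (simp add: NR_def)?; (blast | auto)?)+
  also have "sum (nlt c k) ((\<lambda>q. (k, q)) ` ?J) = (\<Sum>q\<in>?J. nlt c k (k, q))"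
    by (simp add: sum.reindex inj_on_def)
  also have "\<dots> = (\<Sum>q\<in>?J. c k * (of_real (\<Gamma> * of_int k * (cmod (c q))\<^sup>2 - \<Gamma> * (of_int q * (cmod (c q))\<^sup>2))
      + \<i> * of_real (g * (cmod (c q))\<^sup>2)))"
  proof (rule sum.cong[OF refl])
    fix q
    have "nlt c k (k, q) = nlw k q * (c k * (c q * cnj (c q)))"
      by (simp add: nlt_def mult_ac)
    then show "nlt c k (k, q) = c k * (of_real (\<Gamma> * of_int k * (cmod (c q))\<^sup>2 - \<Gamma> * (of_int q * (cmod (c q))\<^sup>2))
      + \<i> * of_real (g * (cmod (c q))\<^sup>2))"
      unfolding sq nlw by (simp add: algebra_simps)
  qed
  also have "\<dots> = c k * (of_real (\<Gamma> * of_int k * Mn n c - \<Gamma> * Pn n c) + \<i> * of_real (g * Mn n c))"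
    unfolding Mn_def Pn_def sum_distrib_left sum_subtractf[symmetric] of_real_sum sum.distrib[symmetric] ..
  also have "sum (nlt c k) ((\<lambda>p. (p, k)) ` (?J - {k})) = (\<Sum>p\<in>?J - {k}. nlt c k (p, k))"
    by (simp add: sum.reindex inj_on_def)
  also have "\<dots> = (\<Sum>p\<in>?J - {k}. c k * (\<i> * of_real (g * (cmod (c p))\<^sup>2)))"
  proof (rule sum.cong[OF refl])
    fix p
    have "nlt c k (p, k) = nlw k k * (c k * (c p * cnj (c p)))"
      by (simp add: nlt_def mult_ac)
    then show "nlt c k (p, k) = c k * (\<i> * of_real (g * (cmod (c p))\<^sup>2))"
      unfolding sq nlw by (simp add: algebra_simps)
  qed
  also have "\<dots> = c k * (\<i> * of_real (g * (Mn n c - (cmod (c k))\<^sup>2)))"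
  proof -
    have "Mn n c - (cmod (c k))\<^sup>2 = (\<Sum>j\<in>?J - {k}. (cmod (c j))\<^sup>2)"
      unfolding Mn_def using kJ by (simp add: sum_diff1)
    then show ?thesis by (simp only: sum_distrib_left of_real_sum)
  qed
  finally show ?thesis unfolding g_def[symmetric] by (simp add: algebra_simps)
qed

section \<open>Bounds for the normal form, uniform in the truncation\<close>

context
  fixes c :: "int \<Rightarrow> complex" and V H s :: real
  assumes V: "l2b (\<lambda>j. jbr j * sy c j) V"
    and E: "l2b (\<lambda>j. jbr j powr s * sy c j) H" and s: "0 \<le> s"
begin

text \<open>The weight of order s goes to one entry, and the additional factor \<open>jbr k\<close>
  is absorbed by the phase through \<open>Wt_sum_total_le\<close>: the normal form is one derivative
  better than the solution. The 90 is three times the 30 found there, one for each entry.\<close>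

lemma Bn_le:
  "jbr k powr s * (jbr k * cmod (Bn n k c)) \<le> 90 * Kw * 3 powr s * H * V\<^sup>2"
proof -
  let ?v = "sy c" and ?I = "NR n k"
  let ?E = "\<lambda>j. jbr j powr s * sy c j"
  let ?b = "\<lambda>i::int \<times> int. k - fst i - snd i"
  let ?W = "\<lambda>i. Wt k (fst i) (?b i) (snd i)"
  note t = tri_pairs[OF finite_NR[of n k], of k]
  have pt: "jbr k powr s * (jbr k * cmod (multiplier k i * (c (fst i) * cnj (c (fst i + snd i - k)) * c (snd i))))
     \<le> Kw * 3 powr s * (jbr k * Wt k (fst i) (?b i) (snd i) * (?E (fst i) * ?v (?b i) * ?v (snd i))
        + jbr k * Wt k (?b i) (snd i) (fst i) * (?E (?b i) * ?v (snd i) * ?v (fst i))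
        + jbr k * Wt k (snd i) (fst i) (?b i) * (?E (snd i) * ?v (fst i) * ?v (?b i)))"
    if "i \<in> ?I" for i
  proof -
    define w where "w = ?v (fst i) * ?v (?b i) * ?v (snd i)"
    define S where "S = jbr (fst i) powr s + jbr (?b i) powr s + jbr (snd i) powr s"
    have w: "0 \<le> w" by (simp add: w_def sy_nonneg)
    have m: "cmod (c (fst i + snd i - k)) \<le> ?v (?b i)"
      using sy_ge_minus[of c "?b i"] by (simp add: algebra_simps)
    have "jbr k powr s \<le> 3 powr s * S"
      unfolding S_def by (rule jbr_powr_add3_le) (use s in auto)
    moreover have "cmod (multiplier k i * (c (fst i) * cnj (c (fst i + snd i - k)) * c (snd i))) \<le> (Kw * ?W i) * w"
      unfolding norm_mult complex_mod_cnj w_def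
      by (intro mult_mono multiplier_NR_le[OF that] sy_ge m mult_nonneg_nonneg sy_nonneg norm_ge_zero Kw_nonneg Wt_nonneg)
    ultimately have "jbr k powr s * (jbr k * cmod (multiplier k i * (c (fst i) * cnj (c (fst i + snd i - k)) * c (snd i))))
       \<le> (3 powr s * S) * (jbr k * ((Kw * ?W i) * w))"
      using jbr_nonneg by (intro mult_mono mult_left_mono mult_nonneg_nonneg) (auto simp: S_def)
    also have "\<dots> = Kw * 3 powr s * (jbr k * ?W i * (S * w))" by (simp add: mult_ac)
    finally show ?thesis
      unfolding Wt_rot[of k "fst i" "?b i", symmetric] Wt_rot[of k "snd i"] S_def w_def
      by (simp add: algebra_simps)
  qed
  have "jbr k powr s * (jbr k * cmod (Bn n k c))
     \<le> jbr k powr s * (jbr k * (\<Sum>i\<in>?I. cmod (multiplier k i * (c (fst i) * cnj (c (fst i + snd i - k)) * c (snd i)))))"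
    unfolding Bn_def using jbr_nonneg by (intro mult_left_mono norm_sum) auto
  also have "\<dots> \<le> (\<Sum>i\<in>?I. Kw * 3 powr s * (jbr k * Wt k (fst i) (?b i) (snd i) * (?E (fst i) * ?v (?b i) * ?v (snd i))
        + jbr k * Wt k (?b i) (snd i) (fst i) * (?E (?b i) * ?v (snd i) * ?v (fst i))
        + jbr k * Wt k (snd i) (fst i) (?b i) * (?E (snd i) * ?v (fst i) * ?v (?b i))))"
    unfolding sum_distrib_left by (intro sum_mono pt)
  also have "\<dots> = Kw * 3 powr s * ((\<Sum>i\<in>?I. jbr k * Wt k (fst i) (?b i) (snd i) * (?E (fst i) * ?v (?b i) * ?v (snd i)))
        + (\<Sum>i\<in>?I. jbr k * Wt k (?b i) (snd i) (fst i) * (?E (?b i) * ?v (snd i) * ?v (fst i)))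
        + (\<Sum>i\<in>?I. jbr k * Wt k (snd i) (fst i) (?b i) * (?E (snd i) * ?v (fst i) * ?v (?b i))))"
    unfolding sum_distrib_left sum.distrib[symmetric] ..
  also have "\<dots> \<le> Kw * 3 powr s * (30 * H * V\<^sup>2 + 30 * H * V\<^sup>2 + 30 * H * V\<^sup>2)"
    using Wt_sum_total_le[OF t E V] Wt_sum_total_le[OF tri_rot[OF t] E V] Wt_sum_total_le[OF tri_rot[OF tri_rot[OF t]] E V] Kw_nonneg
    by (intro mult_left_mono add_mono) auto
  finally show ?thesis by simp
qed

text \<open>One entry is replaced by the nonlinearity and has lost a derivative. That derivative
  sits as \<open>jbr (a i)\<close> on the l^2 sequence \<open>g\<close> and is recovered from the
  phase by \<open>Wt_sum_first_le\<close>; the uniformly bounded rest \<open>h\<close> is handled by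
  \<open>Wt_le\<close> and the l^1 bounds of the other two entries. One factor
  \<open>3 powr s\<close> stems from distributing the weight of k, the other from the nonlinearity
  inside.\<close>

lemma nl_slot:
  assumes t: "tri k I a b d"
  shows "(\<Sum>i\<in>I. jbr k powr s * (Wt k (a i) (b i) (d i) * (sy (nl c) (a i) * sy c (b i) * sy c (d i))))
    \<le> 1920 * Kc * 9 powr s * V ^ 4 * H"
proof -
  let ?v = "sy c" and ?n = "sy (nl c)"
  let ?E = "\<lambda>j. jbr j powr s * sy c j"
  let ?cv = "conv3 ?v ?v ?E"
  define C where "C = Kc * 3 powr s"
  define g where "g = (\<lambda>j. 4 * C * (?cv j + ?cv (- j)))"
  define h where "h = 16 * C * V\<^sup>2 * H"
  have C: "0 \<le> C" by (simp add: C_def Kc_nonneg)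
  have V0: "0 \<le> V" and H0: "0 \<le> H" using V E by (auto dest: l2b_const_nonneg)
  note v = v2[OF V] v1[OF V]
  have n: "l2b ?n (32 * Kc * V ^ 3)"
    using l2b_sym[OF nl_l2b[OF V]] by (simp add: sy_def[abs_def] mult_ac)
  have "l2b ?cv (2 * V * (2 * V) * H)" by (rule l2b_conv3[OF v(2) v(2) E])
  then have g: "l2b g (32 * C * V\<^sup>2 * H)"
    using l2b_scale[OF l2b_sym, of ?cv "2 * V * (2 * V) * H" "4 * C"] C
    unfolding g_def by (simp add: power2_eq_square mult_ac)
  have h0: "0 \<le> h" using C H0 by (simp add: h_def)
  have nw: "jbr j powr s * ?n j \<le> jbr j * g j + h" for j
    using nl_weighted[OF V E s, of j] nl_weighted[OF V E s, of "- j"]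
    unfolding sy_def[of "nl c"] g_def h_def C_def[symmetric] by (simp add: algebra_simps)
  let ?W = "\<lambda>i. Wt k (a i) (b i) (d i)"
  have pt: "jbr k powr s * (?W i * (?n (a i) * ?v (b i) * ?v (d i)))
     \<le> 3 powr s * (jbr (a i) * ?W i * (g (a i) * ?v (b i) * ?v (d i)) + 3 * (h * (?v (b i) * ?v (d i)))
       + ?W i * (?n (a i) * ?E (b i) * ?v (d i)) + ?W i * (?n (a i) * ?v (b i) * ?E (d i)))"
    if "i \<in> I" for i
  proof -
    define w where "w = ?W i * (?v (b i) * ?v (d i))"
    have w: "0 \<le> w" by (simp add: w_def sy_nonneg Wt_nonneg)
    have "jbr k powr s \<le> 3 powr s * (jbr (a i) powr s + jbr (b i) powr s + jbr (d i) powr s)"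
      by (rule jbr_powr_add3_le) (use tri_sum[OF t that] s in auto)
    then have "jbr k powr s * (?n (a i) * w)
       \<le> 3 powr s * (jbr (a i) powr s + jbr (b i) powr s + jbr (d i) powr s) * (?n (a i) * w)"
      using w by (intro mult_right_mono) (auto simp: sy_nonneg)
    also have "\<dots> = 3 powr s * ((jbr (a i) powr s * ?n (a i)) * w
        + (jbr (b i) powr s + jbr (d i) powr s) * (?n (a i) * w))"
      by (simp add: algebra_simps)
    also have "\<dots> \<le> 3 powr s * ((jbr (a i) * g (a i) + h) * w
        + (jbr (b i) powr s + jbr (d i) powr s) * (?n (a i) * w))"
      using nw w by (intro mult_left_mono add_right_mono mult_right_mono) auto
    also have "\<dots> \<le> 3 powr s * (jbr (a i) * g (a i) * w + h * (3 * (?v (b i) * ?v (d i)))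
        + (jbr (b i) powr s + jbr (d i) powr s) * (?n (a i) * w))"
    proof -
      have "w \<le> 3 * (?v (b i) * ?v (d i))"
        unfolding w_def by (intro mult_right_mono Wt_le) (simp add: sy_nonneg)
      then have "h * w \<le> h * (3 * (?v (b i) * ?v (d i)))" using h0 by (rule mult_left_mono)
      then show ?thesis by (intro mult_left_mono) (auto simp: distrib_right)
    qed
    finally show ?thesis unfolding w_def by (simp add: algebra_simps)
  qed
  have one: "(\<Sum>i\<in>I. h * (?v (b i) * ?v (d i))) \<le> h * (4 * V\<^sup>2)"
    using young_l1_l1_bounded[OF tri_rot[OF t] v(2) v(2), of "\<lambda>_. h" h] h0
    by (simp add: power2_eq_square mult_ac)
  have "(\<Sum>i\<in>I. jbr k powr s * (?W i * (?n (a i) * ?v (b i) * ?v (d i))))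
     \<le> (\<Sum>i\<in>I. 3 powr s * (jbr (a i) * ?W i * (g (a i) * ?v (b i) * ?v (d i)) + 3 * (h * (?v (b i) * ?v (d i)))
       + ?W i * (?n (a i) * ?E (b i) * ?v (d i)) + ?W i * (?n (a i) * ?v (b i) * ?E (d i))))"
    by (intro sum_mono pt)
  also have "\<dots> = 3 powr s * ((\<Sum>i\<in>I. jbr (a i) * ?W i * (g (a i) * ?v (b i) * ?v (d i)))
       + 3 * (\<Sum>i\<in>I. h * (?v (b i) * ?v (d i)))
       + (\<Sum>i\<in>I. ?W i * (?n (a i) * ?E (b i) * ?v (d i)))
       + (\<Sum>i\<in>I. ?W i * (?n (a i) * ?v (b i) * ?E (d i))))"
    unfolding sum_distrib_left sum.distrib[symmetric] ..
  also have "\<dots> \<le> 3 powr s * (30 * (32 * C * V\<^sup>2 * H) * V\<^sup>2 + 3 * (h * (4 * V\<^sup>2))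
       + 12 * (32 * Kc * V ^ 3) * H * V + 12 * (32 * Kc * V ^ 3) * V * H)"
    using Wt_sum_first_le[OF t g V] one Wt_sum_le[OF t n E v(1)] Wt_sum_le[OF t n v(1) E]
    by (intro mult_left_mono add_mono) auto
  also have "\<dots> = 3 powr s * (1152 * C * V ^ 4 * H + 768 * Kc * V ^ 4 * H)"
    by (simp add: h_def power2_eq_square power3_eq_cube power4_eq_xxxx algebra_simps)
  also have "\<dots> \<le> 3 powr s * (1152 * C * V ^ 4 * H + 768 * C * V ^ 4 * H)"
  proof -
    have "Kc * 1 \<le> C" unfolding C_def using Kc_nonneg s by (intro mult_left_mono) (auto intro: ge_one_powr_ge_zero)
    then show ?thesis using V0 H0 by (intro mult_left_mono add_left_mono mult_right_mono) auto
  qed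
  also have "\<dots> = 1920 * Kc * (3 powr s * 3 powr s) * V ^ 4 * H" by (simp add: C_def algebra_simps)
  also have "3 powr s * 3 powr s = (9::real) powr s" by (simp add: powr_mult[symmetric])
  finally show ?thesis .
qed

lemma Qn_le: "jbr k powr s * cmod (Qn n k c) \<le> 5760 * Kw * Kc * 9 powr s * V ^ 4 * H"
proof -
  let ?v = "sy c" and ?n = "sy (nl c)" and ?I = "NR n k"
  let ?b = "\<lambda>i::int \<times> int. k - fst i - snd i"
  let ?X = "1920 * Kc * 9 powr s * V ^ 4 * H"
  note t = tri_pairs[OF finite_NR[of n k], of k]
  define q where "q i = nl c (fst i) * cnj (c (fst i + snd i - k)) * c (snd i)
       + c (fst i) * cnj (nl c (fst i + snd i - k)) * c (snd i)
       + c (fst i) * cnj (c (fst i + snd i - k)) * nl c (snd i)" for i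
  have m: "cmod (x (fst i + snd i - k)) \<le> sy x (?b i)" for x i
    using sy_ge_minus[of x "?b i"] by (simp add: algebra_simps)
  have q: "cmod (q i) \<le> ?n (fst i) * ?v (?b i) * ?v (snd i) + ?v (fst i) * ?n (?b i) * ?v (snd i)
      + ?v (fst i) * ?v (?b i) * ?n (snd i)" for i
    unfolding q_def
    by (intro norm_triangle_mono; unfold norm_mult complex_mod_cnj)
       (intro mult_mono m sy_ge mult_nonneg_nonneg sy_nonneg norm_ge_zero)+
  have pt: "jbr k powr s * cmod (multiplier k i * q i)
     \<le> Kw * (jbr k powr s * (Wt k (fst i) (?b i) (snd i) * (?n (fst i) * ?v (?b i) * ?v (snd i)))
        + jbr k powr s * (Wt k (?b i) (snd i) (fst i) * (?n (?b i) * ?v (snd i) * ?v (fst i)))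
        + jbr k powr s * (Wt k (snd i) (fst i) (?b i) * (?n (snd i) * ?v (fst i) * ?v (?b i))))"
    if "i \<in> ?I" for i
  proof -
    have "jbr k powr s * cmod (multiplier k i * q i) \<le> jbr k powr s * ((Kw * Wt k (fst i) (?b i) (snd i)) *
       (?n (fst i) * ?v (?b i) * ?v (snd i) + ?v (fst i) * ?n (?b i) * ?v (snd i)
      + ?v (fst i) * ?v (?b i) * ?n (snd i)))"
      unfolding norm_mult
      by (intro mult_left_mono mult_mono multiplier_NR_le[OF that] q mult_nonneg_nonneg Kw_nonneg Wt_nonneg) auto
    then show ?thesis
      unfolding Wt_rot[of k "fst i" "?b i", symmetric] Wt_rot[of k "snd i"]
      by (simp add: algebra_simps)
  qed
  have "jbr k powr s * cmod (Qn n k c) \<le> jbr k powr s * (\<Sum>i\<in>?I. cmod (multiplier k i * q i))"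
    unfolding Qn_def q_def[symmetric] by (intro mult_left_mono norm_sum) auto
  also have "\<dots> \<le> (\<Sum>i\<in>?I. Kw * (jbr k powr s * (Wt k (fst i) (?b i) (snd i) * (?n (fst i) * ?v (?b i) * ?v (snd i)))
        + jbr k powr s * (Wt k (?b i) (snd i) (fst i) * (?n (?b i) * ?v (snd i) * ?v (fst i)))
        + jbr k powr s * (Wt k (snd i) (fst i) (?b i) * (?n (snd i) * ?v (fst i) * ?v (?b i)))))"
    unfolding sum_distrib_left by (intro sum_mono pt)
  also have "\<dots> = Kw * ((\<Sum>i\<in>?I. jbr k powr s * (Wt k (fst i) (?b i) (snd i) * (?n (fst i) * ?v (?b i) * ?v (snd i))))
        + (\<Sum>i\<in>?I. jbr k powr s * (Wt k (?b i) (snd i) (fst i) * (?n (?b i) * ?v (snd i) * ?v (fst i))))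
        + (\<Sum>i\<in>?I. jbr k powr s * (Wt k (snd i) (fst i) (?b i) * (?n (snd i) * ?v (fst i) * ?v (?b i)))))"
    unfolding sum_distrib_left sum.distrib[symmetric] ..
  also have "\<dots> \<le> Kw * (?X + ?X + ?X)"
    using nl_slot[OF t] nl_slot[OF tri_rot[OF t]] nl_slot[OF tri_rot[OF tri_rot[OF t]]] Kw_nonneg
    by (intro mult_left_mono add_mono) auto
  finally show ?thesis by (simp add: mult_ac)
qed

end

lemma Mn_le:
  assumes "l2b (\<lambda>j. jbr j * cmod (c j)) A"
  shows "Mn n c \<le> A\<^sup>2" "\<bar>Pn n c\<bar> \<le> A\<^sup>2"
proof -
  let ?J = "{- int n..int n}"
  have A: "0 \<le> A" using assms by (rule l2b_const_nonneg)
  have "L2_set (\<lambda>j. jbr j * cmod (c j)) ?J \<le> A" using assms by (rule l2bD) simp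
  then have "(L2_set (\<lambda>j. jbr j * cmod (c j)) ?J)\<^sup>2 \<le> A\<^sup>2" by (intro power_mono) (auto simp: L2_set_nonneg)
  then have *: "(\<Sum>j\<in>?J. (jbr j * cmod (c j))\<^sup>2) \<le> A\<^sup>2"
    unfolding L2_set_def by (simp add: sum_nonneg)
  have sq: "(jbr j)\<^sup>2 \<ge> 1" "(jbr j)\<^sup>2 \<ge> \<bar>of_int j\<bar>" for j
  proof -
    show "(jbr j)\<^sup>2 \<ge> 1" using jbr_ge1[of j] by (simp add: one_le_power)
    have "(jbr j)\<^sup>2 \<ge> jbr j" using jbr_ge1[of j] by (simp add: power2_eq_square)
    then show "(jbr j)\<^sup>2 \<ge> \<bar>of_int j\<bar>" unfolding jbr_def bracket_def by linarith
  qed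
  have "1 * (cmod (c j))\<^sup>2 \<le> (jbr j)\<^sup>2 * (cmod (c j))\<^sup>2" for j
    by (intro mult_right_mono sq) auto
  then have "Mn n c \<le> (\<Sum>j\<in>?J. (jbr j * cmod (c j))\<^sup>2)"
    unfolding Mn_def by (intro sum_mono) (simp add: power_mult_distrib)
  then show "Mn n c \<le> A\<^sup>2" using * by simp
  have "\<bar>of_int j\<bar> * (cmod (c j))\<^sup>2 \<le> (jbr j)\<^sup>2 * (cmod (c j))\<^sup>2" for j
    by (intro mult_right_mono sq) auto
  then have "(\<Sum>j\<in>?J. \<bar>of_int j\<bar> * (cmod (c j))\<^sup>2) \<le> (\<Sum>j\<in>?J. (jbr j * cmod (c j))\<^sup>2)"
    by (intro sum_mono) (simp add: power_mult_distrib)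
  moreover have "\<bar>Pn n c\<bar> \<le> (\<Sum>j\<in>?J. \<bar>of_int j\<bar> * (cmod (c j))\<^sup>2)"
    unfolding Pn_def by (rule order_trans[OF sum_abs]) (simp add: abs_mult)
  ultimately show "\<bar>Pn n c\<bar> \<le> A\<^sup>2" using * by simp
qed

section \<open>The system for the coefficients and the drift of the mass\<close>

definition ode_on :: "real set \<Rightarrow> (real \<Rightarrow> int \<Rightarrow> complex) \<Rightarrow> bool" where
  "ode_on I c \<longleftrightarrow> (\<forall>t\<in>I. \<forall>j. ((\<lambda>t. c t j) has_vector_derivative
      (- (\<i> * of_real (om j)) * c t j + nl (c t) j)) (at t within I))"

lemma ode_on_subset: "ode_on I c \<Longrightarrow> J \<subseteq> I \<Longrightarrow> ode_on J c"
  unfolding ode_on_def by (meson has_vector_derivative_within_subset subsetD)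

definition KL :: "real \<Rightarrow> real" where
  "KL A = 512 * Kc * A ^ 4"

text \<open>The dispersive part is orthogonal to the coefficient and drops out of the derivative;
  what remains is bounded by Cauchy-Schwarz between two l^2 sequences, uniformly in n.\<close>

lemma Mn_lipschitz:
  assumes ode: "ode_on {0..\<tau>} c" and A: "\<And>t. t \<in> {0..\<tau>} \<Longrightarrow> l2b (\<lambda>j. jbr j * cmod (c t j)) A"
    and t: "t \<in> {0..\<tau>}"
  shows "\<bar>Mn n (c t) - Mn n (c 0)\<bar> \<le> KL A * t"
proof (cases "t = 0")
  case False
  let ?J = "{- int n..int n}"
  let ?f' = "\<lambda>t. \<Sum>j\<in>?J. 2 * (c t j \<bullet> (- (\<i> * of_real (om j)) * c t j + nl (c t) j))"
  have d: "((\<lambda>t. Mn n (c t)) has_vector_derivative ?f' x) (at x within {0..\<tau>})" if "x \<in> {0..\<tau>}" for x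
    unfolding Mn_def dot_square_norm[symmetric]
  proof (rule has_vector_derivative_sum)
    fix j
    have "((\<lambda>t. c t j) has_vector_derivative
        (- (\<i> * of_real (om j)) * c x j + nl (c x) j)) (at x within {0..\<tau>})"
      using ode that unfolding ode_on_def by blast
    from bounded_bilinear.has_vector_derivative[OF bounded_bilinear_inner this this]
    show "((\<lambda>t. c t j \<bullet> c t j) has_vector_derivative
        2 * (c x j \<bullet> (- (\<i> * of_real (om j)) * c x j + nl (c x) j))) (at x within {0..\<tau>})"
      by (simp add: inner_commute)
  qed
  have bnd: "\<bar>?f' x\<bar> \<le> KL A" if x: "x \<in> {0..\<tau>}" for x
  proof -
    have A0: "0 \<le> A" using A[OF x] by (rule l2b_const_nonneg)
    have "l2b (\<lambda>j. jbr j powr 1 * cmod (c x j)) A" using A[OF x] jbr_nonneg by simp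
    from l2b_sy[OF this] have V: "l2b (\<lambda>j. jbr j * sy (c x) j) (2 * A)"
      using jbr_nonneg by simp
    have rot: "c x j \<bullet> (- (\<i> * of_real (om j)) * c x j + nl (c x) j) = c x j \<bullet> nl (c x) j" for j
      by (simp add: inner_complex_def algebra_simps)
    have "\<bar>?f' x\<bar> \<le> (\<Sum>j\<in>?J. \<bar>2 * (c x j \<bullet> nl (c x) j)\<bar>)"
      unfolding rot by (rule sum_abs)
    also have "\<dots> \<le> (\<Sum>j\<in>?J. 2 * (\<bar>sy (c x) j\<bar> * \<bar>cmod (nl (c x) j)\<bar>))"
    proof (rule sum_mono)
      fix j
      have "\<bar>c x j \<bullet> nl (c x) j\<bar> \<le> cmod (c x j) * cmod (nl (c x) j)"
        by (rule Cauchy_Schwarz_ineq2)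
      also have "\<dots> \<le> sy (c x) j * cmod (nl (c x) j)"
        by (intro mult_right_mono sy_ge) auto
      finally show "\<bar>2 * (c x j \<bullet> nl (c x) j)\<bar> \<le> 2 * (\<bar>sy (c x) j\<bar> * \<bar>cmod (nl (c x) j)\<bar>)"
        by (simp add: sy_nonneg)
    qed
    also have "\<dots> \<le> 2 * (L2_set (sy (c x)) ?J * L2_set (\<lambda>j. cmod (nl (c x) j)) ?J)"
      unfolding sum_distrib_left[symmetric] by (intro mult_left_mono L2_set_mult_ineq) auto
    also have "\<dots> \<le> 2 * ((2 * A) * (16 * Kc * (2 * A) ^ 3))"
      using l2bD[OF v2[OF V], of ?J] l2bD[OF nl_l2b[OF V], of ?J] A0
      by (intro mult_left_mono mult_mono) (auto simp: L2_set_nonneg)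
    also have "\<dots> = KL A" by (simp add: KL_def power_mult_distrib power4_eq_xxxx power3_eq_cube)
    finally show ?thesis .
  qed
  have sub: "{0..t} \<subseteq> {0..\<tau>}" using t by auto
  have "norm (Mn n (c t) - Mn n (c 0)) \<le> KL A * t - KL A * 0"
  proof (rule differentiable_bound_general)
    show "0 < t" using t False by auto
    show "continuous_on {0..t} (\<lambda>t. Mn n (c t))"
      by (rule continuous_on_subset[OF continuous_on_vector_derivative[OF d] sub])
    fix x assume x: "0 < x" "x < t"
    then have "at x within {0..\<tau>} = at x" using t by (intro at_within_Icc_at) auto
    then show "((\<lambda>t. Mn n (c t)) has_vector_derivative ?f' x) (at x)"
      using d[of x] x t by auto
    show "((\<lambda>t. KL A * t) has_vector_derivative KL A) (at x)"
      by (auto intro!: derivative_eq_intros)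
    show "norm (?f' x) \<le> KL A" using bnd[of x] x t by auto
  qed (auto intro!: continuous_intros)
  then show ?thesis by simp
qed simp

text \<open>The comparison function is the explicit antiderivative of the majorant. A constant error
  gains 1 / \<kappa> and a linearly growing one 1 / \<kappa>^2; the latter compensates the factor k
  in the drift of the mass.\<close>

lemma exp_decay_bound:
  fixes y :: "real \<Rightarrow> complex"
  assumes "0 < \<tau>" "0 < \<kappa>" "0 \<le> a" "0 \<le> b"
    and y: "\<And>t. t \<in> {0..\<tau>} \<Longrightarrow> (y has_vector_derivative y' t) (at t within {0..\<tau>})"
    and b: "\<And>t. t \<in> {0..\<tau>} \<Longrightarrow> cmod (y' t) \<le> exp (- \<kappa> * t) * (a + b * t)"
  shows "cmod (y \<tau> - y 0) \<le> a / \<kappa> + b / \<kappa>\<^sup>2"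
proof -
  let ?\<phi> = "\<lambda>t. - exp (- \<kappa> * t) * (a / \<kappa> + b * t / \<kappa> + b / \<kappa>\<^sup>2)"
  have "cmod (y \<tau> - y 0) \<le> ?\<phi> \<tau> - ?\<phi> 0"
  proof (rule differentiable_bound_general)
    show "0 < \<tau>" by fact
    show "continuous_on {0..\<tau>} y" using y by (rule continuous_on_vector_derivative)
    show "continuous_on {0..\<tau>} ?\<phi>" using assms(2) by (auto intro!: continuous_intros)
    fix x assume x: "0 < x" "x < \<tau>"
    then have "at x within {0..\<tau>} = at x" by (intro at_within_Icc_at) auto
    then show "(y has_vector_derivative y' x) (at x)" using y[of x] x by auto
    have "(?\<phi> has_real_derivative exp (- \<kappa> * x) * (a + b * x)) (at x)"
      using assms(2) by (auto intro!: derivative_eq_intros simp: field_simps power2_eq_square)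
    then show "(?\<phi> has_vector_derivative exp (- \<kappa> * x) * (a + b * x)) (at x)"
      by (simp add: has_real_derivative_iff_has_vector_derivative)
    show "norm (y' x) \<le> exp (- \<kappa> * x) * (a + b * x)" using b[of x] x by auto
  qed
  also have "\<dots> \<le> a / \<kappa> + b / \<kappa>\<^sup>2"
    using assms by simp
  finally show ?thesis .
qed

definition Dst :: "real \<Rightarrow> real \<Rightarrow> real \<Rightarrow> real" where
  "Dst A m \<tau> = 1440 * Kw * A\<^sup>2 + 8 * Kc * A\<^sup>2 / (\<Gamma> * m) + 2880 * Kc * Kw * A\<^sup>2 / \<Gamma>
     + 368640 * Kw * Kc * A ^ 4 / (\<Gamma> * m) + 4 * Kc * KL A / (\<Gamma>\<^sup>2 * m\<^sup>2) + 2 / (\<Gamma> * m * \<tau>)"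

text \<open>The three linear phases add up to \<open>om k\<close> minus \<open>Phi\<close>. The
  factor i \<open>Phi\<close> cancels the denominator of the multiplier and restores the nonresonant
  cubic sum.\<close>

lemma Bn_derivative:
  assumes ode: "ode_on I c" and t: "t \<in> I"
  shows "((\<lambda>t. Bn n k (c t)) has_vector_derivative
    sum (nlt (c t) k) (NR n k) - \<i> * of_real (om k) * Bn n k (c t) + Qn n k (c t)) (at t within I)"
proof -
  have d: "((\<lambda>t. c t j) has_vector_derivative
        (- (\<i> * of_real (om j)) * c t j + nl (c t) j)) (at t within I)" for j
    using ode t unfolding ode_on_def by blast
  define D where "D i = multiplier k i *
     (((- (\<i> * of_real (om (fst i))) * c t (fst i) + nl (c t) (fst i)) * cnj (c t (fst i + snd i - k))
       + c t (fst i) * cnj (- (\<i> * of_real (om (fst i + snd i - k))) * c t (fst i + snd i - k) + nl (c t) (fst i + snd i - k))) * c t (snd i)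
      + c t (fst i) * cnj (c t (fst i + snd i - k)) * (- (\<i> * of_real (om (snd i))) * c t (snd i) + nl (c t) (snd i)))" for i
  have "((\<lambda>t. Bn n k (c t)) has_vector_derivative (\<Sum>i\<in>NR n k. D i)) (at t within I)"
    unfolding Bn_def
  proof (rule has_vector_derivative_sum)
    fix i
    show "((\<lambda>t. multiplier k i * (c t (fst i) * cnj (c t (fst i + snd i - k)) * c t (snd i)))
        has_vector_derivative D i) (at t within I)"
      unfolding D_def
      by (rule derivative_eq_intros has_vector_derivative_mult d has_vector_derivative_cnj refl)+
         (simp add: algebra_simps)
  qed
  moreover have "(\<Sum>i\<in>NR n k. D i)
     = sum (nlt (c t) k) (NR n k) - \<i> * of_real (om k) * Bn n k (c t) + Qn n k (c t)"
    unfolding Bn_def Qn_def sum_distrib_left sum_subtractf[symmetric] sum.distrib[symmetric]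
  proof (rule sum.cong[OF refl])
    fix i assume i: "i \<in> NR n k"
    define x y z where "x = c t (fst i)" and "y = cnj (c t (fst i + snd i - k))" and "z = c t (snd i)"
    have ph: "Phi k (fst i) (snd i) \<noteq> 0" using i by (intro Phi_nz) (auto simp: NR_def)
    have nz: "nlw k (snd i) = multiplier k i * (\<i> * of_real (Phi k (fst i) (snd i)))"
      using ph by (simp add: multiplier_def)
    show "D i = nlt (c t) k i - \<i> * of_real (om k) * (multiplier k i * (c t (fst i) * cnj (c t (fst i + snd i - k)) * c t (snd i)))
       + multiplier k i *
      (nl (c t) (fst i) * cnj (c t (fst i + snd i - k)) * c t (snd i)
       + c t (fst i) * cnj (nl (c t) (fst i + snd i - k)) * c t (snd i)
       + c t (fst i) * cnj (c t (fst i + snd i - k)) * nl (c t) (snd i))"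
      unfolding D_def nlt_def nz Phi_def complex_cnj_add complex_cnj_mult complex_cnj_minus
        x_def[symmetric] y_def[symmetric] z_def[symmetric]
      by (simp add: algebra_simps)
  qed
  ultimately show ?thesis by simp
qed

text \<open>The difference of \<open>c t k\<close> and its normal form, multiplied by exp (- t
  \<open>lam\<close>), has a derivative bounded by a multiple of exp (- \<kappa> t) (a + b t) with
  \<kappa> proportional to k, so that integration over [0, \<tau>] gains 1 / k. Since the solution
  is bounded in H^s up to time \<tau>, the growing mode is estimated backwards from there, at the
  cost of exp (- \<kappa> \<tau>).\<close>

theorem one_step:
  assumes \<tau>: "0 < \<tau>" and s: "0 \<le> s" and k: "0 < k"
    and ode: "ode_on {0..\<tau>} c"
    and A: "\<And>t. t \<in> {0..\<tau>} \<Longrightarrow> l2b (\<lambda>j. jbr j * cmod (c t j)) A"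
    and H: "\<And>t. t \<in> {0..\<tau>} \<Longrightarrow> l2b (\<lambda>j. jbr j powr s * cmod (c t j)) H"
    and M0: "((\<lambda>j. (cmod (c 0 j))\<^sup>2) has_sum M0) UNIV" "0 < M0"
  shows "jbr k powr (s + 1) * cmod (c 0 k) \<le> Dst A M0 \<tau> * 9 powr s * H"
proof -
  define J where "J = jbr k powr s"
  define K where "K = real_of_int k"
  \<comment> \<open>The constants of \<open>Bn_le\<close> and \<open>Qn_le\<close> with 2 A for V
    and 2 H for H; the doubling comes from the even majorant \<open>sy\<close>.\<close>
  define \<beta> where "\<beta> = 720 * Kw * 3 powr s * H * A\<^sup>2"
  define Qb where "Qb = 184320 * Kw * Kc * 9 powr s * A ^ 4 * H"
  define \<kappa> where "\<kappa> = \<Gamma> * K * M0"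
  \<comment> \<open>Resonant rate per unit of k and of mass: growth \<Gamma> and, from the term with
    \<gamma>2, a rotation 2 \<gamma>2. Both are of order k and must go into the exponential; apart
    from the drift of the mass, what is left is of order one.\<close>
  define z where "z = Complex \<Gamma> (2 * \<gamma>2)"
  define lam where "lam = of_real (K * M0) * z - \<i> * of_real (om k)"
  define \<delta> where "\<delta> n = M0 - Mn n (c 0)" for n
  define \<epsilon> where "\<epsilon> n = 12 * Kc * jbr k * (2 * A) ^ 3 / (real n + 1)" for n
  define a where "a n = 4 * Kc * A\<^sup>2 * H + 2 * Kc * M0 * \<beta> + Qb + (2 * Kc * K * \<delta> n * H + J * \<epsilon> n)" for n
  define b where "b = 2 * Kc * K * KL A * H"
  have t0: "0 \<in> {0..\<tau>}" and t1: "\<tau> \<in> {0..\<tau>}" using \<tau> by auto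
  have A0: "0 \<le> A" and H0: "0 \<le> H" using A[OF t0] H[OF t0] by (auto dest: l2b_const_nonneg)
  have K1: "1 \<le> K" using k by (simp add: K_def)
  have jbK: "jbr k = 1 + K" using k by (simp add: jbr_def bracket_def K_def)
  have KL0: "0 \<le> KL A" unfolding KL_def using Kc_nonneg by simp
  have \<beta>0: "0 \<le> \<beta>" and Qb0: "0 \<le> Qb" and J0: "0 \<le> J"
    using Kw_nonneg Kc_nonneg A0 H0 by (auto simp: \<beta>_def Qb_def J_def)
  have \<kappa>: "0 < \<kappa>" using \<Gamma>_pos K1 M0 by (simp add: \<kappa>_def)
  have z: "cmod z \<le> 2 * Kc"
    using cmod_le[of z] \<Gamma>_pos unfolding z_def Kc_def by simp
  have V: "l2b (\<lambda>j. jbr j * sy (c t) j) (2 * A)" if "t \<in> {0..\<tau>}" for t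
    using l2b_sy[of 1 "c t" A] A[OF that] jbr_nonneg by simp
  have E: "l2b (\<lambda>j. jbr j powr s * sy (c t) j) (2 * H)" if "t \<in> {0..\<tau>}" for t
    using l2b_sy[OF H[OF that]] .
  have Bn: "J * (jbr k * cmod (Bn n k (c t))) \<le> \<beta>" if "t \<in> {0..\<tau>}" for n t
    using Bn_le[OF V[OF that] E[OF that] s, of k n] unfolding J_def \<beta>_def by (simp add: mult_ac)
  have Bn': "J * (K * cmod (Bn n k (c t))) \<le> \<beta>" "jbr k * (J * cmod (Bn n k (c t))) \<le> \<beta>"
    if "t \<in> {0..\<tau>}" for n t
  proof -
    have "J * (K * cmod (Bn n k (c t))) \<le> J * (jbr k * cmod (Bn n k (c t)))"
      using J0 jbK by (intro mult_left_mono mult_right_mono) auto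
    then show "J * (K * cmod (Bn n k (c t))) \<le> \<beta>" using Bn[OF that, of n] by linarith
    show "jbr k * (J * cmod (Bn n k (c t))) \<le> \<beta>" using Bn[OF that, of n] by (simp add: mult_ac)
  qed
  have Qn: "J * cmod (Qn n k (c t)) \<le> Qb" if "t \<in> {0..\<tau>}" for n t
    using Qn_le[OF V[OF that] E[OF that] s, of k n] unfolding J_def Qb_def by (simp add: mult_ac)
  have ck: "J * cmod (c t k) \<le> H" if "t \<in> {0..\<tau>}" for t
    using l2b_pt[OF H[OF that], of k] unfolding J_def .
  have \<delta>0: "0 \<le> \<delta> n" for n
    unfolding \<delta>_def Mn_def
    using has_sum_mono_neutral[OF has_sum_finite[of "{- int n..int n}" "\<lambda>j. (cmod (c 0 j))\<^sup>2"] M0(1)]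
    by auto
  have \<delta>: "\<delta> \<longlonglongrightarrow> 0"
    unfolding \<delta>_def Mn_def
    using tendsto_diff[OF tendsto_const has_sum_symm_interval[OF M0(1)], of M0] by simp
  have \<epsilon>0: "0 \<le> \<epsilon> n" for n
    unfolding \<epsilon>_def using Kc_nonneg jbr_nonneg A0 by simp
  have \<epsilon>: "\<epsilon> \<longlonglongrightarrow> 0"
    unfolding \<epsilon>_def
    using tendsto_mult[OF tendsto_const LIMSEQ_inverse_real_of_nat, of "12 * Kc * jbr k * (2 * A) ^ 3"]
    by (simp add: divide_inverse add.commute)
  \<comment> \<open>For n at least |k| the resonant lines lie in the box. The quantities
    \<open>\<delta> n\<close> and \<open>\<epsilon> n\<close> measure the truncation and disappear
    as n tends to infinity.\<close>
  have main: "J * cmod (c 0 k) \<le> \<beta> / jbr k + (a n / \<kappa> + b / \<kappa>\<^sup>2) + exp (- \<kappa> * \<tau>) * (H + \<beta> / jbr k)"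
    if n: "\<bar>k\<bar> \<le> int n" for n
  proof -
    let ?e = "\<lambda>t. exp (- of_real t * lam)"
    let ?y = "\<lambda>t. of_real J * (?e t * (c t k - Bn n k (c t)))"
    define err where "err t = nl (c t) k - sum (nlt (c t) k) (square_box n)" for t
    \<comment> \<open>Resonant remainder: the rate with the mass replaced by its deviation from the
      initial one, plus bounded terms; in the last of them the factor K is compensated by the decay
      of \<open>c t k\<close> in H^1.\<close>
    define S where "S t = c t k * (of_real (K * (Mn n (c t) - M0)) * z + \<i> * of_real (2 * \<gamma>1 * Mn n (c t))
       - of_real (\<Gamma> * Pn n (c t)) - \<i> * of_real ((\<gamma>1 + \<gamma>2 * K) * (cmod (c t k))\<^sup>2))" for t
    define G where "G t = S t + err t + of_real (K * M0) * z * Bn n k (c t) - Qn n k (c t)" for t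
    have ne: "cmod (?e t) = exp (- \<kappa> * t)" for t
      by (simp add: norm_exp_eq_Re lam_def z_def \<kappa>_def)
    have dy: "(?y has_vector_derivative of_real J * (?e t * G t)) (at t within {0..\<tau>})"
      if t: "t \<in> {0..\<tau>}" for t
    proof -
      have dc: "((\<lambda>t. c t k) has_vector_derivative
          (- (\<i> * of_real (om k)) * c t k + nl (c t) k)) (at t within {0..\<tau>})"
        using ode t unfolding ode_on_def by blast
      have de: "(?e has_vector_derivative (- lam * ?e t)) (at t within {0..\<tau>})"
      proof -
        have "((\<lambda>w. exp (- w * lam)) has_field_derivative (- lam * exp (- of_real t * lam))) (at (of_real t))"
          by (auto intro!: derivative_eq_intros)
        from has_vector_derivative_real_field[OF this]
        show ?thesis by (rule has_vector_derivative_at_within)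
      qed
      have zeq: "z = of_real \<Gamma> + \<i> * of_real (2 * \<gamma>2)"
        unfolding z_def by (simp add: complex_eq_iff)
      have "nl (c t) k = err t + sum (nlt (c t) k) (NR n k) + S t + of_real (K * M0) * z * c t k"
      proof -
        have "S t + of_real (K * M0) * z * c t k = c t k * ((of_real (K * (Mn n (c t) - M0)) * z + of_real (K * M0) * z)
           + \<i> * of_real (2 * \<gamma>1 * Mn n (c t))
           - of_real (\<Gamma> * Pn n (c t)) - \<i> * of_real ((\<gamma>1 + \<gamma>2 * K) * (cmod (c t k))\<^sup>2))"
          unfolding S_def by (simp add: algebra_simps)
        also have "\<dots> = c t k * (of_real (\<Gamma> * of_int k * Mn n (c t) - \<Gamma> * Pn n (c t))
             + \<i> * of_real ((\<gamma>1 + \<gamma>2 * of_int k) * (2 * Mn n (c t) - (cmod (c t k))\<^sup>2)))"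
          unfolding zeq K_def by (simp add: algebra_simps)
        finally show ?thesis unfolding err_def using resonant_split[OF n, of "c t"] by simp
      qed
      then have eq: "- (\<i> * of_real (om k)) * c t k + nl (c t) k
           - (sum (nlt (c t) k) (NR n k) - \<i> * of_real (om k) * Bn n k (c t) + Qn n k (c t))
           = G t + lam * (c t k - Bn n k (c t))"
        unfolding G_def lam_def by (simp add: algebra_simps)
      have "((\<lambda>t. c t k - Bn n k (c t)) has_vector_derivative (G t + lam * (c t k - Bn n k (c t))))
          (at t within {0..\<tau>})"
        using has_vector_derivative_diff[OF dc Bn_derivative[OF ode t, of n k]] unfolding eq .
      from has_vector_derivative_mult[OF de this]
      have "((\<lambda>t. ?e t * (c t k - Bn n k (c t))) has_vector_derivative ?e t * G t) (at t within {0..\<tau>})"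
        by (simp add: algebra_simps)
      from has_vector_derivative_mult_right[OF this, of "of_real J"] show ?thesis .
    qed
    have bG: "J * cmod (G t) \<le> a n + b * t" if t: "t \<in> {0..\<tau>}" for t
    proof -
      have Mb: "\<bar>Mn n (c t) - M0\<bar> \<le> KL A * t + \<delta> n"
        using Mn_lipschitz[OF ode A t, of n] \<delta>0[of n] unfolding \<delta>_def by linarith
      have Mn0: "0 \<le> Mn n (c t)" by (simp add: Mn_def sum_nonneg)
      note MA = Mn_le[OF A[OF t], of n]
      have ck2: "K * (cmod (c t k))\<^sup>2 \<le> A\<^sup>2" "(cmod (c t k))\<^sup>2 \<le> A\<^sup>2"
      proof -
        have "(jbr k * cmod (c t k))\<^sup>2 \<le> A\<^sup>2"
          using l2b_pt[OF A[OF t], of k] jbr_nonneg by (intro power_mono) auto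
        moreover have "K \<le> (jbr k)\<^sup>2" "1 \<le> (jbr k)\<^sup>2"
          using K1 by (auto simp: jbK power2_eq_square algebra_simps)
        then have "K * (cmod (c t k))\<^sup>2 \<le> (jbr k)\<^sup>2 * (cmod (c t k))\<^sup>2"
          "1 * (cmod (c t k))\<^sup>2 \<le> (jbr k)\<^sup>2 * (cmod (c t k))\<^sup>2"
          by (intro mult_right_mono; simp)+
        ultimately show "K * (cmod (c t k))\<^sup>2 \<le> A\<^sup>2" "(cmod (c t k))\<^sup>2 \<le> A\<^sup>2"
          by (auto simp: power_mult_distrib)
      qed
      have e1: "cmod (of_real (K * (Mn n (c t) - M0)) * z) \<le> K * (KL A * t + \<delta> n) * (2 * Kc)"
        unfolding norm_mult norm_of_real abs_mult using K1 Mb z by (intro mult_mono) auto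
      have e2: "cmod (\<i> * of_real (2 * \<gamma>1 * Mn n (c t))) \<le> 2 * (\<bar>\<gamma>1\<bar> * A\<^sup>2)"
        unfolding norm_mult norm_of_real abs_mult using MA Mn0
        by (simp add: mult_left_mono)
      have e3: "cmod (of_real (\<Gamma> * Pn n (c t))) \<le> \<Gamma> * A\<^sup>2"
        unfolding norm_of_real abs_mult using MA \<Gamma>_pos by simp
      have e4: "cmod (\<i> * of_real ((\<gamma>1 + \<gamma>2 * K) * (cmod (c t k))\<^sup>2)) \<le> \<bar>\<gamma>1\<bar> * A\<^sup>2 + \<bar>\<gamma>2\<bar> * A\<^sup>2"
      proof -
        have "\<bar>(\<gamma>1 + \<gamma>2 * K) * (cmod (c t k))\<^sup>2\<bar> \<le> \<bar>\<gamma>1 * (cmod (c t k))\<^sup>2\<bar> + \<bar>\<gamma>2 * (K * (cmod (c t k))\<^sup>2)\<bar>"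
          by (simp add: distrib_right mult.assoc)
        also have "\<dots> \<le> \<bar>\<gamma>1\<bar> * A\<^sup>2 + \<bar>\<gamma>2\<bar> * A\<^sup>2"
          unfolding abs_mult using ck2 K1 by (intro add_mono mult_left_mono) (auto simp: abs_mult)
        finally show ?thesis by (simp only: norm_mult norm_ii norm_of_real mult_1_left)
      qed
      have g: "2 * (\<bar>\<gamma>1\<bar> * A\<^sup>2) + \<Gamma> * A\<^sup>2 + (\<bar>\<gamma>1\<bar> * A\<^sup>2 + \<bar>\<gamma>2\<bar> * A\<^sup>2) \<le> 4 * Kc * A\<^sup>2"
        unfolding Kc_def using \<Gamma>_pos by (simp add: algebra_simps)
      have "cmod (S t) \<le> cmod (c t k) * (K * (KL A * t + \<delta> n) * (2 * Kc) + 4 * Kc * A\<^sup>2)"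
        unfolding S_def norm_mult[of "c t k"]
      proof (rule mult_left_mono)
        show "cmod (of_real (K * (Mn n (c t) - M0)) * z + \<i> * of_real (2 * \<gamma>1 * Mn n (c t))
          - of_real (\<Gamma> * Pn n (c t)) - \<i> * of_real ((\<gamma>1 + \<gamma>2 * K) * (cmod (c t k))\<^sup>2))
          \<le> K * (KL A * t + \<delta> n) * (2 * Kc) + 4 * Kc * A\<^sup>2"
          using norm_triangle_le_diff[OF add_mono[OF norm_triangle_le_diff[OF add_mono[OF norm_triangle_le[OF add_mono[OF e1 e2]] e3]] e4]] g
          by linarith
      qed simp
      then have "J * cmod (S t) \<le> J * (cmod (c t k) * (K * (KL A * t + \<delta> n) * (2 * Kc) + 4 * Kc * A\<^sup>2))"
        using J0 by (rule mult_left_mono)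
      also have "\<dots> = (J * cmod (c t k)) * (K * (KL A * t + \<delta> n) * (2 * Kc) + 4 * Kc * A\<^sup>2)"
        by simp
      also have "\<dots> \<le> H * (K * (KL A * t + \<delta> n) * (2 * Kc) + 4 * Kc * A\<^sup>2)"
        using ck[OF t] K1 KL0 \<delta>0 Kc_nonneg t
        by (intro mult_right_mono add_nonneg_nonneg mult_nonneg_nonneg) auto
      finally have f1: "J * cmod (S t) \<le> H * (K * (KL A * t + \<delta> n) * (2 * Kc) + 4 * Kc * A\<^sup>2)" .
      have f2: "J * cmod (err t) \<le> J * \<epsilon> n"
        unfolding err_def \<epsilon>_def using nl_tail[OF V[OF t], of k n] J0 by (rule mult_left_mono)
      have "J * cmod (of_real (K * M0) * z * Bn n k (c t)) = M0 * cmod z * (J * (K * cmod (Bn n k (c t))))"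
        using K1 M0(2) by (simp add: norm_mult abs_mult)
      also have "\<dots> \<le> M0 * (2 * Kc) * \<beta>"
        using Bn'[OF t, of n] z M0(2) J0 K1 Kc_nonneg
        by (intro mult_mono mult_nonneg_nonneg) auto
      finally have f3: "J * cmod (of_real (K * M0) * z * Bn n k (c t)) \<le> M0 * (2 * Kc) * \<beta>" .
      have "cmod (G t) \<le> cmod (S t) + cmod (err t) + cmod (of_real (K * M0) * z * Bn n k (c t)) + cmod (Qn n k (c t))"
        unfolding G_def by (intro norm_triangle_le_diff add_mono norm_triangle_le) auto
      then have "J * cmod (G t) \<le> J * (cmod (S t) + cmod (err t) + cmod (of_real (K * M0) * z * Bn n k (c t)) + cmod (Qn n k (c t)))"
        using J0 by (rule mult_left_mono)
      also have "\<dots> \<le> H * (K * (KL A * t + \<delta> n) * (2 * Kc) + 4 * Kc * A\<^sup>2) + J * \<epsilon> n + M0 * (2 * Kc) * \<beta> + Qb"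
        unfolding distrib_left[of J] by (intro add_mono f1 f2 f3 Qn t)
      also have "\<dots> = a n + b * t" unfolding a_def b_def by (simp add: algebra_simps)
      finally show ?thesis .
    qed
    have "cmod (?y \<tau> - ?y 0) \<le> a n / \<kappa> + b / \<kappa>\<^sup>2"
    proof (rule exp_decay_bound[OF \<tau> \<kappa> _ _ dy])
      show "0 \<le> a n"
        unfolding a_def using Kc_nonneg A0 H0 M0 \<beta>0 Qb0 K1 \<delta>0 \<epsilon>0 J0
        by (intro add_nonneg_nonneg mult_nonneg_nonneg) auto
      show "0 \<le> b" unfolding b_def using Kc_nonneg K1 KL0 H0 by simp
      fix t assume t: "t \<in> {0..\<tau>}"
      have "cmod (of_real J * (?e t * G t)) = exp (- \<kappa> * t) * (J * cmod (G t))"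
        unfolding norm_mult ne using J0 by simp
      also have "\<dots> \<le> exp (- \<kappa> * t) * (a n + b * t)" using bG[OF t] by (intro mult_left_mono) auto
      finally show "cmod (of_real J * (?e t * G t)) \<le> exp (- \<kappa> * t) * (a n + b * t)" .
    qed
    moreover have "cmod (?y \<tau>) \<le> exp (- \<kappa> * \<tau>) * (H + \<beta> / jbr k)"
    proof -
      have "cmod (?y \<tau>) = exp (- \<kappa> * \<tau>) * (J * cmod (c \<tau> k - Bn n k (c \<tau>)))"
        unfolding norm_mult ne using J0 by simp
      also have "J * cmod (c \<tau> k - Bn n k (c \<tau>)) \<le> J * (cmod (c \<tau> k) + cmod (Bn n k (c \<tau>)))"
        using J0 by (intro mult_left_mono norm_triangle_ineq4) auto
      also have "\<dots> \<le> H + \<beta> / jbr k"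
        unfolding distrib_left using ck[OF t1] Bn'(2)[OF t1, of n] jbr_pos[of k]
        by (intro add_mono) (auto simp: pos_le_divide_eq mult.commute)
      finally show ?thesis by simp
    qed
    moreover have "J * cmod (c 0 k) \<le> cmod (?y 0) + \<beta> / jbr k"
    proof -
      have "J * cmod (c 0 k) \<le> J * (cmod (c 0 k - Bn n k (c 0)) + cmod (Bn n k (c 0)))"
        using J0 norm_triangle_ineq[of "c 0 k - Bn n k (c 0)" "Bn n k (c 0)"]
        by (intro mult_left_mono) auto
      also have "\<dots> = cmod (?y 0) + J * cmod (Bn n k (c 0))"
        using J0 by (simp add: norm_mult distrib_left)
      also have "J * cmod (Bn n k (c 0)) \<le> \<beta> / jbr k"
        using Bn'(2)[OF t0, of n] jbr_pos[of k] by (auto simp: pos_le_divide_eq mult.commute)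
      finally show ?thesis by simp
    qed
    moreover have "cmod (?y 0) \<le> cmod (?y \<tau> - ?y 0) + cmod (?y \<tau>)"
      using norm_triangle_ineq4[of "?y \<tau>" "?y \<tau> - ?y 0"] by simp
    ultimately show ?thesis by linarith
  qed
  define a0 where "a0 = 4 * Kc * A\<^sup>2 * H + 2 * Kc * M0 * \<beta> + Qb"
  have "(\<lambda>n. \<beta> / jbr k + (a n / \<kappa> + b / \<kappa>\<^sup>2) + exp (- \<kappa> * \<tau>) * (H + \<beta> / jbr k))
     \<longlonglongrightarrow> \<beta> / jbr k + ((a0 + (2 * Kc * K * 0 * H + J * 0)) / \<kappa> + b / \<kappa>\<^sup>2) + exp (- \<kappa> * \<tau>) * (H + \<beta> / jbr k)"
    unfolding a_def a0_def[symmetric] using \<kappa> by (intro tendsto_intros \<delta> \<epsilon>) auto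
  moreover have "\<forall>\<^sub>F n in sequentially. J * cmod (c 0 k)
      \<le> \<beta> / jbr k + (a n / \<kappa> + b / \<kappa>\<^sup>2) + exp (- \<kappa> * \<tau>) * (H + \<beta> / jbr k)"
    using eventually_ge_at_top[of "nat \<bar>k\<bar>"] by eventually_elim (rule main, simp)
  ultimately have "J * cmod (c 0 k)
      \<le> \<beta> / jbr k + (a0 / \<kappa> + b / \<kappa>\<^sup>2) + exp (- \<kappa> * \<tau>) * (H + \<beta> / jbr k)"
    by (intro tendsto_lowerbound) auto
  then have "jbr k * (J * cmod (c 0 k))
      \<le> jbr k * (\<beta> / jbr k + (a0 / \<kappa> + b / \<kappa>\<^sup>2) + exp (- \<kappa> * \<tau>) * (H + \<beta> / jbr k))"
    using jbr_nonneg by (rule mult_left_mono)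
  also have "\<dots> = \<beta> + a0 * (jbr k / \<kappa>) + b * (jbr k / \<kappa>\<^sup>2) + (jbr k * exp (- \<kappa> * \<tau>)) * H + exp (- \<kappa> * \<tau>) * \<beta>"
    using jbr_nz[of k] by (simp add: distrib_left) (simp add: field_simps)
  also have "\<dots> \<le> \<beta> + a0 * (2 / (\<Gamma> * M0)) + 2 * Kc * KL A * H * (2 / (\<Gamma>\<^sup>2 * M0\<^sup>2)) + (2 / (\<Gamma> * M0 * \<tau>)) * H + 1 * \<beta>"
  proof (intro add_mono)
    have jk: "jbr k \<le> 2 * K" using K1 jbK by simp
    have j1: "jbr k / \<kappa> \<le> 2 / (\<Gamma> * M0)"
      using jk \<Gamma>_pos M0(2) K1 unfolding \<kappa>_def by (simp add: field_simps)
    have a00: "0 \<le> a0" unfolding a0_def using Kc_nonneg A0 H0 M0 \<beta>0 Qb0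
      by (intro add_nonneg_nonneg mult_nonneg_nonneg) auto
    show "a0 * (jbr k / \<kappa>) \<le> a0 * (2 / (\<Gamma> * M0))" using j1 a00 by (rule mult_left_mono)
    have "b * (jbr k / \<kappa>\<^sup>2) = 2 * Kc * KL A * H * (jbr k / \<kappa>) * (K / \<kappa>)"
      unfolding b_def by (simp add: power2_eq_square)
    also have "K / \<kappa> = 1 / (\<Gamma> * M0)" unfolding \<kappa>_def using K1 by (simp add: field_simps)
    also have "2 * Kc * KL A * H * (jbr k / \<kappa>) * (1 / (\<Gamma> * M0)) \<le> 2 * Kc * KL A * H * (2 / (\<Gamma> * M0)) * (1 / (\<Gamma> * M0))"
      using j1 Kc_nonneg KL0 H0 \<Gamma>_pos M0(2) by (intro mult_right_mono mult_left_mono) auto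
    finally show "b * (jbr k / \<kappa>\<^sup>2) \<le> 2 * Kc * KL A * H * (2 / (\<Gamma>\<^sup>2 * M0\<^sup>2))"
      by (simp add: power2_eq_square mult_ac)
    \<comment> \<open>The decay of the exponential is used only to the first power: this supplies
      the factor 1 / k for the value at time \<tau>.\<close>
    have "exp (- \<kappa> * \<tau>) \<le> 1 / (\<kappa> * \<tau>)"
    proof -
      have "\<kappa> * \<tau> \<le> exp (\<kappa> * \<tau>)" using exp_ge_add_one_self[of "\<kappa> * \<tau>"] by linarith
      then show ?thesis using \<kappa> \<tau> by (simp add: exp_minus field_simps)
    qed
    then have "jbr k * exp (- \<kappa> * \<tau>) \<le> jbr k * (1 / (\<kappa> * \<tau>))"
      using jbr_nonneg by (rule mult_left_mono)
    also have "\<dots> = (jbr k / \<kappa>) * (1 / \<tau>)" by simp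
    also have "\<dots> \<le> (2 / (\<Gamma> * M0)) * (1 / \<tau>)" using j1 \<tau> by (intro mult_right_mono) auto
    finally show "(jbr k * exp (- \<kappa> * \<tau>)) * H \<le> (2 / (\<Gamma> * M0 * \<tau>)) * H"
      using H0 by (intro mult_right_mono) auto
    show "exp (- \<kappa> * \<tau>) * \<beta> \<le> 1 * \<beta>" using \<kappa> \<tau> \<beta>0 by (intro mult_right_mono) auto
  qed auto
  also have "\<dots> \<le> Dst A M0 \<tau> * 9 powr s * H"
  proof -
    define N where "N = (9::real) powr s * H"
    have p1: "1 \<le> (9::real) powr s" "(3::real) powr s \<le> 9 powr s"
      using s by (auto intro: ge_one_powr_ge_zero powr_mono2)
    have HN: "H \<le> N" unfolding N_def using p1 H0 mult_right_mono[of 1 "9 powr s" H] by simp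
    have "\<beta> \<le> 720 * Kw * A\<^sup>2 * N"
    proof -
      have "720 * Kw * A\<^sup>2 * H * 3 powr s \<le> 720 * Kw * A\<^sup>2 * H * 9 powr s"
        using p1 Kw_nonneg H0 by (intro mult_left_mono) auto
      then show ?thesis unfolding \<beta>_def N_def by (simp add: mult_ac)
    qed
    moreover have "a0 * (2 / (\<Gamma> * M0)) = 8 * Kc * A\<^sup>2 / (\<Gamma> * M0) * H + 4 * Kc / \<Gamma> * \<beta> + 368640 * Kw * Kc * A ^ 4 / (\<Gamma> * M0) * N"
      unfolding a0_def Qb_def N_def using M0(2) \<Gamma>_pos by (simp add: field_simps)
    moreover have "8 * Kc * A\<^sup>2 / (\<Gamma> * M0) * H \<le> 8 * Kc * A\<^sup>2 / (\<Gamma> * M0) * N"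
      using HN Kc_nonneg \<Gamma>_pos M0(2) by (intro mult_left_mono) auto
    moreover have "4 * Kc / \<Gamma> * \<beta> \<le> 4 * Kc / \<Gamma> * (720 * Kw * A\<^sup>2 * N)"
      using calculation(1) Kc_nonneg \<Gamma>_pos by (intro mult_left_mono) auto
    moreover have "2 * Kc * KL A * H * (2 / (\<Gamma>\<^sup>2 * M0\<^sup>2)) \<le> 4 * Kc * KL A / (\<Gamma>\<^sup>2 * M0\<^sup>2) * N"
      using mult_left_mono[OF HN, of "4 * Kc * KL A / (\<Gamma>\<^sup>2 * M0\<^sup>2)"] Kc_nonneg KL0 by (simp add: mult_ac)
    moreover have "(2 / (\<Gamma> * M0 * \<tau>)) * H \<le> (2 / (\<Gamma> * M0 * \<tau>)) * N"
      using HN \<Gamma>_pos M0(2) \<tau> by (intro mult_left_mono) auto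
    moreover have "Dst A M0 \<tau> * 9 powr s * H = 720 * Kw * A\<^sup>2 * N + 720 * Kw * A\<^sup>2 * N
        + 8 * Kc * A\<^sup>2 / (\<Gamma> * M0) * N + 4 * Kc / \<Gamma> * (720 * Kw * A\<^sup>2 * N)
        + 368640 * Kw * Kc * A ^ 4 / (\<Gamma> * M0) * N + 4 * Kc * KL A / (\<Gamma>\<^sup>2 * M0\<^sup>2) * N + (2 / (\<Gamma> * M0 * \<tau>)) * N"
      unfolding Dst_def N_def by (simp add: algebra_simps)
    ultimately show ?thesis by linarith
  qed
  also have "jbr k * (J * cmod (c 0 k)) = jbr k powr (s + 1) * cmod (c 0 k)"
    using jbr_nonneg[of k] unfolding J_def by (simp add: powr_add)
  finally show ?thesis .
qed

end

subsection \<open>Iteration of the gain of regularity\<close>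

lemma summable_jbr_powr:
  assumes "a > 1"
  shows "(\<lambda>j. jbr j powr (- a)) summable_on UNIV"
proof -
  let ?f = "\<lambda>n::nat. (1 + real n) powr (- a)"
  have sm: "summable ?f"
  proof -
    have "summable (\<lambda>n. real n powr (- a))" using assms by (simp add: summable_real_powr_iff)
    then have "summable (\<lambda>n. real (Suc n) powr (- a))" by (subst summable_Suc_iff)
    then show ?thesis by simp
  qed
  have sym: "(\<Sum>j\<in>{- int n..int n}. jbr j powr (- a)) \<le> 2 * (\<Sum>i\<le>n. ?f i)" for n
  proof (induction n)
    case 0
    then show ?case by (simp add: jbr_def bracket_def)
  next
    case (Suc n)
    have eq: "{- int (Suc n)..int (Suc n)} = insert (int (Suc n)) (insert (- int (Suc n)) {- int n..int n})"
      by auto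
    have "(\<Sum>j\<in>{- int (Suc n)..int (Suc n)}. jbr j powr (- a))
        = 2 * ?f (Suc n) + (\<Sum>j\<in>{- int n..int n}. jbr j powr (- a))"
      unfolding eq by (simp add: jbr_def bracket_def add_ac)
    then show ?case using Suc by simp
  qed
  show ?thesis
  proof (rule nonneg_bdd_above_summable_on)
    show "bdd_above (sum (\<lambda>j. jbr j powr (- a)) ` {F. F \<subseteq> UNIV \<and> finite F})"
    proof (rule bdd_aboveI2)
      fix F :: "int set" assume "F \<in> {F. F \<subseteq> UNIV \<and> finite F}"
      then obtain n where n: "F \<subseteq> {- int n..int n}" using finite_int_subset_interval by blast
      have "(\<Sum>j\<in>F. jbr j powr (- a)) \<le> (\<Sum>j\<in>{- int n..int n}. jbr j powr (- a))"
        using n by (intro sum_mono2) auto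
      also have "\<dots> \<le> 2 * (\<Sum>i\<le>n. ?f i)" by (rule sym)
      also have "\<dots> \<le> 2 * suminf ?f"
        using sum_le_suminf[OF sm, of "{..n}"] by simp
      finally show "(\<Sum>j\<in>F. jbr j powr (- a)) \<le> 2 * suminf ?f" .
    qed
  qed auto
qed

lemma sobolev_seq_jbr:
  "c \<in> sobolev_seq s \<longleftrightarrow> (\<lambda>k. (jbr k powr s * cmod (c k))\<^sup>2) summable_on UNIV"
  "sobolev_seq_norm s c = sqrt (\<Sum>\<^sub>\<infinity>k. (jbr k powr s * cmod (c k))\<^sup>2)"
  by (simp_all add: sobolev_seq_def sobolev_seq_norm_def jbr_def)

lemma l2b_summable:
  assumes "l2b f A"
  shows "(\<lambda>j. (f j)\<^sup>2) summable_on UNIV" "sqrt (\<Sum>\<^sub>\<infinity>j. (f j)\<^sup>2) \<le> A"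
proof -
  have A: "0 \<le> A" using assms by (rule l2b_const_nonneg)
  have b: "(\<Sum>j\<in>S. (f j)\<^sup>2) \<le> A\<^sup>2" if "finite S" for S
  proof -
    have "(L2_set f S)\<^sup>2 \<le> A\<^sup>2" using l2bD[OF assms that] by (intro power_mono) (auto simp: L2_set_nonneg)
    then show ?thesis by (simp add: L2_set_def sum_nonneg)
  qed
  show s: "(\<lambda>j. (f j)\<^sup>2) summable_on UNIV"
    by (rule nonneg_bdd_above_summable_on) (auto intro!: bdd_aboveI2[where M = "A\<^sup>2"] b)
  have "(\<Sum>\<^sub>\<infinity>j. (f j)\<^sup>2) \<le> A\<^sup>2" by (rule infsum_le_finite_sums[OF s]) (auto intro: b)
  then show "sqrt (\<Sum>\<^sub>\<infinity>j. (f j)\<^sup>2) \<le> A" using A by (intro real_le_lsqrt) auto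
qed

lemma l2b_of_summable:
  assumes "(\<lambda>j. (f j)\<^sup>2) summable_on UNIV" "\<And>j. 0 \<le> f j"
  shows "l2b f (sqrt (\<Sum>\<^sub>\<infinity>j. (f j)\<^sup>2))"
  unfolding l2b_def L2_set_def using assms
  by (auto intro!: real_sqrt_le_mono finite_sum_le_infsum)

lemma l2b_sobolev_seq:
  assumes "l2b (\<lambda>j. jbr j powr s * cmod (c j)) H"
  shows "c \<in> sobolev_seq s" "sobolev_seq_norm s c \<le> H"
  using l2b_summable[OF assms] by (auto simp: sobolev_seq_jbr)

lemma sobolev_seq_l2b:
  assumes "c \<in> sobolev_seq s"
  shows "l2b (\<lambda>j. jbr j powr s * cmod (c j)) (sobolev_seq_norm s c)"
  using l2b_of_summable[of "\<lambda>j. jbr j powr s * cmod (c j)"] assms by (simp add: sobolev_seq_jbr)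

text \<open>Any negative power beyond 1/2 is square summable; 3/4 leaves 1/4 of the full derivative
  that is gained pointwise.\<close>

definition Zc :: real where
  "Zc = sqrt (\<Sum>\<^sub>\<infinity>j. (jbr j powr (- (3 / 4)))\<^sup>2)"

lemma l2b_Zc: "l2b (\<lambda>j. jbr j powr (- (3 / 4))) Zc"
  unfolding Zc_def
proof (rule l2b_of_summable)
  have "(jbr j powr (- (3 / 4)))\<^sup>2 = jbr j powr (- (3 / 2))" for j
    using jbr_nz[of j] by (simp add: power2_eq_square flip: powr_add)
  then show "(\<lambda>j. (jbr j powr (- (3 / 4)))\<^sup>2) summable_on UNIV"
    using summable_jbr_powr[of "3 / 2"] by simp
qed simp

lemma Zc_ge1: "1 \<le> Zc"
  using l2b_pt[OF l2b_Zc, of 0] by (simp add: jbr_def bracket_def)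

definition mass :: "(int \<Rightarrow> complex) \<Rightarrow> real" where
  "mass c = (\<Sum>\<^sub>\<infinity>j. (cmod (c j))\<^sup>2)"

lemma mass_has_sum:
  assumes "l2b (\<lambda>j. jbr j * cmod (c j)) A"
  shows "((\<lambda>j. (cmod (c j))\<^sup>2) has_sum mass c) UNIV"
proof -
  have "l2b (\<lambda>j. cmod (c j)) A" using assms by (rule l2b_of_weight(1))
  from l2b_summable(1)[OF this] show ?thesis unfolding mass_def by (rule has_sum_infsum)
qed

lemma mass_nonneg: "0 \<le> mass c"
  unfolding mass_def by (rule infsum_nonneg) simp

lemma mass_zero:
  assumes "l2b (\<lambda>j. jbr j * cmod (c j)) A" "mass c = 0"
  shows "c j = 0"
proof -
  have "(\<lambda>j. (cmod (c j))\<^sup>2) summable_on UNIV" using mass_has_sum[OF assms(1)] has_sum_imp_summable by blast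
  from finite_sum_le_infsum[OF this, of "{j}"] show ?thesis using assms(2) by (simp add: mass_def)
qed

lemma mass_reflect: "mass (\<lambda>j. c (- j)) = mass c"
  unfolding mass_def by (rule infsum_reindex_bij_betw[of uminus]) (rule bij_uminus)

section \<open>Reflection and the gain at interior times\<close>

context raman
begin

text \<open>Under (t, x) -> (-t, -x) the constants \<alpha>1, \<gamma>2 and \<Gamma> are kept,
  \<alpha>2 and \<gamma>1 change sign, and negative frequencies become positive. The nonresonance
  condition is invariant.\<close>

lemma reflected: "raman \<alpha>1 (- \<alpha>2) \<Gamma>"
proof
  have "2 * - \<alpha>2 / (3 * \<alpha>1) = - (2 * \<alpha>2 / (3 * \<alpha>1))" by simp
  then show "2 * - \<alpha>2 / (3 * \<alpha>1) \<notin> \<int>" using nonres by (metis minus_in_Ints_iff)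
qed (use \<Gamma>_pos \<alpha>1_nz in auto)

lemma ode_shift:
  assumes "ode_on I c"
  shows "ode_on ((\<lambda>t. t - r) ` I) (\<lambda>t. c (t + r))"
  unfolding ode_on_def
proof (intro ballI allI)
  fix t j assume t: "t \<in> (\<lambda>t. t - r) ` I"
  then have rt: "t + r \<in> I" by auto
  have d: "((\<lambda>t. c t j) has_vector_derivative
      (- (\<i> * of_real (om j)) * c (t + r) j + nl (c (t + r)) j)) (at (t + r) within I)"
    using assms rt unfolding ode_on_def by blast
  have g: "((\<lambda>t. t + r) has_vector_derivative 1) (at t within (\<lambda>t. t - r) ` I)"
    by (auto intro!: derivative_eq_intros simp: has_vector_derivative_def has_derivative_def)
  have im: "(\<lambda>t. t + r) ` (\<lambda>t. t - r) ` I = I" by (simp add: image_image)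
  have "(((\<lambda>t. c t j) \<circ> (\<lambda>t. t + r)) has_vector_derivative
      1 *\<^sub>R (- (\<i> * of_real (om j)) * c (t + r) j + nl (c (t + r)) j))
      (at t within (\<lambda>t. t - r) ` I)"
    using d g by (intro vector_diff_chain_within) (auto simp: im)
  then show "((\<lambda>t. c (t + r) j) has_vector_derivative
      (- (\<i> * of_real (om j)) * c (t + r) j + nl (c (t + r)) j)) (at t within (\<lambda>t. t - r) ` I)"
    by (simp add: o_def)
qed

lemma mass_lipschitz:
  assumes ode: "ode_on {0..\<tau>} c" and A: "\<And>t. t \<in> {0..\<tau>} \<Longrightarrow> l2b (\<lambda>j. jbr j * cmod (c t j)) A"
    and t: "t \<in> {0..\<tau>}"
  shows "\<bar>mass (c t) - mass (c 0)\<bar> \<le> KL A * t"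
proof (rule tendsto_upperbound)
  have t0: "0 \<in> {0..\<tau>}" using t by auto
  show "(\<lambda>n. \<bar>Mn n (c t) - Mn n (c 0)\<bar>) \<longlonglongrightarrow> \<bar>mass (c t) - mass (c 0)\<bar>"
    unfolding Mn_def by (intro tendsto_intros has_sum_symm_interval mass_has_sum[OF A] t t0)
  show "\<forall>\<^sub>F n in sequentially. \<bar>Mn n (c t) - Mn n (c 0)\<bar> \<le> KL A * t"
    using Mn_lipschitz[OF ode A t] by simp
qed simp

lemma Dst_nonneg: "0 < m \<Longrightarrow> 0 < \<tau> \<Longrightarrow> 0 \<le> Dst A m \<tau>"
  unfolding Dst_def KL_def using Kw_nonneg Kc_nonneg \<Gamma>_pos
  by (intro add_nonneg_nonneg divide_nonneg_pos mult_nonneg_nonneg) auto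

lemma Dst_antimono:
  assumes "0 < m" "m \<le> m'" "0 < \<tau>"
  shows "Dst A m' \<tau> \<le> Dst A m \<tau>"
proof -
  have "m\<^sup>2 \<le> m'\<^sup>2" using assms by (intro power_mono) auto
  then show ?thesis
    unfolding Dst_def KL_def using Kw_nonneg Kc_nonneg \<Gamma>_pos assms
    by (intro add_mono order_refl frac_le mult_left_mono mult_right_mono mult_nonneg_nonneg mult_pos_pos) auto
qed

text \<open>Only the summand 2 / (\<Gamma> m \<tau>) depends on \<tau>, so that shortening the time
  costs at most a linear factor.\<close>

lemma Dst_scale:
  assumes "0 < m" "0 < \<tau>" "1 \<le> x"
  shows "Dst A m (\<tau> / x) \<le> x * Dst A m \<tau>"
proof -
  define r where "r = 1440 * Kw * A\<^sup>2 + 8 * Kc * A\<^sup>2 / (\<Gamma> * m) + 2880 * Kc * Kw * A\<^sup>2 / \<Gamma>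
     + 368640 * Kw * Kc * A ^ 4 / (\<Gamma> * m) + 4 * Kc * KL A / (\<Gamma>\<^sup>2 * m\<^sup>2)"
  have "0 \<le> r"
    unfolding r_def KL_def using Kw_nonneg Kc_nonneg \<Gamma>_pos assms
    by (intro add_nonneg_nonneg divide_nonneg_pos mult_nonneg_nonneg) auto
  then have "1 * r \<le> x * r" using assms by (intro mult_right_mono) auto
  then show ?thesis unfolding Dst_def r_def[symmetric] using assms by (simp add: algebra_simps)
qed

interpretation R: raman \<alpha>1 "- \<alpha>2" "- \<gamma>1" \<gamma>2 \<Gamma>
  by (rule reflected)

lemma R_KL: "R.KL A = KL A"
  by (simp add: KL_def R.KL_def Kc_def R.Kc_def)

text \<open>Substitution of (-p, -q) for (p, q): with \<gamma>1 reversed the symbol changes sign,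
  which matches the sign produced by the reversal of time.\<close>

lemma R_nl: "R.nl (\<lambda>j. c (- j)) k = - nl c (- k)"
proof -
  have bij: "bij (\<lambda>i::int \<times> int. (- fst i, - snd i))"
    by (rule o_bij[of "\<lambda>i. (- fst i, - snd i)"]) (auto simp: fun_eq_iff)
  have w: "R.nlw k (- q) = - nlw (- k) q" for q
    by (simp add: R.nlw_def nlw_def complex_eq_iff algebra_simps)
  have "R.nl (\<lambda>j. c (- j)) k = (\<Sum>\<^sub>\<infinity>i. R.nlt (\<lambda>j. c (- j)) k (- fst i, - snd i))"
    unfolding R.nl_def by (rule infsum_reindex_bij_betw[OF bij, symmetric])
  also have "\<dots> = (\<Sum>\<^sub>\<infinity>i. - nlt c (- k) i)"
    by (rule infsum_cong) (simp add: R.nlt_def nlt_def w algebra_simps)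
  finally show ?thesis unfolding nl_def by (simp add: infsum_uminus)
qed

lemma R_ode:
  assumes "ode_on I c"
  shows "R.ode_on ((\<lambda>t. r - t) ` I) (\<lambda>t j. c (r - t) (- j))"
  unfolding R.ode_on_def
proof (intro ballI allI)
  fix t j assume t: "t \<in> (\<lambda>t. r - t) ` I"
  then have rt: "r - t \<in> I" by auto
  have d: "((\<lambda>t. c t (- j)) has_vector_derivative
      (- (\<i> * of_real (om (- j))) * c (r - t) (- j) + nl (c (r - t)) (- j))) (at (r - t) within I)"
    using assms rt unfolding ode_on_def by blast
  have g: "((\<lambda>t. r - t) has_vector_derivative (-1)) (at t within (\<lambda>t. r - t) ` I)"
    by (auto intro!: derivative_eq_intros simp: has_vector_derivative_def has_derivative_def bounded_linear_minus)
  have im: "(\<lambda>t. r - t) ` (\<lambda>t. r - t) ` I = I" by (simp add: image_image)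
  have o: "om (- j) = - R.om j" by (simp add: om_def R.om_def)
  have "(((\<lambda>t. c t (- j)) \<circ> (\<lambda>t. r - t)) has_vector_derivative
      (-1) *\<^sub>R (- (\<i> * of_real (om (- j))) * c (r - t) (- j) + nl (c (r - t)) (- j)))
      (at t within (\<lambda>t. r - t) ` I)"
    using d g by (intro vector_diff_chain_within) (auto simp: im)
  then show "((\<lambda>t. c (r - t) (- j)) has_vector_derivative
      (- (\<i> * of_real (R.om j)) * c (r - t) (- j) + R.nl (\<lambda>j. c (r - t) (- j)) j))
      (at t within (\<lambda>t. r - t) ` I)"
    by (simp add: o_def R_nl o)
qed

text \<open>The two constants serve positive and negative frequencies. The summand 1 serves k = 0,
  where \<open>jbr\<close> is 1 and nothing is to be gained, and keeps the value at least 1 for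
  positive m and \<tau>.\<close>

definition DD :: "real \<Rightarrow> real \<Rightarrow> real \<Rightarrow> real" where
  "DD A m \<tau> = 1 + Dst A m \<tau> + R.Dst A m \<tau>"

text \<open>Positive frequencies are controlled by the future of r, negative ones, through the
  reflection, by its past. This is why time is needed on both sides of r, and why the interval
  shrinks in the iteration.\<close>

lemma one_step_two_sided:
  assumes \<tau>: "0 < \<tau>" and s: "0 \<le> s" and ode: "ode_on {r - \<tau>..r + \<tau>} c"
    and A: "\<And>t. t \<in> {r - \<tau>..r + \<tau>} \<Longrightarrow> l2b (\<lambda>j. jbr j * cmod (c t j)) A"
    and H: "\<And>t. t \<in> {r - \<tau>..r + \<tau>} \<Longrightarrow> l2b (\<lambda>j. jbr j powr s * cmod (c t j)) H"
    and m: "0 < m" "m \<le> mass (c r)"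
  shows "jbr k powr (s + 1) * cmod (c r k) \<le> DD A m \<tau> * 9 powr s * H"
proof -
  have r: "r \<in> {r - \<tau>..r + \<tau>}" using \<tau> by auto
  have H0: "0 \<le> H" using H[OF r] by (rule l2b_const_nonneg)
  have M: "((\<lambda>j. (cmod (c r j))\<^sup>2) has_sum mass (c r)) UNIV" "0 < mass (c r)"
    using mass_has_sum[OF A[OF r]] m by auto
  have D1: "0 \<le> Dst A m \<tau>" and D2: "0 \<le> R.Dst A m \<tau>"
    using Dst_nonneg R.Dst_nonneg m \<tau> by auto
  have up: "D * 9 powr s * H \<le> DD A m \<tau> * 9 powr s * H" if "D \<le> DD A m \<tau>" for D
    using that H0 by (intro mult_right_mono) auto
  consider "k > 0" | "k < 0" | "k = 0" by linarith
  then show ?thesis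
  proof cases
    case 1
    have im: "{0..\<tau>} \<subseteq> (\<lambda>t. t - r) ` {r - \<tau>..r + \<tau>}"
    proof
      fix x assume "x \<in> {0..\<tau>}"
      then show "x \<in> (\<lambda>t. t - r) ` {r - \<tau>..r + \<tau>}" using \<tau> by (intro image_eqI[of _ _ "x + r"]) auto
    qed
    have "jbr k powr (s + 1) * cmod (c (0 + r) k) \<le> Dst A (mass (c r)) \<tau> * 9 powr s * H"
      by (rule one_step[OF \<tau> s 1 ode_on_subset[OF ode_shift[OF ode] im]]) (use A H M in auto)
    also have "\<dots> \<le> DD A m \<tau> * 9 powr s * H"
      using Dst_antimono[OF m \<tau>, of A] D2 by (intro up) (simp add: DD_def)
    finally show ?thesis by simp
  next
    case 2
    have im: "{0..\<tau>} \<subseteq> (\<lambda>t. r - t) ` {r - \<tau>..r + \<tau>}"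
    proof
      fix x assume "x \<in> {0..\<tau>}"
      then show "x \<in> (\<lambda>t. r - t) ` {r - \<tau>..r + \<tau>}" using \<tau> by (intro image_eqI[of _ _ "r - x"]) auto
    qed
    have A': "l2b (\<lambda>j. jbr j * cmod (c (r - t) (- j))) A" if "t \<in> {0..\<tau>}" for t
      using l2b_comp[OF A[of "r - t"], of uminus] that by simp
    have H': "l2b (\<lambda>j. jbr j powr s * cmod (c (r - t) (- j))) H" if "t \<in> {0..\<tau>}" for t
      using l2b_comp[OF H[of "r - t"], of uminus] that by simp
    have M': "((\<lambda>j. (cmod (c (r - 0) (- j)))\<^sup>2) has_sum mass (c r)) UNIV"
      using mass_has_sum[OF A'[of 0]] \<tau> by (simp add: mass_reflect)
    have "jbr (- k) powr (s + 1) * cmod (c (r - 0) (- (- k))) \<le> R.Dst A (mass (c r)) \<tau> * 9 powr s * H"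
      by (rule R.one_step[OF \<tau> s _ R.ode_on_subset[OF R_ode[OF ode] im] A' H' M' M(2)]) (use 2 in auto)
    also have "\<dots> \<le> DD A m \<tau> * 9 powr s * H"
      using R.Dst_antimono[OF m \<tau>, of A] D1 by (intro up) (simp add: DD_def)
    finally show ?thesis by simp
  next
    case 3
    have "jbr k powr (s + 1) * cmod (c r k) = jbr k powr s * cmod (c r k)"
      using 3 by (simp add: jbr_def bracket_def)
    also have "\<dots> \<le> 1 * 1 * H" using l2b_pt[OF H[OF r], of k] by simp
    also have "\<dots> \<le> DD A m \<tau> * 9 powr s * H"
      using H0 D1 D2 s by (intro mult_right_mono mult_mono) (auto simp: DD_def intro: ge_one_powr_ge_zero)
    finally show ?thesis .
  qed
qed

lemma gain_quarter:
  assumes "\<And>k. jbr k powr (s + 1) * cmod (c k) \<le> X"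
  shows "l2b (\<lambda>j. jbr j powr (s + 1 / 4) * cmod (c j)) (Zc * X)"
proof -
  have X: "0 \<le> X" using assms[of 0] by (rule order_trans[rotated]) simp
  have "l2b (\<lambda>j. X * jbr j powr (- (3 / 4))) (X * Zc)" by (intro l2b_scale l2b_Zc X)
  then have "l2b (\<lambda>j. jbr j powr (s + 1 / 4) * cmod (c j)) (X * Zc)"
  proof (rule l2b_mono)
    fix j
    have "jbr j powr (s + 1 / 4) = jbr j powr (- (3 / 4)) * jbr j powr (s + 1)"
      by (simp add: add.commute flip: powr_add)
    then have "jbr j powr (s + 1 / 4) * cmod (c j) = jbr j powr (- (3 / 4)) * (jbr j powr (s + 1) * cmod (c j))"
      by simp
    also have "\<dots> \<le> jbr j powr (- (3 / 4)) * X" using assms by (intro mult_left_mono) auto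
    finally show "jbr j powr (s + 1 / 4) * cmod (c j) \<le> X * jbr j powr (- (3 / 4))" by (simp add: mult.commute)
  qed auto
  then show ?thesis by (simp add: mult.commute)
qed

text \<open>The time interval shrinks geometrically; the loss \<open>2 ^ n\<close> in the \<open>n\<close>-th step only contributes
  to the factor \<open>18 ^ n\<^sup>2\<close>.\<close>

lemma iteration:
  assumes \<rho>: "0 < \<rho>" and ode: "ode_on {- \<rho>..\<rho>} c"
    and A: "\<And>t. t \<in> {- \<rho>..\<rho>} \<Longrightarrow> l2b (\<lambda>j. jbr j * cmod (c t j)) A"
    and m: "0 < m" "\<And>t. t \<in> {- \<rho>..\<rho>} \<Longrightarrow> m \<le> mass (c t)"
    and t: "\<bar>t\<bar> \<le> \<rho> * (1 + 1 / 2 ^ n) / 2"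
  shows "l2b (\<lambda>j. jbr j powr (1 + real n / 4) * cmod (c t j)) (A * (9 * (Zc * DD A m (\<rho> / 4))) ^ n * 18 ^ (n\<^sup>2))"
  using t
proof (induction n arbitrary: t)
  case 0
  then have "t \<in> {- \<rho>..\<rho>}" by (auto simp: abs_le_iff)
  then show ?case using A[of t] jbr_nonneg by simp
next
  case (Suc n)
  define D where "D = Zc * DD A m (\<rho> / 4)"
  \<comment> \<open>The difference of the radii \<rho> (1 + 1 / 2^n) / 2 of two consecutive
    steps.\<close>
  define \<tau> where "\<tau> = (\<rho> / 4) / 2 ^ n"
  define s where "s = 1 + real n / 4"
  define X where "X = A * (9 * D) ^ n * 18 ^ (n\<^sup>2)"
  have \<tau>: "0 < \<tau>" and s: "0 \<le> s" using \<rho> by (auto simp: \<tau>_def s_def)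
  have p2: "(1::real) \<le> 2 ^ n" by simp
  have sm: "\<bar>x\<bar> \<le> \<rho> * (1 + 1 / 2 ^ n) / 2" if "x \<in> {t - \<tau>..t + \<tau>}" for x
  proof -
    have "\<rho> * (1 + 1 / 2 ^ Suc n) / 2 + \<tau> = \<rho> * (1 + 1 / 2 ^ n) / 2"
      unfolding \<tau>_def by (simp add: field_simps)
    then show ?thesis using Suc.prems that by (auto simp: abs_le_iff)
  qed
  have "\<rho> * (1 + 1 / 2 ^ n) / 2 \<le> \<rho> * (1 + 1) / 2"
    using \<rho> p2 by (intro divide_right_mono mult_left_mono add_left_mono) (auto simp: field_simps)
  then have sub: "{t - \<tau>..t + \<tau>} \<subseteq> {- \<rho>..\<rho>}" using sm by (force simp: abs_le_iff)
  have tin: "t \<in> {t - \<tau>..t + \<tau>}" using \<tau> by auto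
  have A0: "0 \<le> A" using A[of 0] \<rho> by (auto dest: l2b_const_nonneg)
  have D0: "0 \<le> D" using m \<rho> Zc_ge1 Dst_nonneg R.Dst_nonneg
    by (auto simp: D_def DD_def intro!: mult_nonneg_nonneg add_nonneg_nonneg)
  have X0: "0 \<le> X" using A0 D0 by (simp add: X_def)
  have H: "l2b (\<lambda>j. jbr j powr s * cmod (c x j)) X" if "x \<in> {t - \<tau>..t + \<tau>}" for x
    using Suc.IH[OF sm[OF that]] unfolding s_def X_def D_def .
  have "jbr k powr (s + 1) * cmod (c t k) \<le> DD A m \<tau> * 9 powr s * X" for k
    by (rule one_step_two_sided[OF \<tau> s ode_on_subset[OF ode sub] _ H m(1)]) (use A m sub tin in blast)+
  from gain_quarter[of s "c t", OF this]
  have "l2b (\<lambda>j. jbr j powr (s + 1 / 4) * cmod (c t j)) (Zc * (DD A m \<tau> * 9 powr s * X))" .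
  then have "l2b (\<lambda>j. jbr j powr (s + 1 / 4) * cmod (c t j)) (A * (9 * D) ^ Suc n * 18 ^ ((Suc n)\<^sup>2))"
  proof (rule l2b_mono)
    have \<rho>4: "0 < \<rho> / 4" using \<rho> by simp
    have dd: "DD A m \<tau> \<le> 2 ^ n * DD A m (\<rho> / 4)"
      unfolding DD_def \<tau>_def distrib_left mult_1_right
      by (intro add_mono p2 Dst_scale[OF m(1) \<rho>4 p2] R.Dst_scale[OF m(1) \<rho>4 p2])
    \<comment> \<open>Generously, \<open>9 powr (real n / 4)\<close> is replaced by 9^n. With 2^n
      from the shorter time the step costs 18^n, and n + n^2 \<le> (n + 1)^2 closes the
      induction.\<close>
    have "(9::real) powr s = 9 * 9 powr (real n / 4)" unfolding s_def by (simp add: powr_add)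
    also have "(9::real) powr (real n / 4) \<le> 9 powr real n" by (intro powr_mono) auto
    also have "(9::real) powr real n = 9 ^ n" by (simp add: powr_realpow)
    finally have p9: "(9::real) powr s \<le> 9 * 9 ^ n" by simp
    have "Zc * (DD A m \<tau> * 9 powr s * X) \<le> Zc * ((2 ^ n * DD A m (\<rho> / 4)) * (9 * 9 ^ n) * X)"
      using dd p9 X0 Zc_ge1 D0 m \<rho> Dst_nonneg R.Dst_nonneg
      by (intro mult_left_mono mult_right_mono mult_mono mult_nonneg_nonneg) (auto simp: DD_def intro!: add_nonneg_nonneg)
    also have "\<dots> = A * (9 * D) ^ Suc n * ((2 * 9) ^ n * 18 ^ (n\<^sup>2))"
      unfolding X_def D_def power_mult_distrib[of "2::real" 9] by (simp add: mult_ac)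
    also have "\<dots> \<le> A * (9 * D) ^ Suc n * 18 ^ ((Suc n)\<^sup>2)"
    proof (rule mult_left_mono)
      have "(2 * 9) ^ n * 18 ^ (n\<^sup>2) = (18::real) ^ (n + n\<^sup>2)" by (simp add: power_add)
      also have "\<dots> \<le> 18 ^ ((Suc n)\<^sup>2)" by (intro power_increasing) (auto simp: power2_eq_square)
      finally show "(2 * 9) ^ n * 18 ^ (n\<^sup>2) \<le> (18::real) ^ ((Suc n)\<^sup>2)" .
    qed (use A0 D0 in auto)
    finally show "Zc * (DD A m \<tau> * 9 powr s * X) \<le> A * (9 * D) ^ Suc n * 18 ^ ((Suc n)\<^sup>2)" .
  qed auto
  moreover have "s + 1 / 4 = 1 + real (Suc n) / 4" by (simp add: s_def add_divide_distrib)
  ultimately show ?case unfolding D_def by simp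
qed

text \<open>Time during which the mass, whose rate of change is at most \<open>KL A\<close>, keeps
  at least half of its initial value m; the added 1 excludes a zero denominator.\<close>

definition life :: "real \<Rightarrow> real \<Rightarrow> real \<Rightarrow> real" where
  "life A m T = min T (m / (2 * (KL A + 1)))"

text \<open>Base of the power of \<sigma>: at most 4 \<sigma> quarter steps are made, which explains
  the exponent 4, and 1 + A takes up the H^1 bound at the start of the iteration.\<close>

definition Cst :: "real \<Rightarrow> real \<Rightarrow> real \<Rightarrow> real" where
  "Cst A m T = (1 + A) * (9 * (Zc * DD A (m / 2) (life A m T / 4))) ^ 4"

lemma KL_nonneg: "0 \<le> KL A"
  unfolding KL_def using Kc_nonneg by simp

theorem smoothing:
  assumes T: "0 < T" and ode: "ode_on {- T..T} c"
    and A: "\<And>t. t \<in> {- T..T} \<Longrightarrow> l2b (\<lambda>j. jbr j * cmod (c t j)) A"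
    and m: "0 < mass (c 0)" and \<sigma>: "1 \<le> \<sigma>"
  shows "l2b (\<lambda>j. jbr j powr \<sigma> * cmod (c 0 j)) (Cst A (mass (c 0)) T powr \<sigma> * (18 ^ 16) powr (\<sigma>\<^sup>2))"
proof -
  define m where "m = mass (c 0)"
  define \<rho> where "\<rho> = life A m T"
  define D where "D = Zc * DD A (m / 2) (\<rho> / 4)"
  have m0: "0 < m" using m by (simp add: m_def)
  have \<rho>: "0 < \<rho>" using T m0 KL_nonneg[of A] by (simp add: \<rho>_def life_def add_nonneg_pos)
  have \<rho>T: "{- \<rho>..\<rho>} \<subseteq> {- T..T}" by (auto simp: \<rho>_def life_def)
  have A0: "0 \<le> A" using A[of 0] T by (auto dest: l2b_const_nonneg)
  have KL\<rho>: "KL A * \<bar>t\<bar> \<le> m / 2" if "t \<in> {- \<rho>..\<rho>}" for t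
  proof -
    have "\<bar>t\<bar> \<le> m / (2 * (KL A + 1))" using that by (auto simp: \<rho>_def life_def)
    then have "KL A * \<bar>t\<bar> \<le> KL A * (m / (2 * (KL A + 1)))" using KL_nonneg by (rule mult_left_mono)
    also have "\<dots> \<le> m / 2" using KL_nonneg[of A] m0 by (simp add: field_simps)
    finally show ?thesis .
  qed
  \<comment> \<open>The lower bound for the mass is needed at all centres of the iteration; negative
    times are treated by the reflected system.\<close>
  have mt: "m / 2 \<le> mass (c t)" if t: "t \<in> {- \<rho>..\<rho>}" for t
  proof (cases "t \<ge> 0")
    case True
    then have tin: "t \<in> {0..T}" using t \<rho>T by auto
    have "{0..T} \<subseteq> {- T..T}" by auto
    then have "\<bar>mass (c t) - mass (c 0)\<bar> \<le> KL A * t"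
      by (intro mass_lipschitz[OF ode_on_subset[OF ode] _ tin] A) auto
    then show ?thesis using KL\<rho>[OF t] True unfolding m_def by auto
  next
    case False
    then have tin: "- t \<in> {0..T}" using t \<rho>T by auto
    have im: "{0..T} \<subseteq> (\<lambda>t. 0 - t) ` {- T..T}"
    proof
      fix x assume "x \<in> {0..T}"
      then show "x \<in> (\<lambda>t. 0 - t) ` {- T..T}" by (intro image_eqI[of _ _ "- x"]) auto
    qed
    have A': "l2b (\<lambda>j. jbr j * cmod (c (0 - t) (- j))) A" if "t \<in> {0..T}" for t
      using l2b_comp[OF A[of "0 - t"], of uminus] that by simp
    have "\<bar>mass (\<lambda>j. c (0 - (- t)) (- j)) - mass (\<lambda>j. c (0 - 0) (- j))\<bar> \<le> R.KL A * (- t)"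
      by (rule R.mass_lipschitz[OF R.ode_on_subset[OF R_ode[OF ode] im] A' tin])
    then show ?thesis using KL\<rho>[OF t] False unfolding m_def by (auto simp: mass_reflect R_KL)
  qed
  \<comment> \<open>Number of quarter steps from order 1 up to \<sigma>. Even after rounding up, n
    \<le> 4 \<sigma>, hence n^2 \<le> 16 \<sigma>^2 and the base 18^16.\<close>
  define n where "n = nat \<lceil>4 * (\<sigma> - 1)\<rceil>"
  have n1: "4 * (\<sigma> - 1) \<le> real n" unfolding n_def by linarith
  have "0 \<le> \<lceil>4 * (\<sigma> - 1)\<rceil>" using \<sigma> by simp
  then have "real n = of_int \<lceil>4 * (\<sigma> - 1)\<rceil>" unfolding n_def by simp
  also have "\<dots> \<le> 4 * (\<sigma> - 1) + 1" by (rule of_int_ceiling_le_add_one)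
  also have "\<dots> \<le> 4 * \<sigma>" by (simp add: algebra_simps)
  finally have n2: "real n \<le> 4 * \<sigma>" .
  have "l2b (\<lambda>j. jbr j powr (1 + real n / 4) * cmod (c 0 j)) (A * (9 * D) ^ n * 18 ^ (n\<^sup>2))"
    unfolding D_def
    by (rule iteration[OF \<rho> ode_on_subset[OF ode \<rho>T]]) (use \<rho>T A mt m0 \<rho> in auto)
  then show ?thesis
  proof (rule l2b_mono)
    fix j
    show "jbr j powr \<sigma> * cmod (c 0 j) \<le> jbr j powr (1 + real n / 4) * cmod (c 0 j)"
      using n1 jbr_ge1 by (intro mult_right_mono powr_mono) auto
  next
    have D1: "1 \<le> D"
    proof -
      have "1 \<le> DD A (m / 2) (\<rho> / 4)" using Dst_nonneg[of "m / 2" "\<rho> / 4"] R.Dst_nonneg[of "m / 2" "\<rho> / 4"] m0 \<rho>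
        by (simp add: DD_def)
      then show ?thesis unfolding D_def using mult_mono[OF Zc_ge1, of 1 "DD A (m / 2) (\<rho> / 4)"] Zc_ge1 by simp
    qed
    have "A \<le> (1 + A) powr 1" using A0 by simp
    also have "\<dots> \<le> (1 + A) powr \<sigma>" using \<sigma> A0 by (intro powr_mono) auto
    finally have f1: "A \<le> (1 + A) powr \<sigma>" .
    have "(9 * D) ^ n = (9 * D) powr real n" using D1 by (simp add: powr_realpow)
    also have "\<dots> \<le> (9 * D) powr (4 * \<sigma>)" using n2 D1 by (intro powr_mono) auto
    also have "\<dots> = ((9 * D) powr 4) powr \<sigma>" by (simp add: powr_powr)
    also have "(9 * D) powr 4 = (9 * D) ^ 4" using D1 by simp
    finally have f2: "(9 * D) ^ n \<le> ((9 * D) ^ 4) powr \<sigma>" .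
    have "(18::real) ^ (n\<^sup>2) = 18 powr ((real n)\<^sup>2)" by (simp add: powr_realpow flip: of_nat_power)
    also have "\<dots> \<le> 18 powr ((4 * \<sigma>)\<^sup>2)" using n2 by (intro powr_mono power_mono) auto
    also have "(4 * \<sigma>)\<^sup>2 = 16 * \<sigma>\<^sup>2" by (simp add: power_mult_distrib)
    also have "(18::real) powr (16 * \<sigma>\<^sup>2) = (18 powr 16) powr (\<sigma>\<^sup>2)" by (simp only: powr_powr)
    also have "(18::real) powr 16 = 18 ^ 16" by (rule powr_numeral) simp
    finally have f3: "(18::real) ^ (n\<^sup>2) \<le> (18 ^ 16) powr (\<sigma>\<^sup>2)" .
    have "A * (9 * D) ^ n * 18 ^ (n\<^sup>2) \<le> (1 + A) powr \<sigma> * ((9 * D) ^ 4) powr \<sigma> * (18 ^ 16) powr (\<sigma>\<^sup>2)"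
      using f1 f2 f3 A0 D1 by (intro mult_mono mult_nonneg_nonneg) auto
    also have "(1 + A) powr \<sigma> * ((9 * D) ^ 4) powr \<sigma> = Cst A m T powr \<sigma>"
      unfolding Cst_def D_def[symmetric, unfolded \<rho>_def] using A0 D1 by (simp add: powr_mult)
    finally show "A * (9 * D) ^ n * 18 ^ (n\<^sup>2) \<le> Cst A (mass (c 0)) T powr \<sigma> * (18 ^ 16) powr (\<sigma>\<^sup>2)"
      unfolding m_def .
  qed auto
qed

text \<open>The tail bound \<open>nl_tail\<close> depends on t only through A, so that the finite
  sums converge uniformly on I.\<close>

lemma nl_continuous:
  assumes cont: "\<And>j. continuous_on I (\<lambda>t. c t j)"
    and A: "\<And>t. t \<in> I \<Longrightarrow> l2b (\<lambda>j. jbr j * cmod (c t j)) A"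
  shows "continuous_on I (\<lambda>t. nl (c t) k)"
proof (rule uniform_limit_theorem)
  let ?C = "12 * Kc * jbr k * (2 * A) ^ 3"
  show "\<forall>\<^sub>F n in sequentially. continuous_on I (\<lambda>t. sum (nlt (c t) k) (square_box n))"
    unfolding nlt_def by (intro always_eventually allI continuous_intros cont)
  show "uniform_limit I (\<lambda>n t. sum (nlt (c t) k) (square_box n)) (\<lambda>t. nl (c t) k) sequentially"
  proof (rule uniform_limitI)
    fix e :: real assume e: "0 < e"
    have "(\<lambda>n. ?C / (real n + 1)) \<longlonglongrightarrow> 0"
      using tendsto_mult[OF tendsto_const LIMSEQ_inverse_real_of_nat, of ?C]
      by (simp add: divide_inverse add.commute)
    then have "\<forall>\<^sub>F n in sequentially. ?C / (real n + 1) < e"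
      using e by (rule order_tendstoD(2))
    then show "\<forall>\<^sub>F n in sequentially. \<forall>t\<in>I. dist (sum (nlt (c t) k) (square_box n)) (nl (c t) k) < e"
    proof eventually_elim
      case (elim n)
      show ?case
      proof
        fix t assume "t \<in> I"
        then have "l2b (\<lambda>j. jbr j * sy (c t) j) (2 * A)"
          using l2b_sy[of 1 "c t" A] A jbr_nonneg by simp
        from nl_tail[OF this, of k n] elim
        show "dist (sum (nlt (c t) k) (square_box n)) (nl (c t) k) < e"
          by (simp add: dist_norm norm_minus_commute)
      qed
    qed
  qed
qed simp

end

subsection \<open>Fourier series on the torus\<close>

definition ek :: "int \<Rightarrow> real \<Rightarrow> complex" where
  "ek k x = exp (\<i> * of_int k * of_real x)"

lemma ek_cis: "ek k x = cis (of_int k * x)"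
  by (simp add: ek_def cis_conv_exp mult.assoc)

lemma norm_ek [simp]: "cmod (ek k x) = 1"
  by (simp add: ek_cis)

lemma ek_mult: "ek j x * ek k x = ek (j + k) x"
  by (simp add: ek_cis cis_mult distrib_right)

lemma ek_0 [simp]: "ek 0 x = 1"
  by (simp add: ek_def)

lemma cnj_ek: "cnj (ek k x) = ek (- k) x"
  by (simp add: ek_cis cis_cnj)

lemma continuous_ek: "continuous_on S (ek k)"
  unfolding ek_def by (intro continuous_intros)

lemma ek_periodic: "ek k (x + 2 * pi) = ek k x"
proof -
  have "ek k (x + 2 * pi) = cis (of_int k * x) * cis (2 * pi * of_int k)"
    by (simp add: ek_cis cis_mult algebra_simps)
  then show ?thesis by (simp add: cis_multiple_2pi ek_cis)
qed

lemma ek_deriv: "(ek k has_vector_derivative (\<i> * of_int k * ek k x)) (at x within S)"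
proof -
  have "((\<lambda>w. exp (\<i> * of_int k * w)) has_field_derivative (\<i> * of_int k * exp (\<i> * of_int k * of_real x))) (at (of_real x))"
    by (auto intro!: derivative_eq_intros)
  from has_vector_derivative_real_field[OF this]
  show ?thesis unfolding ek_def by (rule has_vector_derivative_at_within)
qed

lemma borel_ek [measurable]: "ek k \<in> borel_measurable borel"
  by (rule borel_measurable_continuous_onI[OF continuous_ek])

lemma lebesgue_ek: "ek k \<in> borel_measurable lebesgue"
  using borel_ek by (simp add: measurable_completion)

lemma set_integrable_continuous_torus:
  fixes f :: "real \<Rightarrow> complex"
  assumes "continuous_on torus f"
  shows "set_integrable lebesgue torus f"
  using absolutely_integrable_continuous_real[OF assms] .

lemma set_integrable_bounded_mult:
  fixes f g :: "real \<Rightarrow> complex"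
  assumes f: "set_integrable lebesgue S f" and g: "g \<in> borel_measurable lebesgue"
    and b: "\<And>x. x \<in> S \<Longrightarrow> cmod (g x) \<le> B"
  shows "set_integrable lebesgue S (\<lambda>x. g x * f x)"
  unfolding set_integrable_def
proof (rule Bochner_Integration.integrable_bound)
  have f': "integrable lebesgue (\<lambda>x. indicator S x *\<^sub>R f x)" using f by (simp add: set_integrable_def)
  show "integrable lebesgue (\<lambda>x. of_real B * (indicator S x *\<^sub>R f x))" by (rule integrable_mult_right[OF f'])
  have "(\<lambda>x. g x * (indicator S x *\<^sub>R f x)) \<in> borel_measurable lebesgue"
    by (intro borel_measurable_times g borel_measurable_integrable f')
  then show "(\<lambda>x. indicator S x *\<^sub>R (g x * f x)) \<in> borel_measurable lebesgue" by simp
  show "AE x in lebesgue. cmod (indicator S x *\<^sub>R (g x * f x)) \<le> cmod (of_real B * (indicator S x *\<^sub>R f x))"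
  proof (rule AE_I2)
    fix x
    show "cmod (indicator S x *\<^sub>R (g x * f x)) \<le> cmod (of_real B * (indicator S x *\<^sub>R f x))"
      using b[of x] abs_ge_self[of B] by (cases "x \<in> S") (auto simp: norm_mult intro!: mult_right_mono)
  qed
qed

lemma integral_ek:
  "(LINT x:torus|lebesgue. ek k x) = (if k = 0 then of_real (2 * pi) else 0)"
proof -
  have i: "set_integrable lebesgue torus (ek k)" by (rule set_integrable_continuous_torus[OF continuous_ek])
  have "(LINT x:torus|lebesgue. ek k x) = integral torus (ek k)"
    using i by (rule set_lebesgue_integral_eq_integral(2))
  also have "\<dots> = (if k = 0 then of_real (2 * pi) else 0)"
  proof (cases "k = 0")
    case True
    then show ?thesis by (simp add: ek_def[abs_def] scaleR_conv_of_real)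
  next
    case False
    have "((\<lambda>x. ek k x / (\<i> * of_int k)) has_vector_derivative ek k x) (at x within torus)" for x
      using has_vector_derivative_divide[OF ek_deriv[of k x torus], of "\<i> * of_int k"] False by simp
    then have "(ek k has_integral (ek k (2 * pi) / (\<i> * of_int k) - ek k 0 / (\<i> * of_int k))) torus"
      by (intro fundamental_theorem_of_calculus) auto
    then show ?thesis using False ek_periodic[of k 0] by (simp add: integral_unique)
  qed
  finally show ?thesis .
qed

lemma fourier_ek: "fourier f k = of_real (1 / sqrt (2 * pi)) * (LINT x:torus|lebesgue. ek (- k) x * f x)"
  by (simp add: fourier_def ek_def)

subsection \<open>Uniqueness of Fourier coefficients\<close>

inductive trigp :: "(real \<Rightarrow> complex) \<Rightarrow> bool" where
  base: "trigp (\<lambda>x. a * ek k x)"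
| add: "trigp f \<Longrightarrow> trigp g \<Longrightarrow> trigp (\<lambda>x. f x + g x)"

lemma trigp_base_mult: "trigp f \<Longrightarrow> trigp (\<lambda>x. a * ek k x * f x)"
proof (induction rule: trigp.induct)
  case (base b j)
  have "trigp (\<lambda>x. (a * b) * ek (k + j) x)" by (rule trigp.base)
  then show ?case by (simp add: ek_mult[symmetric] mult_ac)
next
  case (add f g)
  from trigp.add[OF add.IH] show ?case by (simp add: distrib_left)
qed

lemma trigp_mult: "trigp f \<Longrightarrow> trigp g \<Longrightarrow> trigp (\<lambda>x. f x * g x)"
proof (induction rule: trigp.induct)
  case (base a k)
  then show ?case by (rule trigp_base_mult)
next
  case (add f h)
  from trigp.add[OF add.IH] add.prems show ?case by (simp add: distrib_right)
qed

text \<open>A real linear functional of \<open>cis x\<close> is a combination of cos x and sin x,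
  hence of \<open>ek 1\<close> and \<open>ek (- 1)\<close>, and products of trigonometric
  polynomials are again such. Polynomial approximation in the plane thereby becomes trigonometric
  approximation.\<close>

lemma trigp_real_polynomial: "real_polynomial_function g \<Longrightarrow> trigp (\<lambda>x. of_real (g (cis x)))"
proof (induction rule: real_polynomial_function.induct)
  case (linear f)
  have g: "f (cis x) = cos x * f 1 + sin x * f \<i>" for x
  proof -
    have "cis x = cos x *\<^sub>R 1 + sin x *\<^sub>R \<i>" by (simp add: complex_eq_iff)
    then have "f (cis x) = f (cos x *\<^sub>R 1 + sin x *\<^sub>R \<i>)" by (rule arg_cong)
    then show ?thesis
      by (simp only: linear_add[OF bounded_linear.linear[OF linear]]
        linear_scale[OF bounded_linear.linear[OF linear]] real_scaleR_def)
  qed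
  have "complex_of_real (f (cis x)) = (of_real (f 1) - \<i> * of_real (f \<i>)) / 2 * ek 1 x + (of_real (f 1) + \<i> * of_real (f \<i>)) / 2 * ek (- 1) x" for x
    unfolding g by (rule complex_eqI) (simp_all add: ek_cis diff_divide_distrib add_divide_distrib algebra_simps)
  then show ?case by (simp only:) (intro trigp.intros)
next
  case (const c)
  have "trigp (\<lambda>x. of_real c * ek 0 x)" by (rule trigp.base)
  then show ?case unfolding ek_0 mult_1_right .
next
  case (add f g)
  from trigp.add[OF add.IH] show ?case unfolding of_real_add .
next
  case (mult f g)
  from trigp_mult[OF mult.IH] show ?case unfolding of_real_mult .
qed

lemma trigp_bounded: "trigp p \<Longrightarrow> \<exists>B. \<forall>x. cmod (p x) \<le> B"
proof (induction rule: trigp.induct)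
  case (base a k)
  show ?case by (auto simp: norm_mult)
next
  case (add f g)
  then obtain B C where "\<forall>x. cmod (f x) \<le> B" "\<forall>x. cmod (g x) \<le> C" by blast
  then show ?case by (intro exI[of _ "B + C"]) (auto intro: norm_triangle_mono)
qed

lemma trigp_measurable: "trigp p \<Longrightarrow> p \<in> borel_measurable lebesgue"
  by (induction rule: trigp.induct) (auto intro!: borel_measurable_times lebesgue_ek)

lemma trigp_orthogonal:
  assumes f: "set_integrable lebesgue torus f" and z: "\<And>k. fourier f k = 0" and p: "trigp p"
  shows "(LINT x:torus|lebesgue. p x * f x) = 0"
  using p
proof (induction rule: trigp.induct)
  case (base a k)
  have "(LINT x:torus|lebesgue. ek k x * f x) = 0"
    using z[of "- k"] by (simp add: fourier_ek)
  then show ?case by (simp add: mult.assoc)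
next
  case (add g h)
  have i: "set_integrable lebesgue torus (\<lambda>x. q x * f x)" if q: "trigp q" for q
  proof -
    obtain B where "\<forall>x. cmod (q x) \<le> B" using trigp_bounded[OF q] by blast
    then show ?thesis by (intro set_integrable_bounded_mult[OF f trigp_measurable[OF q]]) auto
  qed
  show ?case using add i by (simp add: distrib_right set_integral_add(2))
qed

lemma cis_lebesgue: 
  assumes "continuous_on UNIV (G :: complex \<Rightarrow> real)"
  shows "(\<lambda>x. complex_of_real (G (cis x))) \<in> borel_measurable lebesgue"
proof -
  have "continuous_on UNIV (\<lambda>x. complex_of_real (G (cis x)))"
    by (intro continuous_intros continuous_on_compose2[OF assms]) auto
  then show ?thesis by (simp add: borel_measurable_continuous_onI measurable_completion)
qed

text \<open>Stone-Weierstrass on the unit circle: replacing G by a polynomial with error e changes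
  the integral by at most e times the L^1 norm of f, and the polynomial contributes nothing.\<close>

lemma circle_orthogonal:
  assumes f: "set_integrable lebesgue torus f" and z: "\<And>k. fourier f k = 0"
    and G: "continuous_on UNIV (G :: complex \<Rightarrow> real)"
  shows "(LINT x:torus|lebesgue. of_real (G (cis x)) * f x) = 0"
proof -
  define N where "N = (LINT x:torus|lebesgue. cmod (f x))"
  have Ni: "set_integrable lebesgue torus (\<lambda>x. cmod (f x))"
    using set_integrable_norm[OF f] .
  have N: "0 \<le> N" unfolding N_def set_lebesgue_integral_def by (intro integral_nonneg_AE) auto
  have GS: "continuous_on (sphere 0 1) G" using G by (rule continuous_on_subset) simp
  have "bounded (G ` sphere 0 1)"
    by (intro compact_imp_bounded compact_continuous_image GS compact_sphere)
  then obtain B where B: "\<And>z. z \<in> sphere 0 1 \<Longrightarrow> \<bar>G z\<bar> \<le> B" unfolding bounded_iff by force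
  have Gi: "set_integrable lebesgue torus (\<lambda>x. of_real (G (cis x)) * f x)"
    by (rule set_integrable_bounded_mult[OF f cis_lebesgue[OF G], where B = B]) (simp add: B)
  have "cmod (LINT x:torus|lebesgue. of_real (G (cis x)) * f x) \<le> e * N" if e: "e > 0" for e
  proof -
    obtain g where g: "real_polynomial_function g" "\<And>z. z \<in> sphere 0 1 \<Longrightarrow> \<bar>G z - g z\<bar> < e"
      using Stone_Weierstrass_real_polynomial_function[OF compact_sphere GS e] by blast
    note p = trigp_real_polynomial[OF g(1)]
    obtain C where "\<forall>x. cmod (of_real (g (cis x))) \<le> C" using trigp_bounded[OF p] by blast
    then have pi: "set_integrable lebesgue torus (\<lambda>x. of_real (g (cis x)) * f x)"
      by (intro set_integrable_bounded_mult[OF f trigp_measurable[OF p]]) auto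
    have "(LINT x:torus|lebesgue. of_real (G (cis x)) * f x)
        = (LINT x:torus|lebesgue. of_real (G (cis x)) * f x) - (LINT x:torus|lebesgue. of_real (g (cis x)) * f x)"
      using trigp_orthogonal[OF f z p] by simp
    also have "\<dots> = (LINT x:torus|lebesgue. of_real (G (cis x)) * f x - of_real (g (cis x)) * f x)"
      using set_integral_diff(2)[OF Gi pi] by simp
    also have "cmod \<dots> \<le> (LINT x:torus|lebesgue. e * cmod (f x))"
      unfolding set_lebesgue_integral_def
    proof (rule order_trans[OF integral_norm_bound integral_mono])
      show "integrable lebesgue (\<lambda>x. cmod (indicat_real torus x *\<^sub>R (of_real (G (cis x)) * f x - of_real (g (cis x)) * f x)))"
        using set_integral_diff(1)[OF Gi pi] unfolding set_integrable_def by (rule integrable_norm)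
      show "integrable lebesgue (\<lambda>x. indicat_real torus x *\<^sub>R (e * cmod (f x)))"
        using Ni by (simp add: set_integrable_def mult.left_commute)
      fix x
      have "cmod (of_real (G (cis x)) * f x - of_real (g (cis x)) * f x) = \<bar>G (cis x) - g (cis x)\<bar> * cmod (f x)"
        by (simp add: left_diff_distrib[symmetric] norm_mult flip: of_real_diff)
      also have "\<dots> \<le> e * cmod (f x)" using g(2)[of "cis x"] by (intro mult_right_mono) auto
      finally show "cmod (indicat_real torus x *\<^sub>R (of_real (G (cis x)) * f x - of_real (g (cis x)) * f x))
          \<le> indicat_real torus x *\<^sub>R (e * cmod (f x))"
        by (auto simp: indicator_def)
    qed
    also have "\<dots> = e * N" by (simp add: N_def)
    finally show ?thesis .
  qed
  then have lim: "\<And>e. e > 0 \<Longrightarrow> cmod (LINT x:torus|lebesgue. of_real (G (cis x)) * f x) \<le> e * N" .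
  have "cmod (LINT x:torus|lebesgue. of_real (G (cis x)) * f x) \<le> 0 + e" if "e > 0" for e
  proof -
    have "e / (N + 1) * N \<le> e" using that N by (simp add: field_simps)
    then show ?thesis using lim[of "e / (N + 1)"] that N by (simp add: divide_pos_pos)
  qed
  then have "cmod (LINT x:torus|lebesgue. of_real (G (cis x)) * f x) \<le> 0" by (rule field_le_epsilon)
  then show ?thesis by simp
qed

lemma cis_inj_on: "x \<in> {0<..<2 * pi} \<Longrightarrow> y \<in> torus \<Longrightarrow> cis x = cis y \<Longrightarrow> x = y"
proof -
  assume x: "x \<in> {0<..<2 * pi}" and y: "y \<in> torus" and eq: "cis x = cis y"
  then have "sin x = sin y" "cos x = cos y" by (auto simp: complex_eq_iff)
  then obtain n where "x = y + 2 * pi * of_int n" using sin_cos_eq_iff by blast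
  moreover have "n = 0"
  proof (rule ccontr)
    assume "n \<noteq> 0"
    then have n: "1 \<le> real_of_int n \<or> real_of_int n \<le> - 1" by linarith
    have b: "0 < x" "x < 2 * pi" "0 \<le> y" "y \<le> 2 * pi" using x y by auto
    from n show False
    proof
      assume "1 \<le> real_of_int n"
      then have "2 * pi * 1 \<le> 2 * pi * real_of_int n" by (rule mult_left_mono) simp
      then show False using b \<open>x = y + 2 * pi * of_int n\<close> by linarith
    next
      assume "real_of_int n \<le> - 1"
      then have "2 * pi * real_of_int n \<le> 2 * pi * (- 1)" by (rule mult_left_mono) simp
      then show False using b \<open>x = y + 2 * pi * of_int n\<close> by linarith
    qed
  qed
  ultimately show ?thesis by simp
qed

text \<open>The indicator of K is the limit of continuous functions of the distance to the image of
  K on the circle. As K avoids both endpoints, no other point of the period is mapped into that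
  image; dominated convergence concludes.\<close>

lemma closed_orthogonal:
  assumes f: "set_integrable lebesgue torus f" and z: "\<And>k. fourier f k = 0"
    and K: "closed K" "K \<subseteq> {0<..<2 * pi}"
  shows "(LINT x:K|lebesgue. f x) = 0"
proof (cases "K = {}")
  case False
  have cK: "compact K" 
  proof -
    have "K \<subseteq> torus" using K(2) by force
    then have "bounded K" using bounded_subset[OF compact_imp_bounded[OF compact_Icc]] by blast
    then show ?thesis using K(1) by (simp add: compact_eq_bounded_closed)
  qed
  define C where "C = cis ` K"
  have C: "closed C" "C \<noteq> {}"
    unfolding C_def using cK False
    by (auto intro!: compact_imp_closed compact_continuous_image continuous_intros)
  define G where "G n z = max 0 (1 - real n * infdist z C)" for n z
  have G: "continuous_on UNIV (G n)" for n unfolding G_def by (intro continuous_intros)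
  have G01: "0 \<le> G n z" "G n z \<le> 1" for n z unfolding G_def using infdist_nonneg[of z C] by auto
  have lim: "(\<lambda>n. G n (cis x)) \<longlonglongrightarrow> indicator K x" if x: "x \<in> torus" for x
  proof (cases "x \<in> K")
    case True
    then have "G n (cis x) = 1" for n unfolding G_def C_def by simp
    then show ?thesis using True by simp
  next
    case False
    have "cis x \<notin> C" using False cis_inj_on[OF _ x] K(2) unfolding C_def by auto
    then have d: "infdist (cis x) C > 0" using C infdist_pos_not_in_closed by blast
    have "\<forall>\<^sub>F n in sequentially. real n \<ge> 1 / infdist (cis x) C"
      using filterlim_real_sequentially by (simp add: filterlim_at_top)
    then have "\<forall>\<^sub>F n in sequentially. G n (cis x) = 0"
      by eventually_elim (use d in \<open>auto simp: G_def field_simps max_def\<close>)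
    then show ?thesis using False by (simp add: tendsto_eventually)
  qed
  have "(\<lambda>n. LINT x:torus|lebesgue. of_real (G n (cis x)) * f x) \<longlonglongrightarrow> (LINT x|lebesgue. indicator K x *\<^sub>R f x)"
    unfolding set_lebesgue_integral_def
  proof (rule integral_dominated_convergence)
    have Kt: "K \<subseteq> torus" using K(2) by force
    have "set_integrable lebesgue K f" by (rule set_integrable_subset[OF f]) (use K Kt in auto)
    then show "(\<lambda>x. indicat_real K x *\<^sub>R f x) \<in> borel_measurable lebesgue"
      by (auto simp: set_integrable_def)
    show "(\<lambda>x. indicat_real torus x *\<^sub>R (of_real (G n (cis x)) * f x)) \<in> borel_measurable lebesgue" for n
      using set_integrable_bounded_mult[OF f cis_lebesgue[OF G[of n]], of 1] G01
      by (auto simp: set_integrable_def)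
    show "integrable lebesgue (\<lambda>x. cmod (indicator torus x *\<^sub>R f x))"
      by (rule integrable_norm[OF f[unfolded set_integrable_def]])
    show "AE x in lebesgue. (\<lambda>n. indicat_real torus x *\<^sub>R (of_real (G n (cis x)) * f x)) \<longlonglongrightarrow> indicat_real K x *\<^sub>R f x"
    proof (rule AE_I2)
      fix x
      show "(\<lambda>n. indicat_real torus x *\<^sub>R (of_real (G n (cis x)) * f x)) \<longlonglongrightarrow> indicat_real K x *\<^sub>R f x"
      proof (cases "x \<in> torus")
        case True
        have "(\<lambda>n. G n (cis x) *\<^sub>R f x) \<longlonglongrightarrow> indicat_real K x *\<^sub>R f x"
          by (intro tendsto_intros lim True)
        then show ?thesis using True by (simp add: scaleR_conv_of_real)
      next
        case False
        then have "x \<notin> K" using Kt by auto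
        then show ?thesis using False by simp
      qed
    qed
    show "AE x in lebesgue. cmod (indicat_real torus x *\<^sub>R (of_real (G n (cis x)) * f x)) \<le> cmod (indicator torus x *\<^sub>R f x)" for n
      using G01 by (intro AE_I2) (auto simp: norm_mult indicator_def intro: mult_left_le_one_le)
  qed
  then show ?thesis
    unfolding circle_orthogonal[OF f z G] set_lebesgue_integral_def[symmetric]
    by (simp add: LIMSEQ_const_iff)
qed (simp add: set_lebesgue_integral_def)

text \<open>If Re f were positive on a set of positive measure, inner regularity would give a closed
  subset of positive measure, over which the integral of Re f vanishes although the integrand is
  positive.\<close>

lemma fourier_zero_Re:
  assumes f: "set_integrable lebesgue torus f" and z: "\<And>k. fourier f k = 0"
  shows "AE x in lebesgue. x \<in> {0<..<2 * pi} \<longrightarrow> Re (f x) \<le> 0"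
proof -
  define P where "P = {x \<in> {0<..<2 * pi}. Re (f x) > 0}"
  have fm: "(\<lambda>x. indicator torus x *\<^sub>R f x) \<in> borel_measurable lebesgue"
    using f by (auto simp: set_integrable_def)
  have fr: "(\<lambda>x. Re (indicator torus x *\<^sub>R f x)) \<in> borel_measurable lebesgue"
    using measurable_compose[OF fm borel_measurable_Re] .
  have "P = {x \<in> space lebesgue. 0 < Re (indicator torus x *\<^sub>R f x)} \<inter> {0<..<2 * pi}"
    unfolding P_def by auto
  also have "\<dots> \<in> sets lebesgue"
    by (rule sets.Int[OF borel_measurable_less[OF borel_measurable_const fr]]) auto
  finally have P: "P \<in> sets lebesgue" .
  have K0: "emeasure lebesgue K = 0" if K: "closed K" "K \<subseteq> P" for K
  proof -
    have K': "K \<subseteq> {0<..<2 * pi}" using K unfolding P_def by auto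
    then have Kt: "K \<subseteq> torus" by force
    have fK: "set_integrable lebesgue K f" by (rule set_integrable_subset[OF f]) (use K Kt in auto)
    then have int: "integrable lebesgue (\<lambda>x. Re (indicator K x *\<^sub>R f x))"
      unfolding set_integrable_def by (rule integrable_Re)
    have "(LINT x|lebesgue. Re (indicator K x *\<^sub>R f x)) = Re (LINT x:K|lebesgue. f x)"
      using fK unfolding set_integrable_def set_lebesgue_integral_def by (rule integral_Re)
    also have "\<dots> = 0" using closed_orthogonal[OF f z K(1) K'] by simp
    finally have i0: "(LINT x|lebesgue. Re (indicator K x *\<^sub>R f x)) = 0" .
    have nn: "AE x in lebesgue. 0 \<le> Re (indicator K x *\<^sub>R f x)"
      using K unfolding P_def by (intro AE_I2) (auto simp: indicator_def dest!: subsetD)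
    have "AE x in lebesgue. Re (indicator K x *\<^sub>R f x) = 0"
      using integral_nonneg_eq_0_iff_AE[OF int nn] i0 by simp
    then have "AE x in lebesgue. x \<notin> K"
      by eventually_elim (use K in \<open>auto simp: P_def indicator_def\<close>)
    moreover have "K \<in> sets lebesgue" using K(1) by simp
    ultimately have "K \<in> null_sets lebesgue" using AE_iff_null_sets by blast
    then show ?thesis by auto
  qed
  have "emeasure lebesgue P \<le> 0"
  proof (rule ennreal_le_epsilon)
    fix e :: real assume e: "0 < e"
    obtain K where K: "closed K" "K \<subseteq> P" "P - K \<in> lmeasurable" "emeasure lebesgue (P - K) < ennreal e"
      by (rule sets_lebesgue_inner_closed[OF P e])
    have Ks: "K \<in> sets lebesgue" using K(1) by simp
    have "P = K \<union> (P - K)" using K(2) by auto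
    then have "emeasure lebesgue P \<le> emeasure lebesgue K + emeasure lebesgue (P - K)"
      using emeasure_subadditive[OF Ks sets.Diff[OF P Ks]] by simp
    also have "\<dots> = emeasure lebesgue (P - K)" using K0[OF K(1,2)] by simp
    also have "\<dots> \<le> 0 + ennreal e" using K(4) by simp
    finally show "emeasure lebesgue P \<le> 0 + ennreal e" .
  qed
  then have "P \<in> null_sets lebesgue" using P by auto
  then have "AE x in lebesgue. x \<notin> P" by (rule AE_not_in)
  then show ?thesis by eventually_elim (auto simp: P_def)
qed

lemma fourier_cmult: "fourier (\<lambda>x. a * f x) k = a * fourier f k"
  by (simp add: fourier_ek mult.left_commute)

lemma fourier_unique_zero:
  assumes f: "set_integrable lebesgue torus f" and z: "\<And>k. fourier f k = 0"
  shows "AE x in lebesgue. x \<in> torus \<longrightarrow> f x = 0"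
proof -
  \<comment> \<open>Used with a = 1, -1, i and -i, which bounds the real and the imaginary part from
    both sides.\<close>
  have *: "AE x in lebesgue. x \<in> {0<..<2 * pi} \<longrightarrow> Re (a * f x) \<le> 0" for a
    by (rule fourier_zero_Re) (use f z in \<open>auto simp: fourier_cmult\<close>)
  have e: "AE x in lebesgue. x \<noteq> 0" "AE x in lebesgue. x \<noteq> 2 * pi"
    by (auto intro!: AE_completion AE_lborel_singleton)
  from *[of 1] *[of "- 1"] *[of "\<i>"] *[of "- \<i>"] e show ?thesis
  proof eventually_elim
    case (elim x)
    show ?case
    proof
      assume "x \<in> torus"
      then have "x \<in> {0<..<2 * pi}" using elim by auto
      then show "f x = 0" using elim by (auto simp: complex_eq_iff)
    qed
  qed
qed

subsection \<open>Absolutely convergent Fourier series\<close>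

abbreviation asummable_on :: "('a \<Rightarrow> 'b::real_normed_vector) \<Rightarrow> 'a set \<Rightarrow> bool" (infixr "asummable'_on" 46) where
  "f asummable_on A \<equiv> (\<lambda>x. norm (f x)) summable_on A"

definition fser :: "(int \<Rightarrow> complex) \<Rightarrow> real \<Rightarrow> complex" where
  "fser c x = (\<Sum>\<^sub>\<infinity>k. c k * ek k x)"

definition cconv :: "(int \<Rightarrow> complex) \<Rightarrow> (int \<Rightarrow> complex) \<Rightarrow> int \<Rightarrow> complex" where
  "cconv c d k = (\<Sum>\<^sub>\<infinity>j. c j * d (k - j))"

text \<open>The sequence c is taken with respect to exp(ikx) itself, without the factor 1 / sqrt (2
  pi) of the Fourier transform; in this normalisation products of functions correspond to
  convolutions with no constant.\<close>

definition frep :: "(real \<Rightarrow> complex) \<Rightarrow> (int \<Rightarrow> complex) \<Rightarrow> bool" where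
  "frep u c \<longleftrightarrow> set_borel_measurable lebesgue torus u \<and> c asummable_on UNIV \<and>
     (AE x in lebesgue. x \<in> torus \<longrightarrow> u x = fser c x)"

lemma fser_summable: "c asummable_on UNIV \<Longrightarrow> (\<lambda>k. c k * ek k x) asummable_on UNIV"
  by (simp add: norm_mult)

lemma fser_le: "c asummable_on UNIV \<Longrightarrow> cmod (fser c x) \<le> (\<Sum>\<^sub>\<infinity>k. cmod (c k))"
  unfolding fser_def using norm_infsum_bound[OF fser_summable, of c x] by (simp add: norm_mult)

lemma fser_periodic: "fser c (x + 2 * pi) = fser c x"
  by (simp add: fser_def ek_periodic)

lemma fser_limit:
  assumes "c asummable_on UNIV"
  shows "(\<lambda>n. \<Sum>j\<in>{- int n..int n}. c j * ek j x) \<longlonglongrightarrow> fser c x"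
  unfolding fser_def
  by (rule has_sum_symm_interval[OF has_sum_infsum[OF abs_summable_summable[OF fser_summable[OF assms]]]])

lemma fser_partial_measurable:
  "(\<lambda>x. \<Sum>j\<in>S. c j * ek j x) \<in> borel_measurable lebesgue"
  by (intro borel_measurable_sum borel_measurable_times lebesgue_ek) auto

lemma fser_measurable:
  assumes "c asummable_on UNIV"
  shows "fser c \<in> borel_measurable lebesgue"
  by (rule borel_measurable_LIMSEQ_metric[OF fser_partial_measurable fser_limit[OF assms]])

lemma torus_indicator: "indicat_real torus \<in> borel_measurable lebesgue"
  by (rule borel_measurable_indicator) simp

lemma one_integrable: "set_integrable lebesgue torus (\<lambda>x. 1 :: complex)"
  by (rule set_integrable_continuous_torus) simp

lemma fser_integrable:
  assumes "c asummable_on UNIV"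
  shows "set_integrable lebesgue torus (fser c)"
  using set_integrable_bounded_mult[OF one_integrable fser_measurable[OF assms] fser_le[OF assms]] by simp

lemma fser_fourier:
  assumes c: "c asummable_on UNIV"
  shows "fourier (fser c) k = of_real (sqrt (2 * pi)) * c k"
proof -
  let ?B = "\<Sum>\<^sub>\<infinity>k. cmod (c k)"
  let ?s = "\<lambda>n x. \<Sum>j\<in>{- int n..int n}. c j * ek j x"
  have i: "set_integrable lebesgue torus (\<lambda>x. c j * ek m x)" for j m
    by (intro set_integrable_continuous_torus continuous_intros continuous_ek)
  have "(\<lambda>n. LINT x:torus|lebesgue. ek (- k) x * ?s n x) \<longlonglongrightarrow> (LINT x:torus|lebesgue. ek (- k) x * fser c x)"
    unfolding set_lebesgue_integral_def
  proof (rule integral_dominated_convergence)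
    show "(\<lambda>x. indicat_real torus x *\<^sub>R (ek (- k) x * fser c x)) \<in> borel_measurable lebesgue"
      by (intro borel_measurable_scaleR borel_measurable_times lebesgue_ek fser_measurable c torus_indicator)
    show "(\<lambda>x. indicat_real torus x *\<^sub>R (ek (- k) x * ?s n x)) \<in> borel_measurable lebesgue" for n
      by (intro borel_measurable_scaleR borel_measurable_times lebesgue_ek fser_partial_measurable torus_indicator)
    show "integrable lebesgue (\<lambda>x. cmod (indicat_real torus x *\<^sub>R (of_real ?B * 1)))"
      by (rule integrable_norm, fold set_integrable_def, rule set_integrable_continuous_torus)
         (intro continuous_intros)
    show "AE x in lebesgue. (\<lambda>n. indicat_real torus x *\<^sub>R (ek (- k) x * ?s n x)) \<longlonglongrightarrow> indicat_real torus x *\<^sub>R (ek (- k) x * fser c x)"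
      by (intro AE_I2 tendsto_intros fser_limit c)
    show "AE x in lebesgue. cmod (indicat_real torus x *\<^sub>R (ek (- k) x * ?s n x)) \<le> cmod (indicat_real torus x *\<^sub>R (of_real ?B * 1))" for n
    proof (rule AE_I2)
      fix x
      have "cmod (?s n x) \<le> (\<Sum>j\<in>{- int n..int n}. cmod (c j))"
        by (rule order_trans[OF norm_sum]) (simp add: norm_mult)
      also have "\<dots> \<le> ?B" using c by (intro finite_sum_le_infsum) auto
      finally have "cmod (?s n x) \<le> ?B" .
      moreover have "0 \<le> ?B" by (rule infsum_nonneg) simp
      ultimately show "cmod (indicat_real torus x *\<^sub>R (ek (- k) x * ?s n x)) \<le> cmod (indicat_real torus x *\<^sub>R (of_real ?B * 1))"
        by (auto simp: norm_mult indicator_def)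
    qed
  qed
  moreover have "\<forall>\<^sub>F n in sequentially. (LINT x:torus|lebesgue. ek (- k) x * ?s n x) = of_real (2 * pi) * c k"
    using eventually_ge_at_top[of "nat \<bar>k\<bar>"]
  proof eventually_elim
    case (elim n)
    then have kn: "k \<in> {- int n..int n}" by auto
    have "(LINT x:torus|lebesgue. ek (- k) x * ?s n x) = (LINT x:torus|lebesgue. \<Sum>j\<in>{- int n..int n}. c j * ek (j - k) x)"
      by (simp add: sum_distrib_left mult.left_commute ek_mult)
    also have "\<dots> = (\<Sum>j\<in>{- int n..int n}. LINT x:torus|lebesgue. c j * ek (j - k) x)"
      unfolding set_lebesgue_integral_def scaleR_sum_right
      by (rule Bochner_Integration.integral_sum) (use i in \<open>simp add: set_integrable_def\<close>)
    also have "\<dots> = (\<Sum>j\<in>{- int n..int n}. if j = k then of_real (2 * pi) * c k else 0)"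
      by (intro sum.cong refl) (simp add: integral_ek)
    also have "\<dots> = of_real (2 * pi) * c k" using kn by simp
    finally show ?case .
  qed
  then have "(\<lambda>n. LINT x:torus|lebesgue. ek (- k) x * ?s n x) \<longlonglongrightarrow> of_real (2 * pi) * c k"
    by (rule tendsto_eventually)
  ultimately have eq: "(LINT x:torus|lebesgue. ek (- k) x * fser c x) = of_real (2 * pi) * c k"
    by (rule LIMSEQ_unique)
  have "1 / sqrt (2 * pi) * (2 * pi) = sqrt (2 * pi)" by (simp add: real_div_sqrt)
  then have "complex_of_real (1 / sqrt (2 * pi)) * complex_of_real (2 * pi) = of_real (sqrt (2 * pi))"
    by (metis of_real_mult)
  then show ?thesis unfolding fourier_ek eq mult.assoc[symmetric] by simp
qed

lemma frep_abs_summable: "frep u c \<Longrightarrow> c asummable_on UNIV"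
  by (simp add: frep_def)

lemma frep_lint:
  assumes u: "frep u c" and g: "g \<in> borel_measurable lebesgue"
  shows "(LINT x:torus|lebesgue. g x * u x) = (LINT x:torus|lebesgue. g x * fser c x)"
  unfolding set_lebesgue_integral_def
proof (rule integral_cong_AE)
  have um: "(\<lambda>x. indicator torus x *\<^sub>R u x) \<in> borel_measurable lebesgue"
    using u by (simp add: frep_def set_borel_measurable_def)
  have "(\<lambda>x. g x * (indicator torus x *\<^sub>R u x)) \<in> borel_measurable lebesgue"
    by (intro borel_measurable_times g um)
  then show "(\<lambda>x. indicat_real torus x *\<^sub>R (g x * u x)) \<in> borel_measurable lebesgue" by simp
  show "(\<lambda>x. indicat_real torus x *\<^sub>R (g x * fser c x)) \<in> borel_measurable lebesgue"
    using frep_abs_summable[OF u] by (intro borel_measurable_scaleR borel_measurable_times g fser_measurable torus_indicator)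
  show "AE x in lebesgue. indicat_real torus x *\<^sub>R (g x * u x) = indicat_real torus x *\<^sub>R (g x * fser c x)"
    using u unfolding frep_def by (auto simp: indicator_def elim!: eventually_mono)
qed

lemma frep_fourier: "frep u c \<Longrightarrow> fourier u k = of_real (sqrt (2 * pi)) * c k"
  using fser_fourier[of c k] frep_lint[of u c "ek (- k)"] frep_abs_summable[of u c]
  by (simp add: fourier_ek lebesgue_ek)

lemma frep_lint_ek:
  assumes "frep u c"
  shows "(LINT x:torus|lebesgue. ek (- k) x * u x) = of_real (2 * pi) * c k"
proof -
  have "of_real (1 / sqrt (2 * pi)) * (LINT x:torus|lebesgue. ek (- k) x * u x) = of_real (sqrt (2 * pi)) * c k"
    using frep_fourier[OF assms, of k] by (simp only: fourier_ek)
  then have "of_real (sqrt (2 * pi)) * (of_real (1 / sqrt (2 * pi)) * (LINT x:torus|lebesgue. ek (- k) x * u x))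
      = of_real (sqrt (2 * pi)) * (of_real (sqrt (2 * pi)) * c k)" by simp
  moreover have "complex_of_real (sqrt (2 * pi)) * of_real (1 / sqrt (2 * pi)) = 1"
    by (simp flip: of_real_mult)
  moreover have "complex_of_real (sqrt (2 * pi)) * of_real (sqrt (2 * pi)) = of_real (2 * pi)"
    by (simp flip: of_real_mult)
  ultimately show ?thesis by (metis mult.assoc mult_1_left)
qed

lemma fourier_diff:
  assumes "set_integrable lebesgue torus f" "set_integrable lebesgue torus g"
  shows "fourier (\<lambda>x. f x - g x) k = fourier f k - fourier g k"
proof -
  have ei: "set_integrable lebesgue torus (\<lambda>x. ek (- k) x * h x)"
    if "set_integrable lebesgue torus h" for h
    by (rule set_integrable_bounded_mult[OF that lebesgue_ek, where B = 1]) simp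
  show ?thesis
    unfolding fourier_ek right_diff_distrib set_integral_diff(2)[OF ei[OF assms(1)] ei[OF assms(2)]] ..
qed

lemma frep_of_fourier:
  assumes u: "set_integrable lebesgue torus u" and s: "fourier u asummable_on UNIV"
  shows "frep u (\<lambda>k. fourier u k / of_real (sqrt (2 * pi)))"
proof -
  define c where "c = (\<lambda>k. fourier u k / of_real (sqrt (2 * pi)))"
  have c: "c asummable_on UNIV"
    using summable_on_cmult_right[OF s, of "1 / sqrt (2 * pi)"] by (simp add: c_def norm_divide)
  have d: "set_integrable lebesgue torus (\<lambda>x. u x - fser c x)"
    by (rule set_integral_diff(1)[OF u fser_integrable[OF c]])
  have "fourier (\<lambda>x. u x - fser c x) k = 0" for k
    unfolding fourier_diff[OF u fser_integrable[OF c]] fser_fourier[OF c] by (simp add: c_def)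
  from fourier_unique_zero[OF d this]
  have "AE x in lebesgue. x \<in> torus \<longrightarrow> u x = fser c x" by simp
  moreover have "set_borel_measurable lebesgue torus u"
    using u unfolding set_integrable_def set_borel_measurable_def by (rule borel_measurable_integrable)
  ultimately show ?thesis using c unfolding frep_def c_def by blast
qed

lemma abs_summable_prod:
  fixes c d :: "int \<Rightarrow> complex"
  assumes c: "c asummable_on UNIV" and d: "d asummable_on UNIV"
  shows "(\<lambda>(j, l). c j * d l) asummable_on UNIV"
proof -
  have "(\<lambda>(j, l). c j * d l) asummable_on (UNIV \<times> UNIV)"
    unfolding Infinite_Sum.abs_summable_on_Sigma_iff
  proof (intro conjI ballI)
    fix j
    show "(\<lambda>l. case (j, l) of (j, l) \<Rightarrow> c j * d l) asummable_on UNIV"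
      using summable_on_cmult_right[OF d, of "cmod (c j)"] by (simp add: norm_mult)
    have "(\<lambda>j. \<Sum>\<^sub>\<infinity>l. cmod (case (j, l) of (j, l) \<Rightarrow> c j * d l)) = (\<lambda>j. cmod (c j) * (\<Sum>\<^sub>\<infinity>l. cmod (d l)))"
      using d by (simp add: norm_mult infsum_cmult_right)
    then show "(\<lambda>j. \<Sum>\<^sub>\<infinity>l. cmod (case (j, l) of (j, l) \<Rightarrow> c j * d l)) asummable_on UNIV"
      using summable_on_cmult_left[OF c, of "\<Sum>\<^sub>\<infinity>l. cmod (d l)"]
      by (simp add: abs_mult infsum_nonneg)
  qed
  then show ?thesis by simp
qed

text \<open>Cauchy product: the bijection from (k, j) to (j, k - j) turns the double series into a
  product, and absolute summability justifies both orders of summation.\<close>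

lemma cconv_sum:
  assumes c: "c asummable_on UNIV" and d: "d asummable_on UNIV"
  shows "cconv c d asummable_on UNIV" "(\<Sum>\<^sub>\<infinity>k. cconv c d k) = (\<Sum>\<^sub>\<infinity>k. c k) * (\<Sum>\<^sub>\<infinity>k. d k)"
proof -
  let ?f = "\<lambda>(k, j). c j * d (k - j)"
  let ?h = "\<lambda>(k, j). (j, k - j)" and ?g = "\<lambda>(j, l). c j * d l"
  have bij: "bij (?h :: int \<times> int \<Rightarrow> _)"
    by (rule o_bij[of "\<lambda>(j, l). (j + l, j)"]) (auto simp: fun_eq_iff)
  have fg: "?f = ?g \<circ> ?h" by (auto simp: fun_eq_iff)
  have g: "?g asummable_on UNIV" by (rule abs_summable_prod[OF c d])
  have f: "?f asummable_on UNIV"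
    using summable_on_reindex_bij_betw[OF bij, of "\<lambda>x. cmod (?g x)"] g
    by (simp add: case_prod_beta)
  then have f': "?f asummable_on (UNIV \<times> UNIV)" by simp
  have i: "(\<lambda>j. c j * d (k - j)) asummable_on UNIV" for k
    using f' unfolding Infinite_Sum.abs_summable_on_Sigma_iff by auto
  have "(\<lambda>k. \<Sum>\<^sub>\<infinity>j. cmod (c j * d (k - j))) asummable_on UNIV"
    using f' unfolding Infinite_Sum.abs_summable_on_Sigma_iff by auto
  then show "cconv c d asummable_on UNIV"
  proof (rule summable_on_comparison_test)
    fix k
    show "cmod (cconv c d k) \<le> norm (\<Sum>\<^sub>\<infinity>j. cmod (c j * d (k - j)))"
      unfolding cconv_def using norm_infsum_bound[OF i, of k] by (simp add: infsum_nonneg)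
  qed simp
  have "(\<Sum>\<^sub>\<infinity>k. cconv c d k) = infsum ?f (UNIV \<times> UNIV)"
    unfolding cconv_def using infsum_Sigma'_banach[of "\<lambda>k j. c j * d (k - j)" UNIV "\<lambda>_. UNIV"] abs_summable_summable[OF f'] by simp
  also have "\<dots> = infsum ?g UNIV"
    using infsum_reindex_bij_betw[OF bij, of ?g] by (simp add: split_def)
  also have "\<dots> = (\<Sum>\<^sub>\<infinity>j. \<Sum>\<^sub>\<infinity>l. c j * d l)"
    using infsum_Sigma'_banach[of "\<lambda>j l. c j * d l" UNIV "\<lambda>_. UNIV"] abs_summable_summable[OF g] by simp
  also have "\<dots> = (\<Sum>\<^sub>\<infinity>k. c k) * (\<Sum>\<^sub>\<infinity>k. d k)"
    using abs_summable_summable[OF c] abs_summable_summable[OF d]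
    by (simp add: infsum_cmult_right infsum_cmult_left)
  finally show "(\<Sum>\<^sub>\<infinity>k. cconv c d k) = (\<Sum>\<^sub>\<infinity>k. c k) * (\<Sum>\<^sub>\<infinity>k. d k)" .
qed

text \<open>At fixed x the exponentials are put into the coefficients. Convolving the twisted
  sequences twists the convolution, so that the sum rule for \<open>cconv\<close> is enough.\<close>

lemma fser_mult:
  assumes c: "c asummable_on UNIV" and d: "d asummable_on UNIV"
  shows "fser c x * fser d x = fser (cconv c d) x"
proof -
  have "cconv (\<lambda>k. c k * ek k x) (\<lambda>k. d k * ek k x) k = cconv c d k * ek k x" for k
  proof -
    have "c j * ek j x * (d (k - j) * ek (k - j) x) = c j * d (k - j) * ek k x" for j
      using ek_mult[of j x "k - j"] by (simp add: mult_ac)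
    then show ?thesis unfolding cconv_def by (simp only: infsum_cmult_left')
  qed
  then show ?thesis
    using cconv_sum(2)[OF fser_summable[OF c, of x] fser_summable[OF d, of x]] by (simp add: fser_def)
qed

lemma frep_mult:
  assumes u: "frep u c" and v: "frep v d"
  shows "frep (\<lambda>x. u x * v x) (cconv c d)"
  unfolding frep_def
proof (intro conjI)
  have "(\<lambda>x. (indicator torus x *\<^sub>R u x) * (indicator torus x *\<^sub>R v x)) \<in> borel_measurable lebesgue"
    using u v unfolding frep_def set_borel_measurable_def by (intro borel_measurable_times) auto
  moreover have "(\<lambda>x. (indicator torus x *\<^sub>R u x) * (indicator torus x *\<^sub>R v x)) = (\<lambda>x. indicat_real torus x *\<^sub>R (u x * v x))"
    by (auto simp: indicator_def fun_eq_iff)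
  ultimately show "set_borel_measurable lebesgue torus (\<lambda>x. u x * v x)"
    unfolding set_borel_measurable_def by simp
  show "cconv c d asummable_on UNIV" using u v by (intro cconv_sum frep_abs_summable)
  have "AE x in lebesgue. x \<in> torus \<longrightarrow> u x = fser c x" "AE x in lebesgue. x \<in> torus \<longrightarrow> v x = fser d x"
    using u v by (auto simp: frep_def)
  then show "AE x in lebesgue. x \<in> torus \<longrightarrow> u x * v x = fser (cconv c d) x"
    by eventually_elim (use fser_mult[OF frep_abs_summable[OF u] frep_abs_summable[OF v]] in auto)
qed

lemma frep_cnj:
  assumes u: "frep u c"
  shows "frep (\<lambda>x. cnj (u x)) (\<lambda>k. cnj (c (- k)))"
  unfolding frep_def
proof (intro conjI)
  have um: "(\<lambda>x. indicator torus x *\<^sub>R u x) \<in> borel_measurable lebesgue"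
    using u by (simp add: frep_def set_borel_measurable_def)
  have "cnj \<in> borel_measurable borel"
    by (rule borel_measurable_continuous_onI) (rule continuous_on_cnj[OF continuous_on_id])
  from measurable_compose[OF um this]
  have "(\<lambda>x. cnj (indicator torus x *\<^sub>R u x)) \<in> borel_measurable lebesgue" .
  then show "set_borel_measurable lebesgue torus (\<lambda>x. cnj (u x))"
    unfolding set_borel_measurable_def by (simp add: complex_cnj_scaleR)
  have "bij (uminus :: int \<Rightarrow> int)" by (rule bij_uminus)
  from summable_on_reindex_bij_betw[OF this, of "\<lambda>k. cmod (c k)"]
  show "(\<lambda>k. cnj (c (- k))) asummable_on UNIV" using frep_abs_summable[OF u] by simp
  have "cnj (fser c x) = fser (\<lambda>k. cnj (c (- k))) x" for x
  proof -
    have "cnj (fser c x) = (\<Sum>\<^sub>\<infinity>k. cnj (c k * ek k x))"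
      unfolding fser_def by (rule infsum_cnj[symmetric])
    also have "\<dots> = (\<Sum>\<^sub>\<infinity>k. cnj (c (- k) * ek (- k) x))"
      by (rule infsum_reindex_bij_betw[OF bij_uminus, symmetric])
    finally show ?thesis by (simp add: fser_def cnj_ek)
  qed
  then show "AE x in lebesgue. x \<in> torus \<longrightarrow> cnj (u x) = fser (\<lambda>k. cnj (c (- k))) x"
    using u unfolding frep_def by (auto elim!: eventually_mono)
qed

text \<open>The coefficients of |u|^2 when c are those of u; the one at frequency 0 is the
  mass.\<close>

definition wsq :: "(int \<Rightarrow> complex) \<Rightarrow> int \<Rightarrow> complex" where
  "wsq c = cconv c (\<lambda>k. cnj (c (- k)))"

lemma wsq_eq: "wsq c j = (\<Sum>\<^sub>\<infinity>p. c p * cnj (c (p - j)))"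
  by (simp add: wsq_def cconv_def)

lemma frep_sq: "frep u c \<Longrightarrow> frep (\<lambda>x. of_real ((cmod (u x))\<^sup>2)) (wsq c)"
  using frep_mult[OF _ frep_cnj, of u c u c] unfolding wsq_def by (simp only: complex_norm_square)

lemma frep_cube: "frep u c \<Longrightarrow> frep (\<lambda>x. of_real ((cmod (u x))\<^sup>2) * u x) (cconv (wsq c) c)"
  by (intro frep_mult frep_sq)

lemma wsq_0:
  assumes "l2b (\<lambda>j. jbr j * cmod (c j)) A"
  shows "wsq c 0 = of_real (mass c)"
proof -
  have "((\<lambda>j. complex_of_real ((cmod (c j))\<^sup>2)) has_sum of_real (mass c)) UNIV"
    by (rule has_sum_bounded_linear[OF bounded_linear_of_real mass_has_sum[OF assms]])
  from infsumI[OF this] show ?thesis unfolding wsq_eq by (simp only: complex_norm_square diff_0_right)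
qed

lemma triple_abs_summable:
  assumes V: "l2b (\<lambda>j. jbr j * sy c j) V"
    and g: "\<And>i. cmod (g i) \<le> (jbr k + jbr (snd i)) * (sy c (fst i) * sy c (k - fst i - snd i) * sy c (snd i))"
  shows "g asummable_on UNIV"
proof (rule nonneg_bdd_above_summable_on)
  note v = l2b_of_weight[OF V]
  show "bdd_above (sum (\<lambda>i. cmod (g i)) ` {F. F \<subseteq> UNIV \<and> finite F})"
  proof (rule bdd_aboveI2)
    fix F :: "(int \<times> int) set" assume "F \<in> {F. F \<subseteq> UNIV \<and> finite F}"
    then have "finite F" by simp
    note t = tri_pairs[OF this, of k]
    let ?v = "sy c"
    have "(\<Sum>i\<in>F. cmod (g i)) \<le> (\<Sum>i\<in>F. (jbr k + jbr (snd i)) * (?v (fst i) * ?v (k - fst i - snd i) * ?v (snd i)))"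
      by (intro sum_mono g)
    also have "\<dots> = jbr k * (\<Sum>i\<in>F. ?v (fst i) * ?v (k - fst i - snd i) * ?v (snd i))
      + (\<Sum>i\<in>F. ?v (fst i) * ?v (k - fst i - snd i) * (jbr (snd i) * ?v (snd i)))"
      unfolding sum_distrib_left sum.distrib[symmetric]
      by (intro sum.cong refl) (simp add: algebra_simps)
    also have "\<dots> \<le> jbr k * (2 * V * V * V) + 2 * V * V * V"
      using jbr_nonneg young_l1_l2_l2[OF t v(2) v(1) v(1)] young_l1_l2_l2[OF t v(2) v(1) V]
      by (intro add_mono mult_left_mono) auto
    finally show "(\<Sum>i\<in>F. cmod (g i)) \<le> jbr k * (2 * V * V * V) + 2 * V * V * V" .
  qed
qed simp

text \<open>The new variable j = k - q is the frequency at which |u|^2 enters; the inner sum over p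
  is then \<open>wsq c j\<close>.\<close>

lemma triple_sum_wsq:
  assumes "(\<lambda>i. h (k - snd i) * (c (fst i) * cnj (c (fst i + snd i - k)) * c (snd i))) asummable_on UNIV"
  shows "(\<Sum>\<^sub>\<infinity>i. h (k - snd i) * (c (fst i) * cnj (c (fst i + snd i - k)) * c (snd i)))
      = (\<Sum>\<^sub>\<infinity>j. h j * wsq c j * c (k - j))"
proof -
  let ?g = "\<lambda>i. h (k - snd i) * (c (fst i) * cnj (c (fst i + snd i - k)) * c (snd i))"
  let ?b = "\<lambda>i::int \<times> int. (snd i, k - fst i)"
  let ?f = "\<lambda>j p. h j * c (k - j) * (c p * cnj (c (p - j)))"
  have bij: "bij ?b"
    by (rule o_bij[of "\<lambda>i. (k - snd i, fst i)"]) (auto simp: fun_eq_iff)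
  have gb: "?g (?b i) = (\<lambda>(j, p). ?f j p) i" for i
    by (cases i) (simp add: mult_ac)
  have "(\<lambda>i. cmod (?g (?b i))) summable_on UNIV"
    using summable_on_reindex_bij_betw[OF bij, of "\<lambda>i. cmod (?g i)"] assms by simp
  then have s: "(\<lambda>(j, p). ?f j p) summable_on (UNIV \<times> UNIV)"
    unfolding gb using abs_summable_summable by force
  have "infsum ?g UNIV = (\<Sum>\<^sub>\<infinity>i. ?g (?b i))"
    by (rule infsum_reindex_bij_betw[OF bij, symmetric])
  also have "\<dots> = infsum (\<lambda>(j, p). ?f j p) (UNIV \<times> UNIV)" unfolding gb by simp
  also have "\<dots> = (\<Sum>\<^sub>\<infinity>j. \<Sum>\<^sub>\<infinity>p. ?f j p)"
    using infsum_Sigma'_banach[OF s] by simp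
  also have "\<dots> = (\<Sum>\<^sub>\<infinity>j. h j * wsq c j * c (k - j))"
    unfolding wsq_eq infsum_cmult_right' by (simp add: mult_ac)
  finally show ?thesis .
qed

text \<open>Identifies the double sum used by the normal form with the two sums that the weak
  formulation yields, one from the pairing with the derivative of |u|^2 and one from |u|^2
  u.\<close>

lemma (in raman) nl_formula:
  assumes V: "l2b (\<lambda>j. jbr j * sy c j) V"
  shows "nl c k = of_real \<Gamma> * (\<Sum>\<^sub>\<infinity>j. of_int j * wsq c j * c (k - j))
      + \<i> * of_real (\<gamma>1 + \<gamma>2 * of_int k) * cconv (wsq c) c k"
proof -
  let ?t = "\<lambda>i::int \<times> int. c (fst i) * cnj (c (fst i + snd i - k)) * c (snd i)"
  have t: "cmod (?t i) \<le> sy c (fst i) * sy c (k - fst i - snd i) * sy c (snd i)" for i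
  proof -
    have m: "cmod (c (fst i + snd i - k)) \<le> sy c (k - fst i - snd i)"
      using sy_ge_minus[of c "k - fst i - snd i"] by (simp add: algebra_simps)
    show ?thesis unfolding norm_mult complex_mod_cnj
      by (intro mult_mono sy_ge m mult_nonneg_nonneg sy_nonneg norm_ge_zero)
  qed
  have nn: "0 \<le> sy c (fst i) * sy c (k - fst i - snd i) * sy c (snd i)" for i
    by (simp add: sy_nonneg)
  have s1: "(\<lambda>i. of_int (k - snd i) * ?t i) asummable_on UNIV"
  proof (rule triple_abs_summable[OF V])
    fix i :: "int \<times> int"
    have "\<bar>of_int (k - snd i)\<bar> \<le> jbr k + jbr (snd i)" by (simp add: jbr_def bracket_def)
    then show "cmod (of_int (k - snd i) * ?t i) \<le> (jbr k + jbr (snd i)) * (sy c (fst i) * sy c (k - fst i - snd i) * sy c (snd i))"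
      using t[of i] unfolding norm_mult[of "of_int _"] norm_of_int
      by (intro mult_mono) (auto simp: jbr_nonneg)
  qed
  have s2: "(\<lambda>i. 1 * ?t i) asummable_on UNIV"
  proof (rule triple_abs_summable[OF V])
    fix i :: "int \<times> int"
    have "1 \<le> jbr k + jbr (snd i)" using jbr_ge1[of k] jbr_nonneg[of "snd i"] by linarith
    then have "1 * cmod (?t i) \<le> (jbr k + jbr (snd i)) * (sy c (fst i) * sy c (k - fst i - snd i) * sy c (snd i))"
      using t[of i] by (intro mult_mono) auto
    then show "cmod (1 * ?t i) \<le> (jbr k + jbr (snd i)) * (sy c (fst i) * sy c (k - fst i - snd i) * sy c (snd i))"
      by simp
  qed
  note S = abs_summable_summable[OF s1] abs_summable_summable[OF s2]
  have "nl c k = (\<Sum>\<^sub>\<infinity>i. of_real \<Gamma> * (of_int (k - snd i) * ?t i) + \<i> * of_real (\<gamma>1 + \<gamma>2 * of_int k) * (1 * ?t i))"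
    unfolding nl_def
  proof (rule infsum_cong)
    fix i :: "int \<times> int"
    have "nlw k (snd i) = of_real \<Gamma> * of_int (k - snd i) + \<i> * of_real (\<gamma>1 + \<gamma>2 * of_int k)"
      unfolding nlw_def by (simp add: complex_eq_iff)
    then show "nlt c k i = of_real \<Gamma> * (of_int (k - snd i) * ?t i) + \<i> * of_real (\<gamma>1 + \<gamma>2 * of_int k) * (1 * ?t i)"
      unfolding nlt_def by (simp add: distrib_right mult.assoc)
  qed
  also have "\<dots> = of_real \<Gamma> * (\<Sum>\<^sub>\<infinity>i. of_int (k - snd i) * ?t i) + \<i> * of_real (\<gamma>1 + \<gamma>2 * of_int k) * (\<Sum>\<^sub>\<infinity>i. 1 * ?t i)"
    using S by (subst infsum_add) (auto intro!: summable_on_cmult_right simp only: infsum_cmult_right)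
  also have "(\<Sum>\<^sub>\<infinity>i. of_int (k - snd i) * ?t i) = (\<Sum>\<^sub>\<infinity>j. of_int j * wsq c j * c (k - j))"
    using triple_sum_wsq[of "of_int" k c] s1 by simp
  also have "(\<Sum>\<^sub>\<infinity>i. 1 * ?t i) = cconv (wsq c) c k"
    using triple_sum_wsq[of "\<lambda>_. 1" k c] s2 by (simp add: cconv_def)
  finally show ?thesis .
qed

subsection \<open>Smooth functions of time\<close>

text \<open>Functions of class C^n in time; the recursion runs parallel to that of
  \<open>C_k\<close>, so that test functions with separated variables are handled by one
  induction.\<close>

primrec Dn :: "nat \<Rightarrow> (real \<Rightarrow> real) \<Rightarrow> bool" where
  "Dn 0 f \<longleftrightarrow> continuous_on UNIV f"
| "Dn (Suc n) f \<longleftrightarrow> (\<exists>f'. (\<forall>t. (f has_real_derivative f' t) (at t)) \<and> Dn n f')"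

lemma Dn_SucI: "(\<And>t. (f has_real_derivative f' t) (at t)) \<Longrightarrow> Dn n f' \<Longrightarrow> Dn (Suc n) f"
  by auto

lemma Dn_continuous: "Dn n f \<Longrightarrow> continuous_on UNIV f"
proof (cases n)
  case (Suc m)
  assume "Dn n f"
  then obtain f' where "\<And>t. (f has_real_derivative f' t) (at t)" using Suc by auto
  then show ?thesis by (meson DERIV_isCont continuous_at_imp_continuous_on)
qed simp

lemma Dn_Suc: "Dn (Suc n) f \<Longrightarrow> Dn n f"
proof (induction n arbitrary: f)
  case 0
  then show ?case using Dn_continuous by fastforce
next
  case (Suc n)
  then show ?case by (metis Dn.simps(2))
qed

lemma Dn_add: "Dn n f \<Longrightarrow> Dn n g \<Longrightarrow> Dn n (\<lambda>t. f t + g t)"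
proof (induction n arbitrary: f g)
  case (Suc n)
  then obtain f' g' where "\<forall>t. (f has_real_derivative f' t) (at t)" "Dn n f'"
    "\<forall>t. (g has_real_derivative g' t) (at t)" "Dn n g'" by auto
  then show ?case using Suc.IH[of f' g'] by (auto intro!: exI[of _ "\<lambda>t. f' t + g' t"] DERIV_add)
qed (auto intro: continuous_intros)

lemma Dn_mult: "Dn n f \<Longrightarrow> Dn n g \<Longrightarrow> Dn n (\<lambda>t. f t * g t)"
proof (induction n arbitrary: f g)
  case (Suc n)
  then obtain f' g' where d: "\<forall>t. (f has_real_derivative f' t) (at t)" "Dn n f'"
    "\<forall>t. (g has_real_derivative g' t) (at t)" "Dn n g'" by auto
  have "Dn n (\<lambda>t. f' t * g t + f t * g' t)"
    by (rule Dn_add[OF Suc.IH[OF d(2) Dn_Suc[OF Suc.prems(2)]] Suc.IH[OF Dn_Suc[OF Suc.prems(1)] d(4)]])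
  then show ?case using d
    by (auto intro!: exI[of _ "\<lambda>t. f' t * g t + f t * g' t"] derivative_eq_intros)
qed (auto intro: continuous_intros)

lemma Dn_const: "Dn n (\<lambda>t. c)"
proof (induction n arbitrary: c)
  case (Suc n)
  then show ?case by (auto intro!: exI[of _ "\<lambda>t. 0"])
qed simp

lemma Dn_affine: "Dn n f \<Longrightarrow> Dn n (\<lambda>t. f (r * t + d))"
proof (induction n arbitrary: f)
  case 0
  then show ?case by (auto intro!: continuous_intros continuous_on_compose2[of UNIV f])
next
  case (Suc n)
  then obtain f' where d: "\<forall>t. (f has_real_derivative f' t) (at t)" "Dn n f'" by auto
  have D1: "Dn n (\<lambda>t. f' (r * t + d) * r)" by (rule Dn_mult[OF Suc.IH[OF d(2)] Dn_const])
  have D2: "((\<lambda>t. f (r * t + d)) has_real_derivative f' (r * t + d) * r) (at t)" for t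
    by (rule DERIV_chain2[OF d(1)[rule_format]]) (auto intro!: derivative_eq_intros)
  show ?case by (rule Dn_SucI[OF D2 D1])
qed

text \<open>Up to linear combinations this family is stable under differentiation, and all its
  members tend to 0 at the origin; smoothness therefore follows by induction on the order, with no
  formula for higher derivatives.\<close>

definition hflat :: "nat \<Rightarrow> real \<Rightarrow> real" where
  "hflat m x = (if x > 0 then exp (- (1 / x)) / x ^ m else 0)"

lemma hflat_tendsto_0: "(hflat m \<longlongrightarrow> 0) (at 0)"
proof -
  have "((\<lambda>y::real. y ^ m / exp y) \<longlongrightarrow> 0) at_top" by (rule tendsto_power_div_exp_0)
  from filterlim_compose[OF this filterlim_inverse_at_top_right]
  have "((\<lambda>x::real. inverse x ^ m / exp (inverse x)) \<longlongrightarrow> 0) (at_right 0)" .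
  moreover have "\<forall>\<^sub>F x in at_right 0. inverse x ^ m / exp (inverse x) = hflat m x"
    using eventually_at_right_less[of "0::real"]
    by eventually_elim (simp add: hflat_def exp_minus field_simps)
  ultimately have "(hflat m \<longlongrightarrow> 0) (at_right 0)" by (rule Lim_transform_eventually)
  moreover have "(hflat m \<longlongrightarrow> 0) (at_left 0)"
    by (rule tendsto_eventually) (auto simp: hflat_def eventually_at_filter)
  ultimately show ?thesis by (simp add: filterlim_split_at)
qed

lemma hflat_deriv: "(hflat m has_real_derivative (- real m) * hflat (m + 1) x + hflat (m + 2) x) (at x)"
proof -
  consider "x > 0" | "x < 0" | "x = 0" by linarith
  then show ?thesis
  proof cases
    case 1
    have "((\<lambda>x. exp (- (1 / x)) / x ^ m) has_real_derivative
        (- real m) * hflat (m + 1) x + hflat (m + 2) x) (at x)"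
      using 1
      by (auto intro!: derivative_eq_intros simp: hflat_def)
         (cases m; simp add: field_simps power2_eq_square)
    then show ?thesis
      by (rule has_field_derivative_transform_within_open[of _ _ _ "{0<..}"]) (use 1 in \<open>auto simp: hflat_def\<close>)
  next
    case 2
    have "((\<lambda>x. 0) has_real_derivative 0) (at x)" by simp
    then have "(hflat m has_real_derivative 0) (at x)"
      by (rule has_field_derivative_transform_within_open[of _ _ _ "{..<0}"]) (use 2 in \<open>auto simp: hflat_def\<close>)
    then show ?thesis using 2 by (simp add: hflat_def)
  next
    case 3
    have "(\<lambda>h. (hflat m (0 + h) - hflat m 0) / h) = hflat (m + 1)"
      by (auto simp: hflat_def fun_eq_iff)
    then have "(hflat m has_real_derivative 0) (at 0)"
      unfolding DERIV_def using hflat_tendsto_0[of "m + 1"] by simp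
    then show ?thesis using 3 by (simp add: hflat_def)
  qed
qed

lemma Dn_hflat: "Dn n (hflat m)"
proof (induction n arbitrary: m)
  case 0
  show ?case using hflat_deriv by (auto intro!: DERIV_continuous_on simp: has_field_derivative_at_within)
next
  case (Suc n)
  have "Dn n (\<lambda>x. (- real m) * hflat (m + 1) x + hflat (m + 2) x)"
    by (rule Dn_add[OF Dn_mult[OF Dn_const Suc.IH] Suc.IH])
  then show ?case by (rule Dn_SucI[OF hflat_deriv])
qed

lemma hflat_pos: "0 < x \<Longrightarrow> 0 < hflat m x" and hflat_zero: "x \<le> 0 \<Longrightarrow> hflat m x = 0"
  and hflat_nonneg: "0 \<le> hflat m x"
  by (simp_all add: hflat_def)

lemma bump_exists:
  fixes a b :: real
  shows "\<exists>g. (\<forall>n. Dn n g) \<and> (\<forall>t. a < t \<longrightarrow> t < b \<longrightarrow> 0 < g t) \<and> (\<forall>t. t \<le> a \<or> b \<le> t \<longrightarrow> g t = 0) \<and> (\<forall>t. 0 \<le> g t)"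
proof (intro exI conjI allI impI)
  fix n t
  let ?g = "\<lambda>t. hflat 0 (1 * t + (- a)) * hflat 0 ((- 1) * t + b)"
  show "Dn n ?g" by (rule Dn_mult[OF Dn_affine[OF Dn_hflat] Dn_affine[OF Dn_hflat]])
  show "0 < ?g t" if "a < t" "t < b" using that by (intro mult_pos_pos hflat_pos) auto
  show "?g t = 0" if "t \<le> a \<or> b \<le> t"
    using that hflat_zero[of "1 * t + (- a)"] hflat_zero[of "(- 1) * t + b"] by auto
  show "0 \<le> ?g t" by (intro mult_nonneg_nonneg hflat_nonneg)
qed

text \<open>A smooth step: G is constant on either side of [a, b], and its derivative g is a bump in
  between. In the weak formulation g localises at a chosen time, while G can be shifted by a
  constant so as to vanish near the open end of the time interval.\<close>

definition step_fun :: "real \<Rightarrow> real \<Rightarrow> (real \<Rightarrow> real) \<Rightarrow> (real \<Rightarrow> real) \<Rightarrow> bool" where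
  "step_fun a b G g \<longleftrightarrow> (\<forall>n. Dn n G) \<and> (\<forall>t. (G has_real_derivative g t) (at t)) \<and>
     (\<forall>t. a < t \<longrightarrow> t < b \<longrightarrow> 0 < g t) \<and> (\<forall>t. t \<le> a \<or> b \<le> t \<longrightarrow> g t = 0) \<and> (\<forall>t. 0 \<le> g t) \<and>
     continuous_on UNIV g \<and> (\<forall>s t. s \<le> a \<longrightarrow> t \<le> a \<longrightarrow> G s = G t) \<and> (\<forall>s t. b \<le> s \<longrightarrow> b \<le> t \<longrightarrow> G s = G t)"

lemma step_fun_exists: "\<exists>G g. step_fun a b G g"
proof -
  obtain g where g: "\<And>n. Dn n g" "\<And>t. a < t \<Longrightarrow> t < b \<Longrightarrow> 0 < g t"
    "\<And>t. t \<le> a \<or> b \<le> t \<Longrightarrow> g t = 0" "\<And>t. 0 \<le> g t"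
    using bump_exists[of a b] by blast
  have gc: "continuous_on UNIV g" using g(1)[of 0] by simp
  obtain G where "\<forall>x. (G has_vector_derivative g x) (at x)"
    using einterval_antiderivative[of "- \<infinity>" \<infinity> g] gc by (auto simp: continuous_on_eq_continuous_at)
  then have G: "(G has_real_derivative g t) (at t)" for t
    by (simp add: has_real_derivative_iff_has_vector_derivative)
  have D: "Dn n G" for n
    by (rule Dn_Suc[OF Dn_SucI[OF G g(1)]])
  have c1: "G s = G t" if "s \<le> a" "t \<le> a" for s t
  proof -
    have "\<And>x. x \<in> {..a} \<Longrightarrow> (G has_field_derivative 0) (at x within {..a})"
      using G g(3) by (metis atMost_iff has_field_derivative_at_within)
    from has_field_derivative_zero_constant[OF _ this] show ?thesis using that by force
  qed
  have c2: "G s = G t" if "b \<le> s" "b \<le> t" for s t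
  proof -
    have "\<And>x. x \<in> {b..} \<Longrightarrow> (G has_field_derivative 0) (at x within {b..})"
      using G g(3) by (metis atLeast_iff has_field_derivative_at_within)
    from has_field_derivative_zero_constant[OF _ this] show ?thesis using that by force
  qed
  have "step_fun a b G g"
    unfolding step_fun_def by (intro conjI allI impI; (rule D G g gc c1 c2)?; assumption?)
  then show ?thesis by blast
qed

section \<open>Test functions with separated variables\<close>

lemma continuous_separated:
  assumes "continuous_on UNIV \<eta>"
  shows "continuous_on UNIV (\<lambda>(t, x). complex_of_real (\<eta> t) * (a * ek m x))"
  unfolding case_prod_beta
  by (intro continuous_intros continuous_on_compose2[OF assms] continuous_on_compose2[OF continuous_ek[of UNIV]]) auto

lemma separated_derivatives:
  assumes "\<And>t. (\<eta> has_real_derivative \<eta>' t) (at t)"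
  shows "((\<lambda>t. of_real (\<eta> t) * (a * ek m x)) has_vector_derivative of_real (\<eta>' t) * (a * ek m x)) (at t)"
    "((\<lambda>x. of_real (\<eta> t) * (a * ek m x)) has_vector_derivative of_real (\<eta> t) * ((a * (\<i> * of_int m)) * ek m x)) (at x)"
  using has_vector_derivative_mult_right[OF has_vector_derivative_mult_right[OF ek_deriv[of m x UNIV], of a], of "of_real (\<eta> t)"]
  by (auto simp: mult.assoc intro!: has_vector_derivative_mult_left has_vector_derivative_of_real assms)

lemma partial_separated:
  assumes "\<And>t. (\<eta> has_real_derivative \<eta>' t) (at t)"
  shows "partial_t (\<lambda>t x. of_real (\<eta> t) * (a * ek m x)) = (\<lambda>t x. of_real (\<eta>' t) * (a * ek m x))"
    "partial_x (\<lambda>t x. of_real (\<eta> t) * (a * ek m x)) = (\<lambda>t x. of_real (\<eta> t) * ((a * (\<i> * of_int m)) * ek m x))"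
proof -
  show "partial_t (\<lambda>t x. of_real (\<eta> t) * (a * ek m x)) = (\<lambda>t x. of_real (\<eta>' t) * (a * ek m x))"
    unfolding partial_t_def by (intro ext vector_derivative_at separated_derivatives(1)[OF assms])
  show "partial_x (\<lambda>t x. of_real (\<eta> t) * (a * ek m x)) = (\<lambda>t x. of_real (\<eta> t) * ((a * (\<i> * of_int m)) * ek m x))"
    unfolding partial_x_def by (intro ext vector_derivative_at separated_derivatives(2)[OF assms])
qed

text \<open>Both partial derivatives of a separated function have the same form, with \<eta>
  replaced by its derivative or \<open>a\<close> multiplied by i m; this is why a general constant
  \<open>a\<close> is carried along.\<close>

lemma C_k_separated:
  "Dn n \<eta> \<Longrightarrow> C_k n (\<lambda>t x. of_real (\<eta> t) * (a * ek m x))"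
proof (induction n arbitrary: \<eta> a)
  case 0
  then show ?case using continuous_separated by simp
next
  case (Suc n)
  then obtain \<eta>' where d: "\<And>t. (\<eta> has_real_derivative \<eta>' t) (at t)" "Dn n \<eta>'" by auto
  show ?case
    unfolding C_k.simps partial_separated[OF d(1)]
    using continuous_separated[OF Dn_continuous[OF Suc.prems]] Suc.IH d(2) Dn_Suc[OF Suc.prems]
      differentiableI_vector[OF separated_derivatives(1)[OF d(1)]]
      differentiableI_vector[OF separated_derivatives(2)[OF d(1)]] by blast
qed

subsection \<open>Fubini for the completed product measure\<close>

text \<open>Lebesgue measure on the plane is the completion of the product measure, so Fubini is
  applied to a Borel representative h', chosen for real and imaginary part separately. For almost
  every t the sections of h and h' agree almost everywhere; the measurability assumed of h along
  sections allows the return to h.\<close>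

lemma lebesgue_prod_integral:
  fixes h :: "real \<times> real \<Rightarrow> complex"
  assumes i: "integrable lebesgue h"
    and m: "\<And>t. (\<lambda>x. h (t, x)) \<in> borel_measurable lebesgue"
    and m2: "(\<lambda>t. LINT x|lebesgue. h (t, x)) \<in> borel_measurable lebesgue"
  shows "integral\<^sup>L lebesgue h = (LINT t|lebesgue. LINT x|lebesgue. h (t, x))"
proof -
  have hm: "h \<in> borel_measurable lebesgue" using i by (rule borel_measurable_integrable)
  obtain hr where hr: "hr \<in> borel_measurable lborel" "AE z in lborel. Re (h z) = hr z"
    using completion_ex_borel_measurable_real[OF measurable_compose[OF hm borel_measurable_Re]] by blast
  obtain hi where hi: "hi \<in> borel_measurable lborel" "AE z in lborel. Im (h z) = hi z"
    using completion_ex_borel_measurable_real[OF measurable_compose[OF hm borel_measurable_Im]] by blast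
  define h' where "h' z = of_real (hr z) + \<i> * of_real (hi z)" for z
  have cr: "complex_of_real \<in> borel_measurable borel"
    by (rule borel_measurable_continuous_onI) (intro continuous_intros)
  have h'm: "h' \<in> borel_measurable lborel"
    unfolding h'_def
    by (intro borel_measurable_add borel_measurable_times borel_measurable_const
      measurable_compose[OF hr(1) cr] measurable_compose[OF hi(1) cr])
  have ae: "AE z in lborel. h z = h' z"
    using hr(2) hi(2) by eventually_elim (simp add: h'_def complex_eq_iff)
  have aec: "AE z in lebesgue. h z = h' z" using ae by (rule AE_completion)
  have h'c: "h' \<in> borel_measurable lebesgue" using h'm by (rule measurable_completion)
  have "integrable lebesgue h'" using integrable_cong_AE_imp[OF i h'c] aec by (auto simp: eq_commute)
  then have il: "integrable lborel h'" using integrable_completion[OF h'm] by simp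
  then have ip: "integrable (lborel \<Otimes>\<^sub>M lborel) h'" by (simp add: lborel_prod)
  have h'p: "h' \<in> borel_measurable (lborel \<Otimes>\<^sub>M lborel)" using h'm by (simp add: lborel_prod)
  have h't: "(\<lambda>x. h' (t, x)) \<in> borel_measurable lborel" for t
    using measurable_compose_Pair1[OF _ h'p, of t] by simp
  have h'2: "(\<lambda>t. LINT x|lborel. h' (t, x)) \<in> borel_measurable lborel"
    using lborel_pair.integrable_fst'[OF ip] by (rule borel_measurable_integrable)
  have aep: "AE t in lborel. AE x in lborel. h (t, x) = h' (t, x)"
  proof (rule lborel_pair.AE_pair)
    have "lborel \<Otimes>\<^sub>M lborel = (lborel :: (real \<times> real) measure)" by (rule lborel_prod)
    then show "AE z in lborel \<Otimes>\<^sub>M lborel. h z = h' z" using ae by (simp only:)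
  qed
  have inner: "AE t in lborel. (LINT x|lebesgue. h (t, x)) = (LINT x|lborel. h' (t, x))"
    using aep
  proof eventually_elim
    case (elim t)
    have "(LINT x|lebesgue. h (t, x)) = (LINT x|lebesgue. h' (t, x))"
      by (rule integral_cong_AE[OF m measurable_completion[OF h't] AE_completion[OF elim]])
    also have "\<dots> = (LINT x|lborel. h' (t, x))" by (rule integral_completion[OF h't])
    finally show ?case .
  qed
  have "integral\<^sup>L lebesgue h = integral\<^sup>L lebesgue h'" by (rule integral_cong_AE[OF hm h'c aec])
  also have "\<dots> = integral\<^sup>L (lborel \<Otimes>\<^sub>M lborel) h'" by (simp add: integral_completion[OF h'm] lborel_prod)
  also have "\<dots> = (LINT t|lborel. LINT x|lborel. h' (t, x))"
    by (rule lborel_pair.integral_fst'[OF ip, symmetric])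
  also have "\<dots> = (LINT t|lebesgue. LINT x|lborel. h' (t, x))"
    by (rule integral_completion[OF h'2, symmetric])
  also have "\<dots> = (LINT t|lebesgue. LINT x|lebesgue. h (t, x))"
    by (rule integral_cong_AE[OF measurable_completion[OF h'2] m2])
       (use AE_completion[OF inner] in \<open>auto simp: eq_commute\<close>)
  finally show ?thesis .
qed

text \<open>Covers [0, T) and (-T, 0] at once. Integrals over J may be replaced by integrals over
  the closed interval, on which the coefficient functions are continuous.\<close>

locale time_interval =
  fixes J :: "real set" and lo hi :: real
  assumes lohi: "lo < hi" and J_lower: "{lo<..<hi} \<subseteq> J" and J_upper: "J \<subseteq> {lo..hi}"
    and J_sets: "J \<in> sets borel"
begin

lemma J_lebesgue [simp]: "J \<in> sets lebesgue"
  using J_sets by simp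

lemma J_almost: "AE t in lebesgue. (t \<in> J) = (t \<in> {lo..hi})"
proof -
  have "AE t in lebesgue. t \<noteq> lo" "AE t in lebesgue. t \<noteq> hi"
    by (auto intro!: AE_completion AE_lborel_singleton)
  then show ?thesis
    by eventually_elim (use J_lower J_upper in \<open>auto simp: less_le\<close>)
qed

lemma lint_J:
  fixes G :: "real \<Rightarrow> complex"
  assumes G: "continuous_on {lo..hi} G"
  shows "(\<lambda>t. indicat_real J t *\<^sub>R G t) \<in> borel_measurable lebesgue"
    "(LINT t:J|lebesgue. G t) = integral {lo..hi} G"
proof -
  have Gi: "set_integrable lebesgue {lo..hi} G" by (rule absolutely_integrable_continuous_real[OF G])
  then have Gm: "(\<lambda>t. indicat_real {lo..hi} t *\<^sub>R G t) \<in> borel_measurable lebesgue"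
    unfolding set_integrable_def by (rule borel_measurable_integrable)
  have "(\<lambda>t. indicat_real J t *\<^sub>R (indicat_real {lo..hi} t *\<^sub>R G t)) \<in> borel_measurable lebesgue"
    by (intro borel_measurable_scaleR Gm borel_measurable_indicator J_lebesgue)
  moreover have eq: "(\<lambda>t. indicat_real J t *\<^sub>R (indicat_real {lo..hi} t *\<^sub>R G t)) = (\<lambda>t. indicat_real J t *\<^sub>R G t)"
    using J_upper by (auto simp: indicator_def fun_eq_iff)
  ultimately show Jm: "(\<lambda>t. indicat_real J t *\<^sub>R G t) \<in> borel_measurable lebesgue" by simp
  have "(LINT t:J|lebesgue. G t) = (LINT t:{lo..hi}|lebesgue. G t)"
    unfolding set_lebesgue_integral_def
  proof (rule integral_cong_AE[OF Jm Gm])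
    show "AE t in lebesgue. indicat_real J t *\<^sub>R G t = indicat_real {lo..hi} t *\<^sub>R G t"
      using J_almost by eventually_elim (auto simp: indicator_def)
  qed
  also have "\<dots> = integral {lo..hi} G" using Gi by (rule set_lebesgue_integral_eq_integral(2))
  finally show "(LINT t:J|lebesgue. G t) = integral {lo..hi} G" .
qed

lemma fubini_J:
  fixes g :: "real \<Rightarrow> real \<Rightarrow> complex"
  assumes i: "set_integrable lebesgue (J \<times> torus) (\<lambda>(t, x). g t x)"
    and m: "\<And>t. t \<in> J \<Longrightarrow> set_borel_measurable lebesgue torus (g t)"
    and G: "\<And>t. t \<in> J \<Longrightarrow> (LINT x:torus|lebesgue. g t x) = G t" "continuous_on {lo..hi} G"
  shows "set_lebesgue_integral lebesgue (J \<times> torus) (\<lambda>(t, x). g t x) = integral {lo..hi} G"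
proof -
  let ?h = "\<lambda>z. indicat_real (J \<times> torus) z *\<^sub>R (case z of (t, x) \<Rightarrow> g t x)"
  have h: "?h (t, x) = indicat_real J t *\<^sub>R (indicat_real torus x *\<^sub>R g t x)" for t x
    by (simp add: indicator_def)
  have inner: "(LINT x|lebesgue. ?h (t, x)) = indicat_real J t *\<^sub>R G t" for t
  proof (cases "t \<in> J")
    case True
    then show ?thesis using G(1)[of t] unfolding h set_lebesgue_integral_def by simp
  qed (simp add: h)
  have "set_lebesgue_integral lebesgue (J \<times> torus) (\<lambda>(t, x). g t x) = integral\<^sup>L lebesgue ?h"
    by (simp add: set_lebesgue_integral_def)
  also have "\<dots> = (LINT t|lebesgue. LINT x|lebesgue. ?h (t, x))"
  proof (rule lebesgue_prod_integral)
    show "integrable lebesgue ?h" using i by (simp add: set_integrable_def)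
    show "(\<lambda>x. ?h (t, x)) \<in> borel_measurable lebesgue" for t
      using m[of t] unfolding h set_borel_measurable_def by (cases "t \<in> J") auto
    show "(\<lambda>t. LINT x|lebesgue. ?h (t, x)) \<in> borel_measurable lebesgue"
      unfolding inner by (rule lint_J(1)[OF G(2)])
  qed
  also have "\<dots> = (LINT t:J|lebesgue. G t)" unfolding inner set_lebesgue_integral_def ..
  also have "\<dots> = integral {lo..hi} G" by (rule lint_J(2)[OF G(2)])
  finally show ?thesis .
qed

text \<open>Meant for v = u and v = |u|^2 u, both at most 1 + |u|^3 in modulus, which is integrable
  over the compact time support of the test function.\<close>

lemma dominated_integrable:
  fixes v \<psi> :: "real \<times> real \<Rightarrow> complex" and w :: "real \<times> real \<Rightarrow> real"
  assumes vm: "set_borel_measurable lebesgue (J \<times> torus) v"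
    and dom: "\<And>z. cmod (v z) \<le> 1 + w z"
    and K: "compact K" "K \<subseteq> J" and w: "set_integrable lebesgue (K \<times> torus) w"
    and \<psi>: "continuous_on UNIV \<psi>" "\<And>t x. t \<in> J - K \<Longrightarrow> \<psi> (t, x) = 0"
  shows "set_integrable lebesgue (J \<times> torus) (\<lambda>z. v z * \<psi> z)"
proof -
  have cK: "compact (K \<times> torus)" using K(1) by (intro compact_Times compact_Icc)
  have "bounded (\<psi> ` (K \<times> torus))"
    using compact_continuous_image[OF continuous_on_subset[OF \<psi>(1)] cK] compact_imp_bounded by blast
  then obtain B where B: "\<And>z. z \<in> K \<times> torus \<Longrightarrow> cmod (\<psi> z) \<le> B" unfolding bounded_iff by force
  have "K \<times> torus \<in> lmeasurable" using cK by (rule lmeasurable_compact)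
  then have one: "set_integrable lebesgue (K \<times> torus) (\<lambda>z. 1 :: real)"
    unfolding set_integrable_def real_scaleR_def mult_1_right lmeasurable_iff_integrable .
  have "set_integrable lebesgue (K \<times> torus) (\<lambda>z. B * (1 + w z))"
    by (intro set_integrable_mult_right set_integral_add(1) one w)
  then have D: "integrable lebesgue (\<lambda>z. indicat_real (K \<times> torus) z *\<^sub>R (B * (1 + w z)))"
    unfolding set_integrable_def .
  have \<psi>m: "\<psi> \<in> borel_measurable lebesgue"
    using \<psi>(1) by (intro measurable_completion) (simp add: borel_measurable_continuous_onI)
  show ?thesis unfolding set_integrable_def
  proof (rule Bochner_Integration.integrable_bound[OF D])
    have "(\<lambda>z. (indicat_real (J \<times> torus) z *\<^sub>R v z) * \<psi> z) \<in> borel_measurable lebesgue"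
      using vm \<psi>m unfolding set_borel_measurable_def by (rule borel_measurable_times)
    then show "(\<lambda>z. indicat_real (J \<times> torus) z *\<^sub>R (v z * \<psi> z)) \<in> borel_measurable lebesgue"
      unfolding mult_scaleR_left .
    show "AE z in lebesgue. norm (indicat_real (J \<times> torus) z *\<^sub>R (v z * \<psi> z)) \<le> norm (indicat_real (K \<times> torus) z *\<^sub>R (B * (1 + w z)))"
    proof (rule AE_I2)
      fix z :: "real \<times> real"
      obtain t x where z: "z = (t, x)" by (cases z)
      consider "z \<in> K \<times> torus" | "z \<notin> J \<times> torus" | "t \<in> J - K" using z by auto
      then show "norm (indicat_real (J \<times> torus) z *\<^sub>R (v z * \<psi> z)) \<le> norm (indicat_real (K \<times> torus) z *\<^sub>R (B * (1 + w z)))"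
      proof cases
        case 1
        then have zJ: "z \<in> J \<times> torus" using K(2) by auto
        have B0: "0 \<le> B" using B[OF 1] norm_ge_zero order_trans by blast
        have w0: "0 \<le> 1 + w z" using dom[of z] norm_ge_zero order_trans by blast
        have "cmod (v z) * cmod (\<psi> z) \<le> (1 + w z) * B"
          by (rule mult_mono[OF dom B[OF 1] w0]) simp
        then show ?thesis using 1 zJ B0 w0 by (simp add: norm_mult abs_mult mult.commute)
      next
        case 3
        then show ?thesis using \<psi>(2) z by simp
      qed simp
    qed
  qed
qed

end

subsection \<open>From the weak formulation to ordinary differential equations\<close>

text \<open>The candidate A solves A' = F with A 0 = a0. Integration by parts shows that D = a - A
  is annihilated by the derivative of every admissible test function, and at an interior time with D
  nonzero a step whose derivative is a small bump gives a contradiction. \<open>P\<close> encodes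
  admissibility at the ends: \<open>bd\<close> evaluates the boundary terms, and
  \<open>steps\<close> says that every step becomes admissible after adding a constant.\<close>

lemma dubois_reymond:
  fixes a F :: "real \<Rightarrow> complex" and P :: "(real \<Rightarrow> real) \<Rightarrow> bool"
  assumes lohi: "lo < hi" and z: "0 \<in> {lo..hi}"
    and a: "continuous_on {lo..hi} a" and F: "continuous_on {lo..hi} F"
    and weak: "\<And>\<eta> \<eta>'. (\<And>n. Dn n \<eta>) \<Longrightarrow> (\<And>t. (\<eta> has_real_derivative \<eta>' t) (at t)) \<Longrightarrow>
        continuous_on UNIV \<eta>' \<Longrightarrow> P \<eta> \<Longrightarrow>
        - integral {lo..hi} (\<lambda>t. of_real (\<eta>' t) * a t) - of_real (e * \<eta> 0) * a0
          = integral {lo..hi} (\<lambda>t. of_real (\<eta> t) * F t)"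
    and bd: "\<And>\<eta> A. P \<eta> \<Longrightarrow> of_real (\<eta> hi) * A hi - of_real (\<eta> lo) * A lo = - of_real (e * \<eta> 0) * (A 0 :: complex)"
    and steps: "\<And>\<alpha> \<beta> G. lo < \<alpha> \<Longrightarrow> \<alpha> < \<beta> \<Longrightarrow> \<beta> < hi \<Longrightarrow> (\<And>s t. s \<le> \<alpha> \<Longrightarrow> t \<le> \<alpha> \<Longrightarrow> G s = G t) \<Longrightarrow>
        (\<And>s t. \<beta> \<le> s \<Longrightarrow> \<beta> \<le> t \<Longrightarrow> G s = G t) \<Longrightarrow> \<exists>d. P (\<lambda>t. G t + d)"
    and t: "t \<in> {lo..hi}"
  shows "(a has_vector_derivative F t) (at t within {lo..hi})" "a 0 = a0"
proof -
  define A where "A t = a0 + (integral {lo..t} F - integral {lo..0} F)" for t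
  have A0: "A 0 = a0" by (simp add: A_def)
  have dA: "(A has_vector_derivative F t) (at t within {lo..hi})" if "t \<in> {lo..hi}" for t
    unfolding A_def using integral_has_vector_derivative[OF F that]
    by (auto intro!: derivative_eq_intros)
  have cA: "continuous_on {lo..hi} A" using dA by (rule continuous_on_vector_derivative)
  define D where "D t = a t - A t" for t
  have cD: "continuous_on {lo..hi} D" unfolding D_def by (intro continuous_intros a cA)
  have D0: "D t1 = 0" if t1: "t1 \<in> {lo<..<hi}" for t1
  proof (rule ccontr)
    assume nz: "D t1 \<noteq> 0"
    \<comment> \<open>Projection onto the direction of \<open>D t1\<close> gives a real function
      that is positive near \<open>t1\<close>.\<close>
    define f where "f t = Re (cnj (D t1) * D t)" for t
    have cf: "continuous_on {lo..hi} f" unfolding f_def by (intro continuous_intros cD)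
    have "f t1 = (cmod (D t1))\<^sup>2" unfolding f_def by (simp add: cmod_power2) (simp add: power2_eq_square)
    then have f1: "0 < f t1" using nz by simp
    obtain d where d: "d > 0" "\<And>s. s \<in> {lo..hi} \<Longrightarrow> dist s t1 < d \<Longrightarrow> dist (f s) (f t1) < f t1"
      using cf t1 f1 unfolding continuous_on_iff by (metis atLeastAtMost_iff greaterThanLessThan_iff less_imp_le)
    define r where "r = min (d / 2) (min ((t1 - lo) / 2) ((hi - t1) / 2))"
    have r: "0 < r" using d t1 by (auto simp: r_def)
    have rl: "lo < t1 - r" "t1 + r < hi" "r < d"
    proof -
      have "r \<le> (t1 - lo) / 2" "r \<le> (hi - t1) / 2" "r \<le> d / 2" unfolding r_def by linarith+
      moreover have "0 < t1 - lo" "0 < hi - t1" using t1 by auto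
      ultimately show "lo < t1 - r" "t1 + r < hi" "r < d" using d(1) by (simp_all add: field_simps)
    qed
    have fpos: "0 < f s" if "t1 - r < s" "s < t1 + r" for s
      using d(2)[of s] that rl by (auto simp: dist_real_def abs_less_iff)
    obtain G g where "step_fun (t1 - r) (t1 + r) G g" using step_fun_exists by blast
    then have g: "\<And>n. Dn n G" "\<And>t. (G has_real_derivative g t) (at t)"
      "\<And>t. t1 - r < t \<Longrightarrow> t < t1 + r \<Longrightarrow> 0 < g t" "\<And>t. t \<le> t1 - r \<or> t1 + r \<le> t \<Longrightarrow> g t = 0" "\<And>t. 0 \<le> g t"
      "continuous_on UNIV g" "\<And>s t. s \<le> t1 - r \<Longrightarrow> t \<le> t1 - r \<Longrightarrow> G s = G t"
      "\<And>s t. t1 + r \<le> s \<Longrightarrow> t1 + r \<le> t \<Longrightarrow> G s = G t"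
      unfolding step_fun_def by blast+
    have "\<exists>d. P (\<lambda>t. G t + d)" by (rule steps[OF rl(1) _ rl(2) g(7) g(8)]) (use r in auto)
    then obtain q where P: "P (\<lambda>t. G t + q)" ..
    define \<eta> where "\<eta> t = G t + q" for t
    have \<eta>d: "(\<eta> has_real_derivative g t) (at t)" for t
      unfolding \<eta>_def by (auto intro!: derivative_eq_intros g(2))
    have \<eta>D: "Dn n \<eta>" for n unfolding \<eta>_def by (rule Dn_add[OF g(1) Dn_const])
    have P\<eta>: "P \<eta>" using P unfolding \<eta>_def .
    have c\<eta>: "continuous_on {lo..hi} \<eta>" by (rule continuous_on_subset[OF Dn_continuous[OF \<eta>D[of 0]]]) simp
    have cg: "continuous_on {lo..hi} g" by (rule continuous_on_subset[OF g(6)]) simp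
    note w = weak[of \<eta> g, OF \<eta>D \<eta>d g(6) P\<eta>]
    let ?u = "\<lambda>t. complex_of_real (\<eta> t) * F t" and ?v = "\<lambda>t. complex_of_real (g t) * A t"
      and ?w = "\<lambda>t. complex_of_real (g t) * a t"
    have d\<eta>A: "((\<lambda>t. of_real (\<eta> t) * A t) has_vector_derivative (?u t + ?v t)) (at t within {lo..hi})"
      if "t \<in> {lo..hi}" for t
    proof -
      have "((\<lambda>t. complex_of_real (\<eta> t)) has_vector_derivative of_real (g t)) (at t within {lo..hi})"
        by (rule has_vector_derivative_of_real[OF has_field_derivative_at_within[OF \<eta>d]])
      from has_vector_derivative_mult[OF this dA[OF that]] show ?thesis by simp
    qed
    have "((\<lambda>t. ?u t + ?v t) has_integral (of_real (\<eta> hi) * A hi - of_real (\<eta> lo) * A lo)) {lo..hi}"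
      by (rule fundamental_theorem_of_calculus[OF less_imp_le[OF lohi] d\<eta>A])
    then have s: "integral {lo..hi} (\<lambda>t. ?u t + ?v t) = - of_real (e * \<eta> 0) * a0"
      using bd[OF P\<eta>, of A] A0 by (simp only: integral_unique)
    have i1: "?u integrable_on {lo..hi}"
      by (rule integrable_continuous_interval) (intro continuous_intros c\<eta> F)
    have i2: "?v integrable_on {lo..hi}"
      by (rule integrable_continuous_interval) (intro continuous_intros cg cA)
    have i3: "?w integrable_on {lo..hi}"
      by (rule integrable_continuous_interval) (intro continuous_intros cg a)
    have "integral {lo..hi} ?u + integral {lo..hi} ?v = - of_real (e * \<eta> 0) * a0"
      using Henstock_Kurzweil_Integration.integral_add[OF i1 i2] s by (simp only:)
    then have "integral {lo..hi} ?w - integral {lo..hi} ?v = 0"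
      unfolding w[symmetric] by (simp add: algebra_simps)
    then have "integral {lo..hi} (\<lambda>t. ?w t - ?v t) = 0"
      using Henstock_Kurzweil_Integration.integral_diff[OF i3 i2] by (simp only:)
    then have gD: "((\<lambda>t. ?w t - ?v t) has_integral 0) {lo..hi}"
      using integrable_integral[OF integrable_diff[OF i3 i2]] by (simp only:)
    have "((\<lambda>t. g t * f t) has_integral 0) {lo..hi}"
      using has_integral_linear[OF gD bounded_linear_compose[OF bounded_linear_Re bounded_linear_mult_right[of "cnj (D t1)"]]]
      by (simp add: o_def f_def D_def algebra_simps)
    then have "integral {lo..hi} (\<lambda>t. g t * f t) = 0" by (rule integral_unique)
    moreover have "continuous_on {lo..hi} (\<lambda>t. g t * f t)" by (intro continuous_intros cg cf)
    moreover have "0 \<le> g s * f s" if "s \<in> {lo..hi}" for s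
      using g(4,5)[of s] fpos[of s] by (cases "t1 - r < s \<and> s < t1 + r") auto
    ultimately have "\<forall>s\<in>{lo..hi}. g s * f s = 0"
      using integral_eq_0_iff[of lo hi "\<lambda>t. g t * f t"] lohi by auto
    then have "g t1 * f t1 = 0" using t1 by auto
    moreover have "0 < g t1" using g(3)[of t1] r by simp
    ultimately show False using f1 by simp
  qed
  have "closure {lo<..<hi} = {lo..hi}" using lohi by simp
  then have aA: "D s = 0" if "s \<in> {lo..hi}" for s
    using continuous_constant_on_closure[of "{lo<..<hi}" D 0 s] cD D0 that by auto
  show "a 0 = a0" using aA[OF z] A0 by (simp add: D_def)
  show "(a has_vector_derivative F t) (at t within {lo..hi})"
    by (rule has_vector_derivative_transform[OF t _ dA[OF t]]) (use aA in \<open>simp add: D_def\<close>)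
qed

context raman
begin

text \<open>By \<open>nl_formula\<close>, raising \<gamma>1 by 1 changes \<open>nl\<close> by
  exactly i times this convolution, and the nonlinearity is continuous for both parameter values; so
  no separate tail estimate is made. The second sum is then what is left of
  \<open>nl\<close>.\<close>

lemma cconv_wsq_continuous:
  assumes cont: "\<And>j. continuous_on I (\<lambda>t. c t j)"
    and A: "\<And>t. t \<in> I \<Longrightarrow> l2b (\<lambda>j. jbr j * cmod (c t j)) A"
  shows "continuous_on I (\<lambda>t. cconv (wsq (c t)) (c t) k)"
    "continuous_on I (\<lambda>t. \<Sum>\<^sub>\<infinity>j. of_int j * wsq (c t) j * c t (k - j))"
proof -
  interpret S: raman \<alpha>1 \<alpha>2 "\<gamma>1 + 1" \<gamma>2 \<Gamma> by unfold_locales (rule \<Gamma>_pos \<alpha>1_nz nonres)+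
  have V: "l2b (\<lambda>j. jbr j * sy (c t) j) (2 * A)" if "t \<in> I" for t
    using l2b_sy[of 1 "c t" A] A[OF that] jbr_nonneg by simp
  have d: "(S.nl (c t) k - nl (c t) k) / \<i> = cconv (wsq (c t)) (c t) k" if "t \<in> I" for t
    unfolding nl_formula[OF V[OF that]] S.nl_formula[OF V[OF that]]
    by (simp add: distrib_right field_simps)
  have "continuous_on I (\<lambda>t. (S.nl (c t) k - nl (c t) k) / \<i>)"
    by (intro continuous_intros S.nl_continuous[OF cont A] nl_continuous[OF cont A]) auto
  then show Y: "continuous_on I (\<lambda>t. cconv (wsq (c t)) (c t) k)"
    by (rule continuous_on_eq) (rule d)
  have e: "(nl (c t) k - \<i> * of_real (\<gamma>1 + \<gamma>2 * of_int k) * cconv (wsq (c t)) (c t) k) / of_real \<Gamma>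
      = (\<Sum>\<^sub>\<infinity>j. of_int j * wsq (c t) j * c t (k - j))" if "t \<in> I" for t
    unfolding nl_formula[OF V[OF that]] using \<Gamma>_pos by simp
  have "continuous_on I (\<lambda>t. (nl (c t) k - \<i> * of_real (\<gamma>1 + \<gamma>2 * of_int k) * cconv (wsq (c t)) (c t) k) / of_real \<Gamma>)"
    using \<Gamma>_pos by (intro continuous_intros nl_continuous[OF cont A] Y) auto
  then show "continuous_on I (\<lambda>t. \<Sum>\<^sub>\<infinity>j. of_int j * wsq (c t) j * c t (k - j))"
    by (rule continuous_on_eq) (rule e)
qed

lemma frep_lint_cmult:
  assumes "frep v d"
  shows "(LINT x:torus|lebesgue. v x * (r * (a * ek (- k) x))) = r * a * (of_real (2 * pi) * d k)"
proof -
  have "(LINT x:torus|lebesgue. v x * (r * (a * ek (- k) x))) = (LINT x:torus|lebesgue. (r * a) * (ek (- k) x * v x))"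
    by (simp add: mult_ac)
  also have "\<dots> = (r * a) * (LINT x:torus|lebesgue. ek (- k) x * v x)" by (rule set_integral_mult_right)
  finally show ?thesis unfolding frep_lint_ek[OF assms] .
qed

lemma frep_set_measurable: "frep v d \<Longrightarrow> set_borel_measurable lebesgue torus (\<lambda>x. v x * (r * (a * ek m x)))"
proof -
  assume v: "frep v d"
  have "(\<lambda>x. (indicat_real torus x *\<^sub>R v x) * (r * (a * ek m x))) \<in> borel_measurable lebesgue"
    using v unfolding frep_def set_borel_measurable_def
    by (intro borel_measurable_times lebesgue_ek borel_measurable_const) auto
  then show ?thesis unfolding set_borel_measurable_def mult_scaleR_left .
qed

lemma pairing_separated:
  assumes u: "frep (u t) (c t)"
  shows "pairing (dx_sq u t) (fourier (\<lambda>x. u t x * (r * (1 * ek (- k) x))))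
     = r * (of_real (2 * pi) * (\<i> * (\<Sum>\<^sub>\<infinity>j. of_int j * wsq (c t) j * c t (k - j))))"
proof -
  let ?s = "complex_of_real (sqrt (2 * pi))"
  have ss: "?s * ?s = of_real (2 * pi)" by (simp flip: of_real_mult)
  have dx: "dx_sq u t j = \<i> * of_int j * (?s * wsq (c t) j)" for j
    unfolding dx_sq_def frep_fourier[OF frep_sq[OF u]] ..
  have f: "fourier (\<lambda>x. u t x * (r * (1 * ek (- k) x))) (- j) = r * (?s * c t (k - j))" for j
  proof -
    have "ek (- (- j)) x * (u t x * (r * (1 * ek (- k) x))) = r * (ek (- (k - j)) x * u t x)" for x
    proof -
      have "ek (- (- j)) x * ek (- k) x = ek (- (k - j)) x" by (simp add: ek_mult)
      then show ?thesis by (metis (no_types, lifting) mult.assoc mult.commute mult_1_left)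
    qed
    then have "fourier (\<lambda>x. u t x * (r * (1 * ek (- k) x))) (- j) = r * fourier (u t) (k - j)"
      unfolding fourier_ek by (simp only: set_integral_mult_right mult.left_commute)
    then show ?thesis unfolding frep_fourier[OF u] .
  qed
  have "pairing (dx_sq u t) (fourier (\<lambda>x. u t x * (r * (1 * ek (- k) x))))
     = (\<Sum>\<^sub>\<infinity>j. (r * (of_real (2 * pi) * \<i>)) * (of_int j * wsq (c t) j * c t (k - j)))"
    unfolding pairing_def dx f ss[symmetric] by (intro infsum_cong) (simp add: mult_ac)
  then show ?thesis unfolding infsum_cmult_right' by (simp add: mult_ac)
qed

text \<open>Testing with \<eta>(t) exp(-ikx) and integrating in x first turns each term of the weak
  identity into a time integral for the coefficient at k, and the common factor 2 pi cancels. The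
  result is the weak form of the k-th differential equation.\<close>

lemma weak_separated:
  assumes ti: "time_interval J lo hi" and z: "0 \<in> {lo..hi}" and L3: "u \<in> L3_loc J"
    and weak: "\<And>\<phi>. \<phi> \<in> test_fun J \<Longrightarrow> weak_identity \<alpha>1 \<alpha>2 \<gamma>1 \<gamma>2 \<Gamma> J e u0 u \<phi>"
    and rep: "\<And>t. t \<in> {lo..hi} \<Longrightarrow> frep (u t) (c t)"
    and A: "\<And>t. t \<in> {lo..hi} \<Longrightarrow> l2b (\<lambda>j. jbr j * cmod (c t j)) A"
    and cont: "\<And>j. continuous_on {lo..hi} (\<lambda>t. c t j)"
    and rep0: "frep u0 c0"
    and \<eta>: "\<And>n. Dn n \<eta>" "\<And>t. (\<eta> has_real_derivative \<eta>' t) (at t)" "continuous_on UNIV \<eta>'"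
    and K: "compact K" "K \<subseteq> J" "\<And>t. t \<in> J - K \<Longrightarrow> \<eta> t = 0 \<and> \<eta>' t = 0"
  shows "- integral {lo..hi} (\<lambda>t. of_real (\<eta>' t) * c t k) - of_real (e * \<eta> 0) * c0 k
     = integral {lo..hi} (\<lambda>t. of_real (\<eta> t) * (- (\<i> * of_real (om k)) * c t k + nl (c t) k))"
proof -
  interpret time_interval J lo hi by (rule ti)
  define p where "p = complex_of_real (2 * pi)"
  have p0: "p \<noteq> 0" by (simp add: p_def)
  \<comment> \<open>Symbol of the x-derivative on exp(-ikx). With the signs that the weak
    formulation puts on the derivatives of the test function, \<open>a1\<close> turns out to be - i
    \<open>om k\<close>.\<close>
  define \<kappa> where "\<kappa> = \<i> * of_int (- k)"
  define a1 where "a1 = - of_real \<alpha>1 * (\<kappa> * \<kappa> * \<kappa>) + \<i> * of_real \<alpha>2 * (\<kappa> * \<kappa>)"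
  define a2 where "a2 = \<i> * of_real \<gamma>1 - of_real \<gamma>2 * \<kappa>"
  define Y where "Y t = cconv (wsq (c t)) (c t) k" for t
  define Z where "Z t = (\<Sum>\<^sub>\<infinity>j. of_int j * wsq (c t) j * c t (k - j))" for t
  let ?\<phi> = "\<lambda>t x. complex_of_real (\<eta> t) * (1 * ek (- k) x)"
  have JI: "t \<in> {lo..hi}" if "t \<in> J" for t using that J_upper by auto
  have cY: "continuous_on {lo..hi} Y" and cZ: "continuous_on {lo..hi} Z"
    unfolding Y_def Z_def using cconv_wsq_continuous[OF cont A] by auto
  have c\<eta>: "continuous_on {lo..hi} \<eta>" by (rule continuous_on_subset[OF Dn_continuous[OF \<eta>(1)[of 0]]]) simp
  have c\<eta>': "continuous_on {lo..hi} \<eta>'" by (rule continuous_on_subset[OF \<eta>(3)]) simp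
  have test: "?\<phi> \<in> test_fun J"
    unfolding test_fun_def mem_Collect_eq
  proof (intro conjI allI exI[of _ K])
    show "C_k n ?\<phi>" for n by (rule C_k_separated[OF \<eta>(1)])
  qed (use K in \<open>auto simp: ek_periodic\<close>)
  have um: "set_borel_measurable lebesgue (J \<times> torus) (\<lambda>(t, x). u t x)"
    and ui: "set_integrable lebesgue (K \<times> torus) (\<lambda>(t, x). (cmod (u t x)) ^ 3)"
    using L3 K unfolding L3_loc_def by auto
  define v where "v z = (case z of (t, x) \<Rightarrow> u t x)" for z
  define w where "w z = (case z of (t, x) \<Rightarrow> (cmod (u t x)) ^ 3)" for z
  have vm: "set_borel_measurable lebesgue (J \<times> torus) v" using um unfolding v_def .
  have wi: "set_integrable lebesgue (K \<times> torus) w" using ui unfolding w_def .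
  have wv: "w z = cmod (v z) ^ 3" for z by (simp add: v_def w_def case_prod_beta)
  have v1: "cmod (v z) \<le> 1 + w z" for z
  proof (cases "cmod (v z) \<le> 1")
    case True
    then show ?thesis unfolding wv using zero_le_power[OF norm_ge_zero[of "v z"], of 3] by linarith
  next
    case False
    then have "cmod (v z) ^ 1 \<le> cmod (v z) ^ 3" by (intro power_increasing) auto
    then show ?thesis unfolding wv by simp
  qed
  define v' where "v' z = of_real ((cmod (v z))\<^sup>2) * v z" for z
  have v'1: "cmod (v' z) \<le> 1 + w z" for z
    unfolding v'_def wv by (simp add: norm_mult power2_eq_square power3_eq_cube)
  have v'm: "set_borel_measurable lebesgue (J \<times> torus) v'"
  proof -
    have m: "(\<lambda>z. indicat_real (J \<times> torus) z *\<^sub>R v z) \<in> borel_measurable lebesgue"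
      using vm unfolding set_borel_measurable_def .
    have "(\<lambda>y. complex_of_real ((cmod y)\<^sup>2) * y) \<in> borel_measurable borel"
      by (rule borel_measurable_continuous_onI) (intro continuous_intros)
    from measurable_compose[OF m this]
    have "(\<lambda>z. of_real ((cmod (indicat_real (J \<times> torus) z *\<^sub>R v z))\<^sup>2) * (indicat_real (J \<times> torus) z *\<^sub>R v z)) \<in> borel_measurable lebesgue" .
    also have "(\<lambda>z. of_real ((cmod (indicat_real (J \<times> torus) z *\<^sub>R v z))\<^sup>2) * (indicat_real (J \<times> torus) z *\<^sub>R v z))
        = (\<lambda>z. indicat_real (J \<times> torus) z *\<^sub>R v' z)"
      unfolding v'_def by (rule ext) (simp split: split_indicator)
    finally show ?thesis unfolding set_borel_measurable_def .
  qed
  have sep: "continuous_on UNIV (\<lambda>z. complex_of_real (\<theta> (fst z)) * (a * ek (- k) (snd z)))" if "continuous_on UNIV \<theta>" for \<theta> a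
    using continuous_separated[OF that, of a "- k"] by (simp add: case_prod_beta)
  have int: "set_integrable lebesgue (J \<times> torus) (\<lambda>z. y z * (complex_of_real (\<theta> (fst z)) * (a * ek (- k) (snd z))))"
    if "set_borel_measurable lebesgue (J \<times> torus) y" "\<And>z. cmod (y z) \<le> 1 + w z"
      "continuous_on UNIV \<theta>" "\<And>t. t \<in> J - K \<Longrightarrow> \<theta> t = 0" for y \<theta> a
    using that by (intro dominated_integrable[OF that(1,2) K(1,2) wi sep]) auto
  have I1: "set_lebesgue_integral lebesgue (J \<times> torus) (\<lambda>(t, x). u t x * partial_t ?\<phi> t x)
      = integral {lo..hi} (\<lambda>t. p * (of_real (\<eta>' t) * c t k))"
    unfolding partial_separated[OF \<eta>(2)]
  proof (rule fubini_J)
    show "set_integrable lebesgue (J \<times> torus) (\<lambda>(t, x). u t x * (of_real (\<eta>' t) * (1 * ek (- k) x)))"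
      using int[OF vm v1 \<eta>(3), of 1] K(3) by (simp add: v_def case_prod_beta')
    show "(LINT x:torus|lebesgue. u t x * (of_real (\<eta>' t) * (1 * ek (- k) x))) = p * (of_real (\<eta>' t) * c t k)"
      if "t \<in> J" for t
      using frep_lint_cmult[OF rep[OF JI[OF that]], of "of_real (\<eta>' t)" 1 k] by (simp add: p_def mult_ac)
    show "continuous_on {lo..hi} (\<lambda>t. p * (of_real (\<eta>' t) * c t k))"
      by (intro continuous_intros c\<eta>' cont)
  qed (rule frep_set_measurable[OF rep[OF JI]])
  have I2: "set_lebesgue_integral lebesgue (J \<times> torus) (\<lambda>(t, x).
         u t x * (- of_real \<alpha>1 * partial_x (partial_x (partial_x ?\<phi>)) t x
                  + \<i> * of_real \<alpha>2 * partial_x (partial_x ?\<phi>) t x)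
         + of_real ((cmod (u t x))\<^sup>2) * u t x *
             (\<i> * of_real \<gamma>1 * ?\<phi> t x - of_real \<gamma>2 * partial_x ?\<phi> t x))
      = integral {lo..hi} (\<lambda>t. p * (of_real (\<eta> t) * (a1 * c t k + a2 * Y t)))" (is "?L = _")
  proof -
    let ?g1 = "\<lambda>t x. u t x * (of_real (\<eta> t) * (a1 * ek (- k) x))"
    let ?g2 = "\<lambda>t x. of_real ((cmod (u t x))\<^sup>2) * u t x * (of_real (\<eta> t) * (a2 * ek (- k) x))"
    have "?L = set_lebesgue_integral lebesgue (J \<times> torus) (\<lambda>(t, x). ?g1 t x + ?g2 t x)"
      unfolding partial_separated(2)[OF \<eta>(2)] a1_def a2_def \<kappa>_def[symmetric] by (simp add: algebra_simps)
    also have "\<dots> = integral {lo..hi} (\<lambda>t. p * (of_real (\<eta> t) * (a1 * c t k + a2 * Y t)))"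
    proof (rule fubini_J)
      have i1: "set_integrable lebesgue (J \<times> torus) (\<lambda>(t, x). ?g1 t x)"
        using int[OF vm v1 Dn_continuous[OF \<eta>(1)[of 0]], of a1] K(3) by (simp add: v_def case_prod_beta')
      have i2: "set_integrable lebesgue (J \<times> torus) (\<lambda>(t, x). ?g2 t x)"
        using int[OF v'm v'1 Dn_continuous[OF \<eta>(1)[of 0]], of a2] K(3) by (simp add: v_def v'_def case_prod_beta')
      show "set_integrable lebesgue (J \<times> torus) (\<lambda>(t, x). ?g1 t x + ?g2 t x)"
        using set_integral_add(1)[OF i1 i2] by (simp only: case_prod_beta')
      fix t assume t: "t \<in> J"
      note r1 = rep[OF JI[OF t]] and r2 = frep_cube[OF rep[OF JI[OF t]]]
      have m1: "set_borel_measurable lebesgue torus (?g1 t)" by (rule frep_set_measurable[OF r1])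
      have m2: "set_borel_measurable lebesgue torus (?g2 t)" by (rule frep_set_measurable[OF r2])
      have fi: "set_integrable lebesgue torus (\<lambda>x. y x * (of_real (\<eta> t) * (a * ek (- k) x)))"
        if "frep y d" for y a d
      proof -
        have "set_integrable lebesgue torus (\<lambda>x. fser d x * (of_real (\<eta> t) * (a * ek (- k) x)))"
        proof -
          have gm: "(\<lambda>x. of_real (\<eta> t) * (a * ek (- k) x)) \<in> borel_measurable lebesgue"
            by (intro borel_measurable_times lebesgue_ek borel_measurable_const)
          have "set_integrable lebesgue torus (\<lambda>x. (of_real (\<eta> t) * (a * ek (- k) x)) * fser d x)"
            by (rule set_integrable_bounded_mult[OF fser_integrable[OF frep_abs_summable[OF that]] gm,
                where B = "\<bar>\<eta> t\<bar> * cmod a"]) (simp add: norm_mult)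
          then show ?thesis by (simp only: mult.commute)
        qed
        then have "integrable lebesgue (\<lambda>x. indicat_real torus x *\<^sub>R (fser d x * (of_real (\<eta> t) * (a * ek (- k) x))))"
          unfolding set_integrable_def .
        moreover have "(\<lambda>x. indicat_real torus x *\<^sub>R (y x * (of_real (\<eta> t) * (a * ek (- k) x)))) \<in> borel_measurable lebesgue"
          using frep_set_measurable[OF that] unfolding set_borel_measurable_def .
        moreover have "AE x in lebesgue. indicat_real torus x *\<^sub>R (fser d x * (of_real (\<eta> t) * (a * ek (- k) x)))
           = indicat_real torus x *\<^sub>R (y x * (of_real (\<eta> t) * (a * ek (- k) x)))"
          using that unfolding frep_def by (auto simp: indicator_def elim!: eventually_mono)
        ultimately show ?thesis unfolding set_integrable_def by (rule integrable_cong_AE_imp)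
      qed
      show "set_borel_measurable lebesgue torus (\<lambda>x. ?g1 t x + ?g2 t x)"
        using borel_measurable_add[OF m1[unfolded set_borel_measurable_def] m2[unfolded set_borel_measurable_def]]
        unfolding set_borel_measurable_def scaleR_add_right .
      show "(LINT x:torus|lebesgue. ?g1 t x + ?g2 t x) = p * (of_real (\<eta> t) * (a1 * c t k + a2 * Y t))"
        unfolding set_integral_add(2)[OF fi[OF r1] fi[OF r2]] frep_lint_cmult[OF r1] frep_lint_cmult[OF r2]
        by (simp add: p_def Y_def algebra_simps)
    next
      show "continuous_on {lo..hi} (\<lambda>t. p * (of_real (\<eta> t) * (a1 * c t k + a2 * Y t)))"
        by (intro continuous_intros c\<eta> cont cY)
    qed
    finally show ?thesis .
  qed
  have I3: "(LINT t:J|lebesgue. pairing (dx_sq u t) (fourier (\<lambda>x. u t x * ?\<phi> t x)))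
      = integral {lo..hi} (\<lambda>t. p * (of_real (\<eta> t) * (\<i> * Z t)))"
  proof -
    have "(LINT t:J|lebesgue. pairing (dx_sq u t) (fourier (\<lambda>x. u t x * ?\<phi> t x)))
        = (LINT t:J|lebesgue. p * (of_real (\<eta> t) * (\<i> * Z t)))"
    proof (rule set_lebesgue_integral_cong)
      show "J \<in> sets lebesgue" by simp
      show "\<forall>t. t \<in> J \<longrightarrow> pairing (dx_sq u t) (fourier (\<lambda>x. u t x * ?\<phi> t x)) = p * (of_real (\<eta> t) * (\<i> * Z t))"
      proof (intro allI impI)
        fix t assume "t \<in> J"
        show "pairing (dx_sq u t) (fourier (\<lambda>x. u t x * ?\<phi> t x)) = p * (of_real (\<eta> t) * (\<i> * Z t))"
          unfolding pairing_separated[of u t c "of_real (\<eta> t)" k, OF rep[OF JI[OF \<open>t \<in> J\<close>]]]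
          by (simp add: p_def Z_def mult.left_commute)
      qed
    qed
    also have "\<dots> = integral {lo..hi} (\<lambda>t. p * (of_real (\<eta> t) * (\<i> * Z t)))"
      by (rule lint_J(2)) (intro continuous_intros c\<eta> cZ)
    finally show ?thesis .
  qed
  have I0: "(LINT x:torus|lebesgue. u0 x * ?\<phi> 0 x) = p * (of_real (\<eta> 0) * c0 k)"
    using frep_lint_cmult[OF rep0, of "of_real (\<eta> 0)" 1 k] by (simp add: p_def mult_ac)
  have "- integral {lo..hi} (\<lambda>t. p * (of_real (\<eta>' t) * c t k)) - of_real e * (p * (of_real (\<eta> 0) * c0 k))
     = integral {lo..hi} (\<lambda>t. p * (of_real (\<eta> t) * (a1 * c t k + a2 * Y t)))
     - \<i> * of_real \<Gamma> * integral {lo..hi} (\<lambda>t. p * (of_real (\<eta> t) * (\<i> * Z t)))"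
    using weak[OF test] unfolding weak_identity_def I0 I1 I2 I3 .
  then have "p * (- integral {lo..hi} (\<lambda>t. of_real (\<eta>' t) * c t k) - of_real (e * \<eta> 0) * c0 k)
     = p * (integral {lo..hi} (\<lambda>t. of_real (\<eta> t) * (a1 * c t k + a2 * Y t))
     - \<i> * of_real \<Gamma> * integral {lo..hi} (\<lambda>t. of_real (\<eta> t) * (\<i> * Z t)))"
    unfolding integral_mult_right by (simp add: algebra_simps)
  then have "- integral {lo..hi} (\<lambda>t. of_real (\<eta>' t) * c t k) - of_real (e * \<eta> 0) * c0 k
     = integral {lo..hi} (\<lambda>t. of_real (\<eta> t) * (a1 * c t k + a2 * Y t))
     - integral {lo..hi} (\<lambda>t. \<i> * of_real \<Gamma> * (of_real (\<eta> t) * (\<i> * Z t)))"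
    using p0 unfolding mult_cancel_left integral_mult_right by blast
  also have "\<dots> = integral {lo..hi} (\<lambda>t. of_real (\<eta> t) * (a1 * c t k + a2 * Y t) - \<i> * of_real \<Gamma> * (of_real (\<eta> t) * (\<i> * Z t)))"
    by (rule Henstock_Kurzweil_Integration.integral_diff[symmetric])
       (rule integrable_continuous_interval, intro continuous_intros c\<eta> cont cY cZ)+
  also have "\<dots> = integral {lo..hi} (\<lambda>t. of_real (\<eta> t) * (- (\<i> * of_real (om k)) * c t k + nl (c t) k))"
  proof (rule Henstock_Kurzweil_Integration.integral_cong)
    fix t assume t: "t \<in> {lo..hi}"
    have V: "l2b (\<lambda>j. jbr j * sy (c t) j) (2 * A)"
      using l2b_sy[of 1 "c t" A] A[OF t] jbr_nonneg by simp
    have 1: "a1 = - (\<i> * of_real (om k))"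
      unfolding a1_def \<kappa>_def om_def by (simp add: complex_eq_iff power2_eq_square power3_eq_cube algebra_simps)
    have 2: "a2 = \<i> * of_real (\<gamma>1 + \<gamma>2 * of_int k)"
      unfolding a2_def \<kappa>_def by (simp add: algebra_simps)
    show "of_real (\<eta> t) * (a1 * c t k + a2 * Y t) - \<i> * of_real \<Gamma> * (of_real (\<eta> t) * (\<i> * Z t))
        = of_real (\<eta> t) * (- (\<i> * of_real (om k)) * c t k + nl (c t) k)"
      unfolding nl_formula[OF V] 1 2 Y_def[symmetric] Z_def[symmetric] by (simp add: algebra_simps)
  qed
  finally show ?thesis .
qed

lemma weak_to_ode:
  assumes ti: "time_interval J lo hi" and z: "0 \<in> {lo..hi}" and L3: "u \<in> L3_loc J"
    and weak: "\<And>\<phi>. \<phi> \<in> test_fun J \<Longrightarrow> weak_identity \<alpha>1 \<alpha>2 \<gamma>1 \<gamma>2 \<Gamma> J e u0 u \<phi>"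
    and rep: "\<And>t. t \<in> {lo..hi} \<Longrightarrow> frep (u t) (c t)"
    and A: "\<And>t. t \<in> {lo..hi} \<Longrightarrow> l2b (\<lambda>j. jbr j * cmod (c t j)) A"
    and cont: "\<And>j. continuous_on {lo..hi} (\<lambda>t. c t j)"
    and rep0: "frep u0 c0"
    and bd: "\<And>\<eta> A. P \<eta> \<Longrightarrow> of_real (\<eta> hi) * A hi - of_real (\<eta> lo) * A lo = - of_real (e * \<eta> 0) * (A 0 :: complex)"
    and steps: "\<And>\<alpha> \<beta> G. lo < \<alpha> \<Longrightarrow> \<alpha> < \<beta> \<Longrightarrow> \<beta> < hi \<Longrightarrow> (\<And>s t. s \<le> \<alpha> \<Longrightarrow> t \<le> \<alpha> \<Longrightarrow> G s = G t) \<Longrightarrow>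
        (\<And>s t. \<beta> \<le> s \<Longrightarrow> \<beta> \<le> t \<Longrightarrow> G s = G t) \<Longrightarrow> \<exists>d. P (\<lambda>t. G t + d)"
    and PK: "\<And>\<eta> \<eta>'. P \<eta> \<Longrightarrow> (\<And>t. (\<eta> has_real_derivative \<eta>' t) (at t)) \<Longrightarrow>
        \<exists>K. compact K \<and> K \<subseteq> J \<and> (\<forall>t\<in>J - K. \<eta> t = 0 \<and> \<eta>' t = 0)"
  shows "ode_on {lo..hi} c" "c 0 k = c0 k"
proof -
  have lohi: "lo < hi" using ti by (simp add: time_interval_def)
  have cF: "continuous_on {lo..hi} (\<lambda>t. - (\<i> * of_real (om k)) * c t k + nl (c t) k)" for k
    by (intro continuous_intros cont nl_continuous[OF cont A])
  have W: "- integral {lo..hi} (\<lambda>t. of_real (\<eta>' t) * c t k) - of_real (e * \<eta> 0) * c0 k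
     = integral {lo..hi} (\<lambda>t. of_real (\<eta> t) * (- (\<i> * of_real (om k)) * c t k + nl (c t) k))"
    if "\<And>n. Dn n \<eta>" "\<And>t. (\<eta> has_real_derivative \<eta>' t) (at t)" "continuous_on UNIV \<eta>'" "P \<eta>" for \<eta> \<eta>' k
  proof -
    note \<eta> = that
    obtain K where K: "compact K" "K \<subseteq> J" "\<forall>t\<in>J - K. \<eta> t = 0 \<and> \<eta>' t = 0"
      using PK[OF \<eta>(4) \<eta>(2)] by blast
    show ?thesis
      by (rule weak_separated[OF ti z L3 weak rep A cont rep0 \<eta>(1-3) K(1,2)]) (use K(3) in auto)
  qed
  have D: "((\<lambda>t. c t k) has_vector_derivative (- (\<i> * of_real (om k)) * c t k + nl (c t) k)) (at t within {lo..hi})"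
    if "t \<in> {lo..hi}" for t k
    by (rule dubois_reymond(1)[OF lohi z cont cF W bd steps that])
  show "ode_on {lo..hi} c" unfolding ode_on_def using D by blast
  show "c 0 k = c0 k"
    by (rule dubois_reymond(2)[OF lohi z cont cF W bd steps z])
qed

end

subsection \<open>Regularity of solutions\<close>

text \<open>Coefficients in the normalisation of \<open>fser\<close>.\<close>

definition fc :: "(real \<Rightarrow> complex) \<Rightarrow> int \<Rightarrow> complex" where
  "fc u k = fourier u k / of_real (sqrt (2 * pi))"

lemma sqrt_2pi: "1 \<le> sqrt (2 * pi)" "sqrt (2 * pi) \<le> 3"
proof -
  show "1 \<le> sqrt (2 * pi)" using pi_ge_two by simp
  have "2 * pi \<le> 3\<^sup>2" using pi_less_4 by simp
  then show "sqrt (2 * pi) \<le> 3" by (rule real_le_lsqrt[rotated]) simp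
qed

lemma norm_fc: "cmod (fourier u k) = sqrt (2 * pi) * cmod (fc u k)"
  by (simp add: fc_def norm_divide)

lemma norm_fc_le: "cmod (fc u k) \<le> cmod (fourier u k)"
  unfolding norm_fc using mult_right_mono[OF sqrt_2pi(1), of "cmod (fc u k)"] by simp

lemma l2b_powr_mono:
  assumes "l2b (\<lambda>j. jbr j powr s' * cmod (c j)) H" "s \<le> s'"
  shows "l2b (\<lambda>j. jbr j powr s * cmod (c j)) H"
  using assms(1) by (rule l2b_mono) (use jbr_ge1 assms(2) in \<open>auto intro!: mult_right_mono powr_mono\<close>)

lemma sobolev_l2b:
  "u \<in> sobolev s \<Longrightarrow> l2b (\<lambda>j. jbr j powr s * cmod (fourier u j)) (sobolev_norm s u)"
  unfolding sobolev_norm_def by (rule sobolev_seq_l2b) (simp add: sobolev_def)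

lemma sobolev_l2b_fc:
  assumes "u \<in> sobolev s" "sobolev_norm s u \<le> H"
  shows "l2b (\<lambda>j. jbr j powr s * cmod (fc u j)) H"
  by (rule l2b_mono[OF sobolev_l2b[OF assms(1)]]) (use norm_fc_le assms(2) in \<open>auto intro!: mult_left_mono\<close>)

lemma sobolev_norm_mono:
  assumes "u \<in> sobolev s'" "s \<le> s'"
  shows "u \<in> sobolev s" "sobolev_norm s u \<le> sobolev_norm s' u"
  using l2b_sobolev_seq[OF l2b_powr_mono[OF sobolev_l2b[OF assms(1)] assms(2)]] assms(1)
  by (auto simp: sobolev_def sobolev_norm_def)

lemma sobolev_asummable:
  assumes u: "u \<in> sobolev s" and s: "1 / 2 < s"
  shows "fourier u asummable_on UNIV"
proof -
  have "(jbr j powr (- s))\<^sup>2 = jbr j powr (- (2 * s))" for j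
    using jbr_nz[of j] by (simp add: power2_eq_square flip: powr_add)
  then have "l2b (\<lambda>j. jbr j powr (- s)) (sqrt (\<Sum>\<^sub>\<infinity>j. (jbr j powr (- s))\<^sup>2))"
    using summable_jbr_powr[of "2 * s"] s by (intro l2b_of_summable) auto
  from l1b_mult[OF this sobolev_l2b[OF u]]
  obtain B where "l1b (\<lambda>j. jbr j powr (- s) * (jbr j powr s * cmod (fourier u j))) B" by blast
  moreover have "jbr j powr (- s) * (jbr j powr s * cmod (fourier u j)) = cmod (fourier u j)" for j
    using jbr_nz[of j] by (simp add: mult.assoc[symmetric] flip: powr_add)
  ultimately have "l1b (\<lambda>j. cmod (fourier u j)) B" by simp
  then show ?thesis
    by (intro nonneg_bdd_above_summable_on) (auto intro!: bdd_aboveI2[where M = B] dest: l1bD)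
qed

lemma sobolev_frep:
  assumes "u \<in> sobolev s" "1 / 2 < s"
  shows "frep u (fc u)"
  using frep_of_fourier[OF _ sobolev_asummable[OF assms]] assms(1) unfolding fc_def[abs_def] sobolev_def by blast

text \<open>The norm of the difference dominates each coefficient only if its defining series
  converges, an infinite sum being 0 otherwise; hence the difference is first shown to lie in the
  space.\<close>

lemma C_sobolev_continuous:
  assumes u: "u \<in> C_sobolev I \<sigma>" and \<sigma>: "1 / 2 < \<sigma>"
  shows "continuous_on I (\<lambda>t. fc (u t) j)"
  unfolding continuous_on_def
proof
  fix t assume t: "t \<in> I"
  have us: "u s \<in> sobolev \<sigma>" if "s \<in> I" for s using u that by (auto simp: C_sobolev_def)
  have lim: "((\<lambda>s. sobolev_norm \<sigma> (\<lambda>x. u s x - u t x)) \<longlongrightarrow> 0) (at t within I)"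
    using u t by (auto simp: C_sobolev_def)
  have b: "cmod (fc (u s) j - fc (u t) j) \<le> sobolev_norm \<sigma> (\<lambda>x. u s x - u t x)" if s: "s \<in> I" for s
  proof -
    have fd: "fourier (\<lambda>x. u s x - u t x) k = fourier (u s) k - fourier (u t) k" for k
      using us[OF s] us[OF t] by (intro fourier_diff) (auto simp: sobolev_def)
    have "l2b (\<lambda>j. jbr j powr \<sigma> * cmod (fourier (u s) j - fourier (u t) j)) (sobolev_norm \<sigma> (u s) + sobolev_norm \<sigma> (u t))"
    proof (rule l2b_mono[OF l2b_add[OF sobolev_l2b[OF us[OF s]] sobolev_l2b[OF us[OF t]]]])
      fix k
      show "jbr k powr \<sigma> * cmod (fourier (u s) k - fourier (u t) k)
         \<le> jbr k powr \<sigma> * cmod (fourier (u s) k) + jbr k powr \<sigma> * cmod (fourier (u t) k)"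
        unfolding distrib_left[symmetric] by (intro mult_left_mono norm_triangle_ineq4) simp
    qed auto
    then have "fourier (\<lambda>x. u s x - u t x) \<in> sobolev_seq \<sigma>"
      by (intro l2b_sobolev_seq(1)) (simp only: fd)
    from l2b_pt[OF sobolev_seq_l2b[OF this], of j]
    have "jbr j powr \<sigma> * cmod (fourier (u s) j - fourier (u t) j) \<le> sobolev_norm \<sigma> (\<lambda>x. u s x - u t x)"
      unfolding fd sobolev_norm_def .
    moreover have "1 * cmod (fourier (u s) j - fourier (u t) j) \<le> jbr j powr \<sigma> * cmod (fourier (u s) j - fourier (u t) j)"
      using jbr_ge1[of j] \<sigma> by (intro mult_right_mono ge_one_powr_ge_zero) auto
    moreover have "cmod (fc (u s) j - fc (u t) j) = cmod (fourier (u s) j - fourier (u t) j) / sqrt (2 * pi)"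
      unfolding fc_def diff_divide_distrib[symmetric] by (simp add: norm_divide)
    moreover have "cmod (fourier (u s) j - fourier (u t) j) / sqrt (2 * pi) \<le> cmod (fourier (u s) j - fourier (u t) j) / 1"
      using sqrt_2pi(1) by (intro divide_left_mono) auto
    ultimately show ?thesis by linarith
  qed
  show "((\<lambda>s. fc (u s) j) \<longlongrightarrow> fc (u t) j) (at t within I)"
  proof (rule Lim_null_comparison[THEN Lim_null[THEN iffD2]])
    show "\<forall>\<^sub>F s in at t within I. norm (fc (u s) j - fc (u t) j) \<le> sobolev_norm \<sigma> (\<lambda>x. u s x - u t x)"
      using b by (auto simp: eventually_at_filter)
  qed (rule lim)
qed

text \<open>The squared terms decay like the power -(2 s + 2 - 2 \<sigma>) of \<open>jbr k\<close>,
  and 2 s + 2 - 2 \<sigma> exceeds 1 exactly when \<sigma> < s + 1/2.\<close>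

lemma fser_sobolev:
  assumes d: "\<And>k. jbr k powr (s + 1) * cmod (d k) \<le> X" and a: "d asummable_on UNIV" and \<sigma>: "\<sigma> < s + 1 / 2"
  shows "fser d \<in> sobolev \<sigma>"
proof -
  have X: "0 \<le> X" using d[of 0] by (rule order_trans[rotated]) simp
  have "(\<lambda>k. (sqrt (2 * pi) * X)\<^sup>2 * jbr k powr (- (2 * s + 2 - 2 * \<sigma>))) summable_on UNIV"
    using \<sigma> by (intro summable_on_cmult_right summable_jbr_powr) simp
  then have "(\<lambda>k. (jbr k powr \<sigma> * cmod (fourier (fser d) k))\<^sup>2) summable_on UNIV"
  proof (rule summable_on_comparison_test)
    fix k
    have "jbr k powr \<sigma> * cmod (d k) = jbr k powr (\<sigma> - s - 1) * (jbr k powr (s + 1) * cmod (d k))"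
      using jbr_nz[of k] by (simp add: mult.assoc[symmetric] flip: powr_add)
    also have "\<dots> \<le> jbr k powr (\<sigma> - s - 1) * X" by (intro mult_left_mono d) simp
    finally have "sqrt (2 * pi) * (jbr k powr \<sigma> * cmod (d k)) \<le> sqrt (2 * pi) * (jbr k powr (\<sigma> - s - 1) * X)"
      by (intro mult_left_mono) auto
    then have "(sqrt (2 * pi) * (jbr k powr \<sigma> * cmod (d k)))\<^sup>2 \<le> (sqrt (2 * pi) * (jbr k powr (\<sigma> - s - 1) * X))\<^sup>2"
      by (intro power_mono) auto
    moreover have "(jbr k powr (\<sigma> - s - 1))\<^sup>2 = jbr k powr (- (2 * s + 2 - 2 * \<sigma>))"
      using jbr_nz[of k] by (simp add: power2_eq_square algebra_simps flip: powr_add)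
    ultimately show "(jbr k powr \<sigma> * cmod (fourier (fser d) k))\<^sup>2
        \<le> (sqrt (2 * pi) * X)\<^sup>2 * jbr k powr (- (2 * s + 2 - 2 * \<sigma>))"
      unfolding fser_fourier[OF a] by (simp add: norm_mult power_mult_distrib mult_ac)
  qed auto
  then show ?thesis
    unfolding sobolev_def using fser_periodic fser_integrable[OF a] by (auto simp: sobolev_seq_jbr)
qed

lemma half_series_fser:
  "of_real (1 / sqrt (2 * pi)) * (\<Sum>\<^sub>\<infinity>k\<in>S. fourier f k * exp (\<i> * of_int k * of_real x))
     = fser (\<lambda>k. if k \<in> S then fc f k else 0) x"
proof -
  have "of_real (1 / sqrt (2 * pi)) * (\<Sum>\<^sub>\<infinity>k\<in>S. fourier f k * exp (\<i> * of_int k * of_real x))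
      = (\<Sum>\<^sub>\<infinity>k\<in>S. of_real (1 / sqrt (2 * pi)) * (fourier f k * ek k x))"
    unfolding ek_def by (rule infsum_cmult_right'[symmetric])
  also have "\<dots> = fser (\<lambda>k. if k \<in> S then fc f k else 0) x"
    unfolding fser_def by (rule infsum_cong_neutral) (auto simp: fc_def)
  finally show ?thesis .
qed

lemma P_plus_fser: "P_plus f = fser (\<lambda>k. if 0 < k then fc f k else 0)"
  and P_minus_fser: "P_minus f = fser (\<lambda>k. if k < 0 then fc f k else 0)"
  unfolding fun_eq_iff P_plus_def P_minus_def half_series_fser by simp_all

lemma deriv_zero_if:
  assumes "(\<eta> has_real_derivative d) (at t)" "open S" "t \<in> S" "\<And>x. x \<in> S \<Longrightarrow> \<eta> x = 0"
  shows "d = 0"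
proof -
  have "((\<lambda>x. 0) has_real_derivative d) (at t)"
    by (rule has_field_derivative_transform_within_open[OF assms(1-3)]) (use assms(4) in simp)
  then show ?thesis using DERIV_unique DERIV_const by blast
qed

lemma regular_facts:
  assumes "regular_on I s u" "1 \<le> s"
  shows "\<And>t. t \<in> I \<Longrightarrow> frep (u t) (fc (u t))"
    "\<And>t. t \<in> I \<Longrightarrow> l2b (\<lambda>j. jbr j powr s * cmod (fc (u t) j)) (SUP t\<in>I. sobolev_norm s (u t))"
    "\<And>t. t \<in> I \<Longrightarrow> l2b (\<lambda>j. jbr j * cmod (fc (u t) j)) (SUP t\<in>I. sobolev_norm 1 (u t))"
    "\<And>j. continuous_on I (\<lambda>t. fc (u t) j)"
proof -
  have us: "u t \<in> sobolev s" if "t \<in> I" for t using assms(1) that by (simp add: regular_on_def)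
  have bd: "bdd_above ((\<lambda>t. sobolev_norm s (u t)) ` I)" using assms(1) by (simp add: regular_on_def)
  then obtain B where B: "\<And>t. t \<in> I \<Longrightarrow> sobolev_norm s (u t) \<le> B" by (auto simp: bdd_above_def)
  have bd1: "bdd_above ((\<lambda>t. sobolev_norm 1 (u t)) ` I)"
    by (rule bdd_aboveI2[where M = B]) (use B sobolev_norm_mono(2)[OF us assms(2)] order_trans in blast)
  show "frep (u t) (fc (u t))" if "t \<in> I" for t
    by (rule sobolev_frep[OF us[OF that]]) (use assms(2) in simp)
  show "l2b (\<lambda>j. jbr j powr s * cmod (fc (u t) j)) (SUP t\<in>I. sobolev_norm s (u t))" if "t \<in> I" for t
    by (rule sobolev_l2b_fc[OF us[OF that] cSUP_upper[OF that bd]])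
  show "l2b (\<lambda>j. jbr j * cmod (fc (u t) j)) (SUP t\<in>I. sobolev_norm 1 (u t))" if "t \<in> I" for t
    using sobolev_l2b_fc[OF sobolev_norm_mono(1)[OF us[OF that] assms(2)] cSUP_upper[OF that bd1]] jbr_nonneg by simp
  show "continuous_on I (\<lambda>t. fc (u t) j)" for j
    using assms(1) C_sobolev_continuous unfolding regular_on_def by blast
qed

lemma regular_on_subset:
  assumes "regular_on I s u" "J \<subseteq> I"
  shows "regular_on J s u"
proof -
  obtain \<sigma> where "\<sigma> > 1/2" "u \<in> C_sobolev I \<sigma>" using assms(1) by (auto simp: regular_on_def)
  then have "u \<in> C_sobolev J \<sigma>"
    using assms(2) tendsto_within_subset unfolding C_sobolev_def by blast
  moreover have "bdd_above ((\<lambda>t. sobolev_norm s (u t)) ` J)"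
    by (rule bdd_above_mono[OF _ image_mono[OF assms(2)]]) (use assms(1) in \<open>simp add: regular_on_def\<close>)
  ultimately show ?thesis using assms \<open>\<sigma> > 1/2\<close> unfolding regular_on_def by blast
qed

section \<open>From weak solutions to the system for the coefficients\<close>

context raman
begin

interpretation R: raman \<alpha>1 "- \<alpha>2" "- \<gamma>1" \<gamma>2 \<Gamma>
  by (rule reflected)

lemma forward_ode:
  assumes T: "0 < T" and s: "1 \<le> s" and sol: "solution_forward \<alpha>1 \<alpha>2 \<gamma>1 \<gamma>2 \<Gamma> T u0 u"
    and reg: "regular_on {0..T} s u"
  shows "ode_on {0..T} (\<lambda>t. fc (u t))" "fc (u 0) k = fc u0 k"
proof -
  obtain s' where s': "s' > 1/2" "solution_half_open \<alpha>1 \<alpha>2 \<gamma>1 \<gamma>2 \<Gamma> {0..<T} 1 s' u0 u"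
    using sol by (auto simp: solution_forward_def)
  have h: "u0 \<in> sobolev s'" "u \<in> L3_loc {0..<T}"
    "\<And>\<phi>. \<phi> \<in> test_fun {0..<T} \<Longrightarrow> weak_identity \<alpha>1 \<alpha>2 \<gamma>1 \<gamma>2 \<Gamma> {0..<T} 1 u0 u \<phi>"
    using s'(2) by (auto simp: solution_half_open_def)
  \<comment> \<open>Admissible time factors vanish near the open end T and are unrestricted at 0,
    where they produce the initial datum.\<close>
  define P where "P \<eta> \<longleftrightarrow> (\<exists>b<T. \<forall>t\<ge>b. \<eta> t = 0)" for \<eta> :: "real \<Rightarrow> real"
  have ti: "time_interval {0..<T} 0 T" using T by unfold_locales auto
  have z: "0 \<in> {0..T}" using T by auto
  have bd: "of_real (\<eta> T) * A T - of_real (\<eta> 0) * A 0 = - of_real (1 * \<eta> 0) * (A 0 :: complex)" if "P \<eta>" for \<eta> A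
    using that unfolding P_def by auto
  have steps: "\<exists>d. P (\<lambda>t. G t + d)" if b: "\<beta> < T" and st: "\<And>s t. \<beta> \<le> s \<Longrightarrow> \<beta> \<le> t \<Longrightarrow> G s = G t" for \<beta> G
  proof (intro exI)
    have "G t + - G \<beta> = 0" if "\<beta> \<le> t" for t using st[OF that order_refl] by simp
    then show "P (\<lambda>t. G t + - G \<beta>)" unfolding P_def using b by blast
  qed
  have PK: "\<exists>K. compact K \<and> K \<subseteq> {0..<T} \<and> (\<forall>t\<in>{0..<T} - K. \<eta> t = 0 \<and> \<eta>' t = 0)"
    if Pe: "P \<eta>" and d: "\<And>t. (\<eta> has_real_derivative \<eta>' t) (at t)" for \<eta> \<eta>'
  proof -
    obtain b where b: "b < T" "\<And>t. b \<le> t \<Longrightarrow> \<eta> t = 0" using Pe unfolding P_def by blast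
    \<comment> \<open>The support is cut midway between b and T, strictly beyond b, so that \<eta>
      vanishes in a neighbourhood of every later time and its derivative is 0 there as well.\<close>
    have mid: "b < (b + T) / 2" "(b + T) / 2 < T" using b(1) by (simp_all add: field_simps)
    have "\<eta> t = 0 \<and> \<eta>' t = 0" if "t \<in> {0..<T} - {0..(b + T) / 2}" for t
    proof -
      have "b < t" using that mid by auto
      then show ?thesis using b(2) deriv_zero_if[OF d[of t], of "{b<..}"] by auto
    qed
    then show ?thesis using mid by (intro exI[of _ "{0..(b + T) / 2}"]) auto
  qed
  note F = regular_facts[OF reg s]
  note W = weak_to_ode[OF ti z h(2,3) F(1,3,4) sobolev_frep[OF h(1) s'(1)], of P]
  show "ode_on {0..T} (\<lambda>t. fc (u t))" by (rule W(1)[OF _ _ _ bd steps PK])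
  show "fc (u 0) k = fc u0 k" by (rule W(2)[OF _ _ _ bd steps PK])
qed

lemma backward_ode:
  assumes T: "0 < T" and s: "1 \<le> s" and sol: "solution_backward \<alpha>1 \<alpha>2 \<gamma>1 \<gamma>2 \<Gamma> T u0 u"
    and reg: "regular_on {- T..0} s u"
  shows "ode_on {- T..0} (\<lambda>t. fc (u t))" "fc (u 0) k = fc u0 k"
proof -
  obtain s' where s': "s' > 1/2" "solution_half_open \<alpha>1 \<alpha>2 \<gamma>1 \<gamma>2 \<Gamma> {- T<..0} (- 1) s' u0 u"
    using sol by (auto simp: solution_backward_def)
  have h: "u0 \<in> sobolev s'" "u \<in> L3_loc {- T<..0}"
    "\<And>\<phi>. \<phi> \<in> test_fun {- T<..0} \<Longrightarrow> weak_identity \<alpha>1 \<alpha>2 \<gamma>1 \<gamma>2 \<Gamma> {- T<..0} (- 1) u0 u \<phi>"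
    using s'(2) by (auto simp: solution_half_open_def)
  define P where "P \<eta> \<longleftrightarrow> (\<exists>b>- T. \<forall>t\<le>b. \<eta> t = 0)" for \<eta> :: "real \<Rightarrow> real"
  have ti: "time_interval {- T<..0} (- T) 0" using T by unfold_locales auto
  have z: "0 \<in> {- T..0}" using T by auto
  have bd: "of_real (\<eta> 0) * A 0 - of_real (\<eta> (- T)) * A (- T) = - of_real (- 1 * \<eta> 0) * (A 0 :: complex)" if "P \<eta>" for \<eta> A
    using that unfolding P_def by auto
  have steps: "\<exists>d. P (\<lambda>t. G t + d)" if b: "- T < \<alpha>" and st: "\<And>s t. s \<le> \<alpha> \<Longrightarrow> t \<le> \<alpha> \<Longrightarrow> G s = G t" for \<alpha> G
  proof (intro exI)
    have "G t + - G \<alpha> = 0" if "t \<le> \<alpha>" for t using st[OF that order_refl] by simp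
    then show "P (\<lambda>t. G t + - G \<alpha>)" unfolding P_def using b by blast
  qed
  have PK: "\<exists>K. compact K \<and> K \<subseteq> {- T<..0} \<and> (\<forall>t\<in>{- T<..0} - K. \<eta> t = 0 \<and> \<eta>' t = 0)"
    if Pe: "P \<eta>" and d: "\<And>t. (\<eta> has_real_derivative \<eta>' t) (at t)" for \<eta> \<eta>'
  proof -
    obtain b where b: "- T < b" "\<And>t. t \<le> b \<Longrightarrow> \<eta> t = 0" using Pe unfolding P_def by blast
    have mid: "(b - T) / 2 < b" "- T < (b - T) / 2" using b(1) by (simp_all add: field_simps)
    have "\<eta> t = 0 \<and> \<eta>' t = 0" if "t \<in> {- T<..0} - {(b - T) / 2..0}" for t
    proof -
      have "t < b" using that mid by auto
      then show ?thesis using b(2) deriv_zero_if[OF d[of t], of "{..<b}"] by auto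
    qed
    then show ?thesis using mid by (intro exI[of _ "{(b - T) / 2..0}"]) auto
  qed
  note F = regular_facts[OF reg s]
  note W = weak_to_ode[OF ti z h(2,3) F(1,3,4) sobolev_frep[OF h(1) s'(1)], of P]
  show "ode_on {- T..0} (\<lambda>t. fc (u t))" by (rule W(1)[OF _ _ _ bd steps PK])
  show "fc (u 0) k = fc u0 k" by (rule W(2)[OF _ _ _ bd steps PK])
qed

section \<open>Regularity of the data and growth of the Sobolev norms\<close>

lemma half_asummable:
  assumes "u0 \<in> sobolev s" "1 / 2 < s"
  shows "(\<lambda>k. if Q k then fc u0 k else 0) asummable_on UNIV"
  using frep_abs_summable[OF sobolev_frep[OF assms]]
  by (rule summable_on_comparison_test) auto

theorem P_plus_regular:
  assumes T: "0 < T" and s: "1 \<le> s" and sol: "solution_forward \<alpha>1 \<alpha>2 \<gamma>1 \<gamma>2 \<Gamma> T u0 u"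
    and reg: "regular_on {0..T} s u" and \<sigma>: "\<sigma> < s + 1 / 2"
  shows "P_plus u0 \<in> sobolev \<sigma>"
proof -
  obtain s' where s': "s' > 1/2" "u0 \<in> sobolev s'"
    using sol by (auto simp: solution_forward_def solution_half_open_def)
  note F = regular_facts[OF reg s] and O = forward_ode[OF T s sol reg]
  have t0: "0 \<in> {0..T}" using T by auto
  \<comment> \<open>With zero mass there is no growth rate to divide by, but then all coefficients
    at time 0 vanish and 0 is a valid bound.\<close>
  define X where "X = (if 0 < mass (fc (u 0)) then Dst (SUP t\<in>{0..T}. sobolev_norm 1 (u t)) (mass (fc (u 0))) T
      * 9 powr s * (SUP t\<in>{0..T}. sobolev_norm s (u t)) else 0)"
  have X: "jbr k powr (s + 1) * cmod (fc u0 k) \<le> X" if k: "0 < k" for k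
  proof (cases "0 < mass (fc (u 0))")
    case True
    have "jbr k powr (s + 1) * cmod (fc (u 0) k) \<le> X"
      unfolding X_def using one_step[OF T _ k O(1) F(3) F(2) mass_has_sum[OF F(3)[OF t0]] True] True s by simp
    then show ?thesis using O(2) by simp
  next
    case False
    then have "fc (u 0) k = 0" using mass_zero[OF F(3)[OF t0]] mass_nonneg[of "fc (u 0)"] by simp
    then show ?thesis using O(2)[of k] False by (simp add: X_def)
  qed
  have "0 \<le> X" using X[of 1] by (rule order_trans[rotated]) simp_all
  then show ?thesis
    unfolding P_plus_fser using X by (intro fser_sobolev[OF _ half_asummable[OF s'(2,1)] \<sigma>, of _ X]) auto
qed

text \<open>The reflection turns the past of u into a future and negative frequencies into positive
  ones; \<open>one_step\<close> then applies with the constants of the reflected system.\<close>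

theorem P_minus_regular:
  assumes T: "0 < T" and s: "1 \<le> s" and sol: "solution_backward \<alpha>1 \<alpha>2 \<gamma>1 \<gamma>2 \<Gamma> T u0 u"
    and reg: "regular_on {- T..0} s u" and \<sigma>: "\<sigma> < s + 1 / 2"
  shows "P_minus u0 \<in> sobolev \<sigma>"
proof -
  obtain s' where s': "s' > 1/2" "u0 \<in> sobolev s'"
    using sol by (auto simp: solution_backward_def solution_half_open_def)
  note F = regular_facts[OF reg s] and O = backward_ode[OF T s sol reg]
  have t0: "0 \<in> {- T..0}" using T by auto
  define X where "X = (if 0 < mass (fc (u 0)) then R.Dst (SUP t\<in>{- T..0}. sobolev_norm 1 (u t)) (mass (fc (u 0))) T
      * 9 powr s * (SUP t\<in>{- T..0}. sobolev_norm s (u t)) else 0)"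
  have im: "(\<lambda>t. 0 - t) ` {- T..0} = {0..T}"
  proof -
    have "x \<in> (\<lambda>t. 0 - t) ` {- T..0}" if "x \<in> {0..T}" for x
      using that by (intro image_eqI[of _ _ "- x"]) auto
    then show ?thesis by auto
  qed
  have RO: "R.ode_on {0..T} (\<lambda>t j. fc (u (0 - t)) (- j))" using R_ode[OF O(1), of 0] unfolding im .
  have A: "l2b (\<lambda>j. jbr j * cmod (fc (u (0 - t)) (- j))) (SUP t\<in>{- T..0}. sobolev_norm 1 (u t))"
    and H: "l2b (\<lambda>j. jbr j powr s * cmod (fc (u (0 - t)) (- j))) (SUP t\<in>{- T..0}. sobolev_norm s (u t))"
    if "t \<in> {0..T}" for t
    using l2b_comp[OF F(3)[of "0 - t"], of uminus] l2b_comp[OF F(2)[of "0 - t"], of uminus] that by auto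
  have M: "((\<lambda>j. (cmod (fc (u (0 - 0)) (- j)))\<^sup>2) has_sum mass (fc (u 0))) UNIV"
    using mass_has_sum[OF A[of 0]] T by (simp add: mass_reflect)
  have X: "jbr k powr (s + 1) * cmod (fc u0 k) \<le> X" if k: "k < 0" for k
  proof (cases "0 < mass (fc (u 0))")
    case True
    have "jbr (- k) powr (s + 1) * cmod (fc (u (0 - 0)) (- (- k))) \<le> X"
      unfolding X_def using R.one_step[OF T _ _ RO A H M True, of "- k"] True s k by simp
    then show ?thesis using O(2) by simp
  next
    case False
    then have "fc (u 0) k = 0" using mass_zero[OF F(3)[OF t0]] mass_nonneg[of "fc (u 0)"] by simp
    then show ?thesis using O(2)[of k] False by (simp add: X_def)
  qed
  have "0 \<le> X" using X[of "- 1"] by (rule order_trans[rotated]) simp_all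
  then show ?thesis
    unfolding P_minus_fser using X by (intro fser_sobolev[OF _ half_asummable[OF s'(2,1)] \<sigma>, of _ X]) auto
qed

text \<open>At t = 0 the two one-sided derivatives agree because the equation gives both the same
  value. At other times t is outside one of the two closed intervals, and differentiability within
  that interval is vacuous.\<close>

lemma ode_glue:
  assumes T: "0 < T" and p: "ode_on {0..T} c" and m: "ode_on {- T..0} c"
  shows "ode_on {- T..T} c"
  unfolding ode_on_def
proof (intro ballI allI)
  fix t j assume t: "t \<in> {- T..T}"
  let ?d = "- (\<i> * of_real (om j)) * c t j + nl (c t) j"
  have un: "{- T..T} = {- T..0} \<union> {0..T}" using T by auto
  have h: "((\<lambda>t. c t j) has_vector_derivative ?d) (at t within S)"
    if "closed S" "t \<in> S \<Longrightarrow> ((\<lambda>t. c t j) has_vector_derivative ?d) (at t within S)" for S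
  proof (cases "t \<in> S")
    case False
    then have "at t within S = bot" using that(1) by (simp add: at_within_eq_bot_iff closure_closed)
    then show ?thesis by (simp add: has_vector_derivative_def has_derivative_def bounded_linear_scaleR_left)
  qed (rule that(2))
  have "((\<lambda>t. c t j) has_vector_derivative ?d) (at t within {- T..0})"
    by (rule h[OF closed_atLeastAtMost]) (use m in \<open>unfold ode_on_def, blast\<close>)
  moreover have "((\<lambda>t. c t j) has_vector_derivative ?d) (at t within {0..T})"
    by (rule h[OF closed_atLeastAtMost]) (use p in \<open>unfold ode_on_def, blast\<close>)
  ultimately show "((\<lambda>t. c t j) has_vector_derivative ?d) (at t within {- T..T})"
    unfolding un has_vector_derivative_def has_derivative_within
    by (auto simp: at_within_union intro: filterlim_sup)
qed

lemma smoothing_sobolev: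
  assumes T: "0 < T" and ode: "ode_on {- T..T} (\<lambda>t. fc (v t))"
    and A: "\<And>t. t \<in> {- T..T} \<Longrightarrow> l2b (\<lambda>j. jbr j * cmod (fc (v t) j)) A" and \<sigma>: "1 \<le> \<sigma>"
  shows "l2b (\<lambda>j. jbr j powr \<sigma> * cmod (fourier (v 0) j))
    (if mass (fc (v 0)) = 0 then 0 else 3 * (Cst A (mass (fc (v 0))) T powr \<sigma> * (18 ^ 16) powr (\<sigma>\<^sup>2)))"
proof (cases "mass (fc (v 0)) = 0")
  case True
  have "fc (v 0) j = 0" for j by (rule mass_zero[OF A True]) (use T in auto)
  then have "cmod (fourier (v 0) j) = 0" for j unfolding norm_fc by simp
  then show ?thesis using True by (simp add: l2b_def L2_set_def)
next
  case False
  then have m: "0 < mass (fc (v 0))" using mass_nonneg[of "fc (v 0)"] by simp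
  have "l2b (\<lambda>j. sqrt (2 * pi) * (jbr j powr \<sigma> * cmod (fc (v 0) j)))
      (sqrt (2 * pi) * (Cst A (mass (fc (v 0))) T powr \<sigma> * (18 ^ 16) powr (\<sigma>\<^sup>2)))"
    by (rule l2b_scale[OF smoothing[OF T ode A m \<sigma>]]) auto
  then show ?thesis
    by (rule l2b_mono) (use False sqrt_2pi(2) in \<open>auto simp: norm_fc mult_ac intro!: mult_mono\<close>)
qed

theorem two_sided_ode:
  assumes T: "0 < T" and s: "1 \<le> s" and sol: "solution_two_sided \<alpha>1 \<alpha>2 \<gamma>1 \<gamma>2 \<Gamma> T u0 u"
    and reg: "regular_on {- T..T} s u"
  shows "ode_on {- T..T} (\<lambda>t. fc (u t))" "fc (u 0) k = fc u0 k"
proof -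
  have r: "regular_on {0..T} s u" "regular_on {- T..0} s u"
    using T by (auto intro: regular_on_subset[OF reg])
  have sol': "solution_forward \<alpha>1 \<alpha>2 \<gamma>1 \<gamma>2 \<Gamma> T u0 u" "solution_backward \<alpha>1 \<alpha>2 \<gamma>1 \<gamma>2 \<Gamma> T u0 u"
    using sol by (auto simp: solution_two_sided_def)
  show "ode_on {- T..T} (\<lambda>t. fc (u t))"
    by (rule ode_glue[OF T forward_ode(1)[OF T s sol'(1) r(1)] backward_ode(1)[OF T s sol'(2) r(2)]])
  show "fc (u 0) k = fc u0 k" by (rule forward_ode(2)[OF T s sol'(1) r(1)])
qed

text \<open>After a shift in time every interior t is the centre of a symmetric interval of radius T
  - |t|, to which the estimate at the centre applies.\<close>

theorem interior_smooth:
  assumes T: "0 < T" and s: "1 \<le> s" and sol: "solution_two_sided \<alpha>1 \<alpha>2 \<gamma>1 \<gamma>2 \<Gamma> T u0 u"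
    and reg: "regular_on {- T..T} s u" and t: "t \<in> {- T<..<T}"
  shows "u t \<in> sobolev_inf"
proof -
  note F = regular_facts[OF reg s] and O = two_sided_ode[OF T s sol reg]
  define r where "r = T - \<bar>t\<bar>"
  have r: "0 < r" using t by (auto simp: r_def)
  have sub: "{- r..r} \<subseteq> (\<lambda>x. x - t) ` {- T..T}"
  proof
    fix x assume "x \<in> {- r..r}"
    then show "x \<in> (\<lambda>x. x - t) ` {- T..T}" by (intro image_eqI[of _ _ "x + t"]) (auto simp: r_def)
  qed
  have ode: "ode_on {- r..r} (\<lambda>x. fc (u (x + t)))"
    using ode_on_subset[OF ode_shift[OF O(1), of t] sub] .
  have A: "l2b (\<lambda>j. jbr j * cmod (fc (u (x + t)) j)) (SUP t\<in>{- T..T}. sobolev_norm 1 (u t))" if "x \<in> {- r..r}" for x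
    by (rule F(3)) (use that in \<open>auto simp: r_def\<close>)
  have us: "u t \<in> sobolev s" using reg t by (auto simp: regular_on_def)
  have "u t \<in> sobolev \<sigma>" for \<sigma>
  proof -
    have "fourier (u (0 + t)) \<in> sobolev_seq (max 1 \<sigma>)"
      using smoothing_sobolev[OF r ode A, of "max 1 \<sigma>"] by (intro l2b_sobolev_seq(1)) auto
    then have "u t \<in> sobolev (max 1 \<sigma>)" using us by (simp add: sobolev_def)
    then show ?thesis by (rule sobolev_norm_mono(1)) simp
  qed
  then show ?thesis by (simp add: sobolev_inf_def)
qed

text \<open>Parseval's identity, read off from the coefficient of |u|^2 at frequency 0.\<close>

lemma mass_l2_norm:
  assumes "u \<in> sobolev 1"
  shows "(l2_norm u)\<^sup>2 = 2 * pi * mass (fc u)"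
proof -
  have r: "frep u (fc u)" by (rule sobolev_frep[OF assms]) simp
  have A: "l2b (\<lambda>j. jbr j * cmod (fc u j)) (sobolev_norm 1 u)"
    using sobolev_l2b_fc[OF assms order_refl] jbr_nonneg by simp
  have "(LINT x:torus|lebesgue. ek (- 0) x * of_real ((cmod (u x))\<^sup>2)) = of_real (2 * pi) * wsq (fc u) 0"
    by (rule frep_lint_ek[OF frep_sq[OF r]])
  then have "(LINT x:torus|lebesgue. complex_of_real ((cmod (u x))\<^sup>2)) = of_real (2 * pi * mass (fc u))"
    unfolding wsq_0[OF A] by simp
  then have "complex_of_real (LINT x:torus|lebesgue. (cmod (u x))\<^sup>2) = of_real (2 * pi * mass (fc u))"
    using set_integral_complex_of_real[of lebesgue torus "\<lambda>x. (cmod (u x))\<^sup>2"] by (simp only:)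
  then have e: "(LINT x:torus|lebesgue. (cmod (u x))\<^sup>2) = 2 * pi * mass (fc u)"
    by (simp only: of_real_eq_iff)
  show ?thesis unfolding l2_norm_def e by (simp add: mass_nonneg)
qed

text \<open>The second argument is the inverse of the L^2 norm, so that 1 / (2 pi b^2) recovers the
  mass, and the third is the inverse of T. The 3 bounds sqrt (2 pi), the ratio of the two
  normalisations of the coefficients; the maximum makes the value positive for arbitrary
  arguments.\<close>

definition C1 :: "real \<Rightarrow> real \<Rightarrow> real \<Rightarrow> real" where
  "C1 a b c = max 1 (3 * Cst a (1 / (2 * pi * b\<^sup>2)) (inverse c))"

theorem sobolev_growth:
  assumes T: "0 < T" and s: "1 \<le> s" and sol: "solution_two_sided \<alpha>1 \<alpha>2 \<gamma>1 \<gamma>2 \<Gamma> T u0 u"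
    and reg: "regular_on {- T..T} s u" and \<sigma>: "1 \<le> \<sigma>"
  shows "u0 \<in> sobolev \<sigma>" "sobolev_norm \<sigma> u0 \<le>
     C1 (SUP t\<in>{- T..T}. sobolev_norm 1 (u t)) (inverse (l2_norm u0)) (inverse T) powr \<sigma> * (18 ^ 16) powr (\<sigma>\<^sup>2)"
proof -
  note F = regular_facts[OF reg s] and O = two_sided_ode[OF T s sol reg]
  define A where "A = (SUP t\<in>{- T..T}. sobolev_norm 1 (u t))"
  define m where "m = mass (fc (u 0))"
  define C where "C = C1 A (inverse (l2_norm u0)) (inverse T)"
  obtain s' where s': "u0 \<in> sobolev s'"
    using sol by (auto simp: solution_two_sided_def solution_forward_def solution_half_open_def)
  have fu: "fourier (u 0) = fourier u0"
  proof
    fix k show "fourier (u 0) k = fourier u0 k" using O(2)[of k] by (simp add: fc_def)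
  qed
  have fcu: "fc u0 = fc (u 0)" using O(2) by (simp add: fun_eq_iff)
  note S = smoothing_sobolev[OF T O(1) F(3), unfolded fu, folded m_def A_def]
  have in_\<sigma>: "u0 \<in> sobolev \<tau>" if "1 \<le> \<tau>" for \<tau>
    using l2b_sobolev_seq(1)[OF S[OF _ that]] s' by (simp add: sobolev_def)
  show "u0 \<in> sobolev \<sigma>" by (rule in_\<sigma>[OF \<sigma>])
  have "sobolev_norm \<sigma> u0 \<le> (if m = 0 then 0 else 3 * (Cst A m T powr \<sigma> * (18 ^ 16) powr (\<sigma>\<^sup>2)))"
    unfolding sobolev_norm_def by (rule l2b_sobolev_seq(2)[OF S[OF _ \<sigma>]])
  also have "\<dots> \<le> C powr \<sigma> * (18 ^ 16) powr (\<sigma>\<^sup>2)"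
  \<comment> \<open>For zero mass the argument \<open>inverse (l2_norm u0)\<close> no longer encodes
    it, but then the left side is 0.\<close>
  proof (cases "m = 0")
    case False
    then have m: "0 < m" using mass_nonneg[of "fc (u 0)"] by (simp add: m_def)
    have "(l2_norm u0)\<^sup>2 = 2 * pi * m"
      using mass_l2_norm[OF in_\<sigma>[of 1]] by (simp add: fcu m_def)
    then have "1 / (2 * pi * (inverse (l2_norm u0))\<^sup>2) = m"
      using m by (simp add: power_inverse field_simps)
    then have C: "C = max 1 (3 * Cst A m T)" unfolding C_def C1_def by simp
    have "0 \<le> A" using F(3)[of 0] T unfolding A_def by (auto dest: l2b_const_nonneg)
    then have C0: "0 \<le> Cst A m T" unfolding Cst_def by (intro mult_nonneg_nonneg) (auto intro: zero_le_even_power)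
    \<comment> \<open>Since \<sigma> \<ge> 1, the factor 3 can be taken into the power.\<close>
    have "3 * Cst A m T powr \<sigma> \<le> 3 powr \<sigma> * Cst A m T powr \<sigma>"
      using powr_mono[OF \<sigma>, of 3] by (intro mult_right_mono) auto
    also have "\<dots> = (3 * Cst A m T) powr \<sigma>" using C0 by (simp add: powr_mult)
    also have "\<dots> \<le> C powr \<sigma>" using C0 \<sigma> unfolding C by (intro powr_mono2) auto
    finally have "3 * Cst A m T powr \<sigma> * (18 ^ 16) powr (\<sigma>\<^sup>2) \<le> C powr \<sigma> * (18 ^ 16) powr (\<sigma>\<^sup>2)"
      by (rule mult_right_mono) simp
    then show ?thesis using False by (simp only: if_False mult.assoc)
  qed simp
  finally show "sobolev_norm \<sigma> u0 \<le> C1 (SUP t\<in>{- T..T}. sobolev_norm 1 (u t)) (inverse (l2_norm u0)) (inverse T) powr \<sigma> * (18 ^ 16) powr (\<sigma>\<^sup>2)"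
    unfolding C_def A_def .
qed

lemma C1_pos: "0 < C1 a b c"
  by (simp add: C1_def)

end

theorem theorem2p2:
  fixes \<alpha>\<^sub>1 \<alpha>\<^sub>2 \<gamma>\<^sub>1 \<gamma>\<^sub>2 \<Gamma> :: real
  assumes "\<Gamma> > 0" and "\<alpha>\<^sub>1 \<noteq> 0" and "2 * \<alpha>\<^sub>2 / (3 * \<alpha>\<^sub>1) \<notin> \<int>"
  shows
    "(\<forall>s T u\<^sub>0 u. s \<ge> 1 \<and> T > 0 \<and>
        solution_forward \<alpha>\<^sub>1 \<alpha>\<^sub>2 \<gamma>\<^sub>1 \<gamma>\<^sub>2 \<Gamma> T u\<^sub>0 u \<and> regular_on {0..T} s u \<longrightarrow>
        (\<forall>\<sigma> < s + 1/2. P_plus u\<^sub>0 \<in> sobolev \<sigma>)) \<and>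
     (\<forall>s T u\<^sub>0 u. s \<ge> 1 \<and> T > 0 \<and>
        solution_backward \<alpha>\<^sub>1 \<alpha>\<^sub>2 \<gamma>\<^sub>1 \<gamma>\<^sub>2 \<Gamma> T u\<^sub>0 u \<and> regular_on {-T..0} s u \<longrightarrow>
        (\<forall>\<sigma> < s + 1/2. P_minus u\<^sub>0 \<in> sobolev \<sigma>)) \<and>
     (\<exists>(C\<^sub>1 :: real \<Rightarrow> real \<Rightarrow> real \<Rightarrow> real) (R\<^sub>1 :: real).
        (\<forall>a b c. C\<^sub>1 a b c > 0) \<and> R\<^sub>1 > 0 \<and>
        (\<forall>s T u\<^sub>0 u. s \<ge> 1 \<and> T > 0 \<and>
           solution_two_sided \<alpha>\<^sub>1 \<alpha>\<^sub>2 \<gamma>\<^sub>1 \<gamma>\<^sub>2 \<Gamma> T u\<^sub>0 u \<and> regular_on {-T..T} s u \<longrightarrow>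
           (\<forall>t \<in> {-T<..<T}. u t \<in> sobolev_inf) \<and>
           (\<forall>\<sigma> \<ge> 1. u\<^sub>0 \<in> sobolev \<sigma> \<and>
              sobolev_norm \<sigma> u\<^sub>0 \<le>
                C\<^sub>1 (SUP t\<in>{-T..T}. sobolev_norm 1 (u t)) (inverse (l2_norm u\<^sub>0)) (inverse T) powr \<sigma>
                * R\<^sub>1 powr (\<sigma>\<^sup>2))))"
proof -
  interpret raman \<alpha>\<^sub>1 \<alpha>\<^sub>2 \<gamma>\<^sub>1 \<gamma>\<^sub>2 \<Gamma> by unfold_locales (rule assms)+
  show ?thesis
    by (intro conjI exI[of _ C1] exI[of _ "18 ^ 16"] allI impI ballI; (elim conjE)?)
       (rule P_plus_regular P_minus_regular interior_smooth sobolev_growth C1_pos zero_less_power; assumption | simp)+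
qed

end
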